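(* Let $K$ be a field of characteristic $0$, let $\varepsilon\in K^\times$ be not a root of unity, let $n\ge2$ and $r\ge1$. Let $U=U(\widehat{\mathfrak{gl}}_n)_K$ be the quantum affine $\mathfrak{gl}_n$, let $S=\mathcal S_{\vartriangle}(n,r)_K=\operatorname{End}_{H}(\Omega_K^{\otimes r})$ be the affine quantum Schur algebra, where $H=\mathcal H_{\vartriangle}(r)_K$, and let $\zeta_r:U\to S$ be the natural algebra homomorphism given by the action of $U$ on the affine tensor space $\Omega_K^{\otimes r}$. Let $Z(n)$ be the commutative subalgebra of $U$ generated by the central elements $\mathsf z_m^{+},\mathsf z_m^-$ ($m\ge1$), and put $Z(n,r)=\zeta_r(Z(n))$. Then $$\zeta_r\bigl(Z(U)\bigr)=Z(n,r)=Z(S),$$ where $Z(A)$ denotes the center of an algebra $A$.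
   Context: Hecke algebra: put $q=\varepsilon^2$. $H=\mathcal H_{\vartriangle}(r)_K$ is the $K$-algebra given by generators $T_1,\dots,T_{r-1}$, $X_1^{\pm1},\dots,X_r^{\pm1}$ and relations $(T_i+1)(T_i-q)=0$; $T_iT_j=T_jT_i$ for $|i-j|>1$; $T_iT_{i+1}T_i=T_{i+1}T_iT_{i+1}$; $X_iX_i^{-1}=1=X_i^{-1}X_i$; $X_iX_j=X_jX_i$; $T_iX_iT_i=qX_{i+1}$; $X_jT_i=T_iX_j$ for $j\ne i,i+1$. Affine tensor space: $\Omega_K$ is the $K$-vector space with basis $\{\omega_i\mid i\in\mathbb Z\}$. For $\mathbf i=(i_1,\dots,i_r)\in\mathbb Z^r$ write $\omega_{\mathbf i}=\omega_{i_1}\otimes\cdots\otimes\omega_{i_r}$. The right $H$-action on $\Omega_K^{\otimes r}$ is determined by: $\omega_{\mathbf i}X_t^{-1}=\omega_{i_1}\cdots\omega_{i_{t-1}}\omega_{i_t+n}\omega_{i_{t+1}}\cdots\omega_{i_r}$ for all $\mathbf i\in\mathbb Z^r$, and, for $\mathbf i\in\{1,\dots,n\}^r$ and $1\le k\le r-1$, $\omega_{\mathbf i}T_k=\varepsilon^2\omega_{\mathbf i}$ if $i_k=i_{k+1}$; $\omega_{\mathbf i}T_k=\varepsilon\,\omega_{\mathbf is_k}$ if $i_k<i_{k+1}$; $\omega_{\mathbf i}T_k=\varepsilon\,\omega_{\mathbf is_k}+(\varepsilon^2-1)\omega_{\mathbf i}$ if $i_k>i_{k+1}$, where $\mathbf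 is_k$ is $\mathbf i$ with the $k$-th and $(k+1)$-th entries interchanged. Quantum affine $\mathfrak{gl}_n$: $U=U(\widehat{\mathfrak{gl}}_n)_K$ is the $K$-algebra with generators $E_i,F_i,K_i^{\pm1}$ ($i\in\mathbb Z/n\mathbb Z$) and $\mathsf z_m^+,\mathsf z_m^-$ ($m\ge1$), and relations: the $K_i^{\pm1}$ commute with each other and $K_iK_i^{-1}=1$; $K_iE_j=\varepsilon^{\delta_{i,j}-\delta_{i,j+1}}E_jK_i$; $K_iF_j=\varepsilon^{-\delta_{i,j}+\delta_{i,j+1}}F_jK_i$; $E_iF_j-F_jE_i=\delta_{i,j}\dfrac{\widetilde K_i-\widetilde K_i^{-1}}{\varepsilon-\varepsilon^{-1}}$ with $\widetilde K_i=K_iK_{i+1}^{-1}$; the quantum Serre relations at parameter $\varepsilon$ $\sum_{a+b=1-c_{ij}}(-1)^a\binom{1-c_{ij}}{a}_{\varepsilon}E_i^aE_jE_i^b=0$ for $i\neq j$, and the same relations with $F$ in place of $E$, where $(c_{ij})$ is the affine Cartan matrix of type $A^{(1)}_{n-1}$ (so $c_{12}=c_{21}=-2$ if $n=2$) and $\binom{\cdot}{\cdot}_\varepsilon$ is the symmetric Gaussian binomial; and all $\mathsf z_m^\pm$ are central. Action of $U$: on $\Omega_K$, with indices of $E,F,K$ taken modulo $n$ and $\delta_{i,s}=1$ iff $i\equiv s \bmod n$ (and $0$ otherwise), $E_i\omega_s=\delta_{i+1,s}\,\omega_{s-1}$, $F_i\omega_s=\delta_{i,s}\,\omega_{s+1}$,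 $K_i^{\pm1}\omega_s=\varepsilon^{\pm\delta_{i,s}}\omega_s$, $\mathsf z_m^{\pm}\omega_s=\omega_{s\mp mn}$. $U$ acts on $\Omega_K^{\otimes r}$ through the comultiplication $\Delta(E_i)=E_i\otimes\widetilde K_i+1\otimes E_i$, $\Delta(F_i)=F_i\otimes1+\widetilde K_i^{-1}\otimes F_i$, $\Delta(K_i^{\pm1})=K_i^{\pm1}\otimes K_i^{\pm1}$, $\Delta(\mathsf z_m^\pm)=\mathsf z_m^\pm\otimes1+1\otimes\mathsf z_m^\pm$. This action commutes with the right $H$-action, which gives $\zeta_r:U\to S$; by a theorem of Deng-Du-Fu, $\zeta_r$ is surjective. *)

theory Defs
  imports
    "HOL-Library.Poly_Mapping"
    "HOL-Library.FuncSet"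
    "HOL-Number_Theory.Cong"
    "HOL-Algebra.QuotRing"
    "HOL-Algebra.Subrings"
    "HOL-Algebra.Module"
begin

section \<open>Associative algebras over a field\<close>

text \<open>
  A unital associative (not necessarily commutative) algebra over the field given by the type
  \<open>'k\<close> is represented by a record of type \<open>('k, 'a) module\<close>, which provides the ring operations
  and the scalar multiplication. (The library locale \<open>algebra\<close> covers only
  commutative algebras.)
\<close>

definition alg_hom :: "('k, 'a) module \<Rightarrow> ('k, 'b) module \<Rightarrow> ('a \<Rightarrow> 'b) set" where
  "alg_hom A B = {h \<in> ring_hom A B. \<forall>c. \<forall>x\<in>carrier A. h (c \<odot>\<^bsub>A\<^esub> x) = c \<odot>\<^bsub>B\<^esub> h x}"

definition opposite_alg :: "('k, 'a) module \<Rightarrow> ('k, 'a) module" where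
  "opposite_alg A = A\<lparr>mult := (\<lambda>x y. y \<otimes>\<^bsub>A\<^esub> x)\<rparr>"

definition alg_center :: "('k, 'a) module \<Rightarrow> 'a set" where
  "alg_center A = {x \<in> carrier A. \<forall>y\<in>carrier A. x \<otimes>\<^bsub>A\<^esub> y = y \<otimes>\<^bsub>A\<^esub> x}"

definition generated_subalg :: "('k, 'a) module \<Rightarrow> 'a set \<Rightarrow> 'a set" where
  "generated_subalg A X =
     \<Inter>{B. subring B A \<and> (\<forall>c. \<forall>b\<in>B. c \<odot>\<^bsub>A\<^esub> b \<in> B) \<and> X \<subseteq> B}"

definition quotient_alg :: "('k, 'a) module \<Rightarrow> 'a set \<Rightarrow> ('k, 'a set) module" where
  "quotient_alg A I =
     \<lparr>carrier = carrier (A Quot I), mult = mult (A Quot I), one = one (A Quot I),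
      zero = zero (A Quot I), add = add (A Quot I),
      smult = (\<lambda>c X. \<Union>x\<in>X. I +>\<^bsub>A\<^esub> (c \<odot>\<^bsub>A\<^esub> x))\<rparr>"


section \<open>Finitely supported functions as vectors\<close>

definition pm_scale :: "'k::field \<Rightarrow> ('a \<Rightarrow>\<^sub>0 'k) \<Rightarrow> ('a \<Rightarrow>\<^sub>0 'k)" where
  "pm_scale c v = Poly_Mapping.map (\<lambda>x. c * x) v"

definition basis_vec :: "'a \<Rightarrow> ('a \<Rightarrow>\<^sub>0 'k::field)" where
  "basis_vec i = Poly_Mapping.single i 1"

definition linear_ext :: "('a \<Rightarrow> ('b \<Rightarrow>\<^sub>0 'k::field)) \<Rightarrow> ('a \<Rightarrow>\<^sub>0 'k) \<Rightarrow> ('b \<Rightarrow>\<^sub>0 'k)" where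
  "linear_ext f v = (\<Sum>i\<in>Poly_Mapping.keys v. pm_scale (Poly_Mapping.lookup v i) (f i))"


section \<open>Algebras given by generators and relations\<close>

text \<open>
  Words in generators form a monoid under concatenation, written additively so that the
  convolution product of \<open>Poly_Mapping\<close> on \<open>'g word \<Rightarrow>\<^sub>0 'k\<close> is the product of the free algebra.
\<close>

datatype 'g word = Word (letters: "'g list")

instantiation word :: (type) monoid_add
begin

definition zero_word :: "'a word" where
  "zero_word = Word []"

definition plus_word :: "'a word \<Rightarrow> 'a word \<Rightarrow> 'a word" where
  "plus_word u v = Word (letters u @ letters v)"

instance
  by standard (simp_all add: zero_word_def plus_word_def)

end

definition letter :: "'g \<Rightarrow> ('g word \<Rightarrow>\<^sub>0 'k::field)" where
  "letter g = Poly_Mapping.single (Word [g]) 1"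

definition free_alg :: "'g set \<Rightarrow> ('k::field, 'g word \<Rightarrow>\<^sub>0 'k) module" where
  "free_alg G =
     \<lparr>carrier = {p. \<forall>w\<in>Poly_Mapping.keys p. set (letters w) \<subseteq> G},
      mult = (*), one = 1, zero = 0, add = (+), smult = pm_scale\<rparr>"

definition presented_alg ::
    "'g set \<Rightarrow> ('g word \<Rightarrow>\<^sub>0 'k::field) set \<Rightarrow> ('k, ('g word \<Rightarrow>\<^sub>0 'k) set) module" where
  "presented_alg G R = quotient_alg (free_alg G) (Idl\<^bsub>free_alg G\<^esub> R)"

definition presented_gen ::
    "'g set \<Rightarrow> ('g word \<Rightarrow>\<^sub>0 'k::field) set \<Rightarrow> 'g \<Rightarrow> ('g word \<Rightarrow>\<^sub>0 'k) set" where
  "presented_gen G R g = (Idl\<^bsub>free_alg G\<^esub> R) +>\<^bsub>free_alg G\<^esub> letter g"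


section \<open>Affine tensor space and its endomorphism algebra\<close>

text \<open>
  The basis vector \<open>\<omega>\<^sub>s\<close> is \<open>basis_vec s :: int \<Rightarrow>\<^sub>0 'k\<close>. The \<open>r\<close>-th tensor power has the
  basis of all \<open>\<omega>\<^sub>i = basis_vec i\<close> for integer lists \<open>i\<close> of length \<open>r\<close>; the \<open>t\<close>-th tensor
  factor sits at list position \<open>t - 1\<close>.
\<close>

definition tensor_space :: "nat \<Rightarrow> (int list \<Rightarrow>\<^sub>0 'k::field) set" where
  "tensor_space r = {v. \<forall>i\<in>Poly_Mapping.keys v. length i = r}"

definition tensor_Cons ::
    "(int \<Rightarrow>\<^sub>0 'k::field) \<Rightarrow> (int list \<Rightarrow>\<^sub>0 'k) \<Rightarrow> (int list \<Rightarrow>\<^sub>0 'k)" where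
  "tensor_Cons u v = linear_ext (\<lambda>s. linear_ext (\<lambda>i. basis_vec (s # i)) v) u"

text \<open>Endomorphisms are extensional functions, so that equality of maps on the tensor space is
  equality in HOL.\<close>

definition tensor_End ::
    "nat \<Rightarrow> ('k::field, (int list \<Rightarrow>\<^sub>0 'k) \<Rightarrow> (int list \<Rightarrow>\<^sub>0 'k)) module" where
  "tensor_End r =
     \<lparr>carrier = {f \<in> tensor_space r \<rightarrow>\<^sub>E tensor_space r.
         (\<forall>u\<in>tensor_space r. \<forall>v\<in>tensor_space r. f (u + v) = f u + f v) \<and>
         (\<forall>c. \<forall>v\<in>tensor_space r. f (pm_scale c v) = pm_scale c (f v))},
      mult = compose (tensor_space r),
      one = (\<lambda>v\<in>tensor_space r. v),
      zero = (\<lambda>v\<in>tensor_space r. 0),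
      add = (\<lambda>f g. \<lambda>v\<in>tensor_space r. f v + g v),
      smult = (\<lambda>c f. \<lambda>v\<in>tensor_space r. pm_scale c (f v))\<rparr>"


section \<open>The affine Hecke algebra and its right action on tensor space\<close>

datatype hecke_gen = T_gen nat | X_gen nat | Xinv_gen nat

definition hecke_gens :: "nat \<Rightarrow> hecke_gen set" where
  "hecke_gens r = T_gen ` {1..<r} \<union> X_gen ` {1..r} \<union> Xinv_gen ` {1..r}"

definition hecke_rels :: "nat \<Rightarrow> 'k::field \<Rightarrow> (hecke_gen word \<Rightarrow>\<^sub>0 'k) set" where
  "hecke_rels r \<epsilon> =
    (let T = (\<lambda>i. letter (T_gen i)); X = (\<lambda>i. letter (X_gen i));
         Xinv = (\<lambda>i. letter (Xinv_gen i)); q = \<epsilon>^2 in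
       {(T i + 1) * (T i - pm_scale q 1) | i. i \<in> {1..<r}}
     \<union> {T i * T j - T j * T i | i j. i \<in> {1..<r} \<and> j \<in> {1..<r} \<and> \<bar>int i - int j\<bar> > 1}
     \<union> {T i * T (i+1) * T i - T (i+1) * T i * T (i+1) | i. i \<in> {1..<r} \<and> i + 1 \<in> {1..<r}}
     \<union> {X i * Xinv i - 1 | i. i \<in> {1..r}}
     \<union> {Xinv i * X i - 1 | i. i \<in> {1..r}}
     \<union> {X i * X j - X j * X i | i j. i \<in> {1..r} \<and> j \<in> {1..r}}
     \<union> {T i * X i * T i - pm_scale q (X (i+1)) | i. i \<in> {1..<r}}
     \<union> {X j * T i - T i * X j | i j. i \<in> {1..<r} \<and> j \<in> {1..r} \<and> j \<noteq> i \<and> j \<noteq> i + 1})"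

definition hecke_alg :: "nat \<Rightarrow> 'k::field \<Rightarrow> ('k, (hecke_gen word \<Rightarrow>\<^sub>0 'k) set) module" where
  "hecke_alg r \<epsilon> = presented_alg (hecke_gens r) (hecke_rels r \<epsilon>)"

definition hecke_elem :: "nat \<Rightarrow> 'k::field \<Rightarrow> hecke_gen \<Rightarrow> (hecke_gen word \<Rightarrow>\<^sub>0 'k) set" where
  "hecke_elem r \<epsilon> = presented_gen (hecke_gens r) (hecke_rels r \<epsilon>)"

definition swap_entries :: "nat \<Rightarrow> int list \<Rightarrow> int list" where
  "swap_entries k i = i[k - 1 := i ! k, k := i ! (k - 1)]"

definition hecke_T_value :: "'k::field \<Rightarrow> nat \<Rightarrow> int list \<Rightarrow> (int list \<Rightarrow>\<^sub>0 'k)" where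
  "hecke_T_value \<epsilon> k i =
     (if i ! (k - 1) = i ! k then pm_scale (\<epsilon>^2) (basis_vec i)
      else if i ! (k - 1) < i ! k then pm_scale \<epsilon> (basis_vec (swap_entries k i))
      else pm_scale \<epsilon> (basis_vec (swap_entries k i)) + pm_scale (\<epsilon>^2 - 1) (basis_vec i))"

text \<open>
  A right action of the Hecke algebra is a homomorphism into the opposite of the endomorphism
  algebra; \<open>\<rho> h v\<close> stands for \<open>v h\<close>. The formula for \<open>T\<^sub>k\<close> is imposed only for indices with all
  entries in \<open>{1..n}\<close>; these vectors generate the tensor space under the \<open>X\<^sub>t\<^sup>\<plusminus>\<^sup>1\<close>, whose commutation
  with \<open>T\<^sub>k\<close> is prescribed by the relations, so the action is uniquely determined.
\<close>

definition is_hecke_action ::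
    "nat \<Rightarrow> nat \<Rightarrow> 'k::field \<Rightarrow>
     ((hecke_gen word \<Rightarrow>\<^sub>0 'k) set \<Rightarrow> (int list \<Rightarrow>\<^sub>0 'k) \<Rightarrow> (int list \<Rightarrow>\<^sub>0 'k)) \<Rightarrow> bool" where
  "is_hecke_action n r \<epsilon> \<rho> \<longleftrightarrow>
     \<rho> \<in> alg_hom (hecke_alg r \<epsilon>) (opposite_alg (tensor_End r)) \<and>
     (\<forall>t\<in>{1..r}. \<forall>i. length i = r \<longrightarrow>
        \<rho> (hecke_elem r \<epsilon> (Xinv_gen t)) (basis_vec i)
          = basis_vec (i[t - 1 := i ! (t - 1) + int n])) \<and>
     (\<forall>k\<in>{1..<r}. \<forall>i. length i = r \<and> set i \<subseteq> {1..int n} \<longrightarrow>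
        \<rho> (hecke_elem r \<epsilon> (T_gen k)) (basis_vec i) = hecke_T_value \<epsilon> k i)"

definition hecke_action ::
    "nat \<Rightarrow> nat \<Rightarrow> 'k::field \<Rightarrow>
     (hecke_gen word \<Rightarrow>\<^sub>0 'k) set \<Rightarrow> (int list \<Rightarrow>\<^sub>0 'k) \<Rightarrow> (int list \<Rightarrow>\<^sub>0 'k)" where
  "hecke_action n r \<epsilon> =
     (THE \<rho>. \<rho> \<in> extensional (carrier (hecke_alg r \<epsilon>)) \<and> is_hecke_action n r \<epsilon> \<rho>)"

definition schur_alg ::
    "nat \<Rightarrow> nat \<Rightarrow> 'k::field \<Rightarrow> ('k, (int list \<Rightarrow>\<^sub>0 'k) \<Rightarrow> (int list \<Rightarrow>\<^sub>0 'k)) module" where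
  "schur_alg n r \<epsilon> = (tensor_End r)
     \<lparr>carrier := {f \<in> carrier (tensor_End r).
        \<forall>h\<in>carrier (hecke_alg r \<epsilon>). \<forall>v\<in>tensor_space r.
          f (hecke_action n r \<epsilon> h v) = hecke_action n r \<epsilon> h (f v)}\<rparr>"


section \<open>Quantum affine gl(n)\<close>

text \<open>Elements of \<open>\<int>/n\<int>\<close> are represented by the integers in \<open>{0..<n}\<close>.\<close>

datatype qaff_gen = E_gen int | F_gen int | K_gen int | Kinv_gen int | Zp_gen nat | Zm_gen nat

definition qaff_gens :: "nat \<Rightarrow> qaff_gen set" where
  "qaff_gens n = E_gen ` {0..<int n} \<union> F_gen ` {0..<int n}
     \<union> K_gen ` {0..<int n} \<union> Kinv_gen ` {0..<int n} \<union> Zp_gen ` {1..} \<union> Zm_gen ` {1..}"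

definition delta_mod :: "nat \<Rightarrow> int \<Rightarrow> int \<Rightarrow> int" where
  "delta_mod n i j = (if [i = j] (mod int n) then 1 else 0)"

definition next_idx :: "nat \<Rightarrow> int \<Rightarrow> int" where
  "next_idx n i = (i + 1) mod int n"

text \<open>The affine Cartan matrix of type \<open>A\<close>; the two off-diagonal contributions add up to \<open>-2\<close> when
  \<open>n = 2\<close>.\<close>

definition cartan :: "nat \<Rightarrow> int \<Rightarrow> int \<Rightarrow> int" where
  "cartan n i j = 2 * delta_mod n i j - delta_mod n i (j + 1) - delta_mod n (i + 1) j"

definition q_int :: "'k::field \<Rightarrow> nat \<Rightarrow> 'k" where
  "q_int \<epsilon> m = (\<epsilon>^m - inverse \<epsilon>^m) / (\<epsilon> - inverse \<epsilon>)"

definition q_fact :: "'k::field \<Rightarrow> nat \<Rightarrow> 'k" where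
  "q_fact \<epsilon> m = (\<Prod>k\<in>{1..m}. q_int \<epsilon> k)"

definition q_binom :: "'k::field \<Rightarrow> nat \<Rightarrow> nat \<Rightarrow> 'k" where
  "q_binom \<epsilon> m a = q_fact \<epsilon> m / (q_fact \<epsilon> a * q_fact \<epsilon> (m - a))"

definition serre_expr ::
    "'k::field \<Rightarrow> nat \<Rightarrow> ('g word \<Rightarrow>\<^sub>0 'k) \<Rightarrow> ('g word \<Rightarrow>\<^sub>0 'k) \<Rightarrow> ('g word \<Rightarrow>\<^sub>0 'k)" where
  "serre_expr \<epsilon> m x y = (\<Sum>a\<le>m. pm_scale ((-1)^a * q_binom \<epsilon> m a) (x^a * y * x^(m - a)))"

definition qaff_rels :: "nat \<Rightarrow> 'k::field \<Rightarrow> (qaff_gen word \<Rightarrow>\<^sub>0 'k) set" where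
  "qaff_rels n \<epsilon> =
    (let E = (\<lambda>i. letter (E_gen i)); F = (\<lambda>i. letter (F_gen i));
         K = (\<lambda>i. letter (K_gen i)); Kinv = (\<lambda>i. letter (Kinv_gen i));
         Kt = (\<lambda>i. K i * Kinv (next_idx n i)); Ktinv = (\<lambda>i. K (next_idx n i) * Kinv i);
         I = {0..<int n};
         Ks = K_gen ` I \<union> Kinv_gen ` I; Zs = Zp_gen ` {1..} \<union> Zm_gen ` {1..} in
       {letter g * letter h - letter h * letter g | g h. g \<in> Ks \<and> h \<in> Ks}
     \<union> {K i * Kinv i - 1 | i. i \<in> I}
     \<union> {K i * E j - pm_scale (\<epsilon> powi (delta_mod n i j - delta_mod n i (j + 1))) (E j * K i)
          | i j. i \<in> I \<and> j \<in> I}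
     \<union> {K i * F j - pm_scale (\<epsilon> powi (- delta_mod n i j + delta_mod n i (j + 1))) (F j * K i)
          | i j. i \<in> I \<and> j \<in> I}
     \<union> {E i * F j - F j * E i
          - pm_scale (of_int (delta_mod n i j) / (\<epsilon> - inverse \<epsilon>)) (Kt i - Ktinv i)
          | i j. i \<in> I \<and> j \<in> I}
     \<union> {serre_expr \<epsilon> (nat (1 - cartan n i j)) (E i) (E j) | i j. i \<in> I \<and> j \<in> I \<and> i \<noteq> j}
     \<union> {serre_expr \<epsilon> (nat (1 - cartan n i j)) (F i) (F j) | i j. i \<in> I \<and> j \<in> I \<and> i \<noteq> j}
     \<union> {letter z * letter g - letter g * letter z | z g. z \<in> Zs \<and> g \<in> qaff_gens n})"

definition qaff_alg :: "nat \<Rightarrow> 'k::field \<Rightarrow> ('k, (qaff_gen word \<Rightarrow>\<^sub>0 'k) set) module" where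
  "qaff_alg n \<epsilon> = presented_alg (qaff_gens n) (qaff_rels n \<epsilon>)"

definition qaff_elem :: "nat \<Rightarrow> 'k::field \<Rightarrow> qaff_gen \<Rightarrow> (qaff_gen word \<Rightarrow>\<^sub>0 'k) set" where
  "qaff_elem n \<epsilon> = presented_gen (qaff_gens n) (qaff_rels n \<epsilon>)"

definition central_subalg :: "nat \<Rightarrow> 'k::field \<Rightarrow> (qaff_gen word \<Rightarrow>\<^sub>0 'k) set set" where
  "central_subalg n \<epsilon> = generated_subalg (qaff_alg n \<epsilon>)
     ((\<lambda>m. qaff_elem n \<epsilon> (Zp_gen m)) ` {1..} \<union> (\<lambda>m. qaff_elem n \<epsilon> (Zm_gen m)) ` {1..})"


section \<open>The action of quantum affine gl(n) on tensor space\<close>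

fun omega_value :: "nat \<Rightarrow> 'k::field \<Rightarrow> qaff_gen \<Rightarrow> int \<Rightarrow> (int \<Rightarrow>\<^sub>0 'k)" where
  "omega_value n \<epsilon> (E_gen i) s = pm_scale (of_int (delta_mod n (i + 1) s)) (basis_vec (s - 1))"
| "omega_value n \<epsilon> (F_gen i) s = pm_scale (of_int (delta_mod n i s)) (basis_vec (s + 1))"
| "omega_value n \<epsilon> (K_gen i) s = pm_scale (\<epsilon> powi (delta_mod n i s)) (basis_vec s)"
| "omega_value n \<epsilon> (Kinv_gen i) s = pm_scale (\<epsilon> powi (- delta_mod n i s)) (basis_vec s)"
| "omega_value n \<epsilon> (Zp_gen m) s = basis_vec (s - int m * int n)"
| "omega_value n \<epsilon> (Zm_gen m) s = basis_vec (s + int m * int n)"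

text \<open>The comultiplication on generators, as a list of pure tensors of words in the generators, and
  the counit.\<close>

fun comult :: "nat \<Rightarrow> qaff_gen \<Rightarrow> (qaff_gen list \<times> qaff_gen list) list" where
  "comult n (E_gen i) = [([E_gen i], [K_gen i, Kinv_gen (next_idx n i)]), ([], [E_gen i])]"
| "comult n (F_gen i) = [([F_gen i], []), ([K_gen (next_idx n i), Kinv_gen i], [F_gen i])]"
| "comult n (K_gen i) = [([K_gen i], [K_gen i])]"
| "comult n (Kinv_gen i) = [([Kinv_gen i], [Kinv_gen i])]"
| "comult n (Zp_gen m) = [([Zp_gen m], []), ([], [Zp_gen m])]"
| "comult n (Zm_gen m) = [([Zm_gen m], []), ([], [Zm_gen m])]"

fun counit :: "qaff_gen \<Rightarrow> 'k::field" where
  "counit (K_gen i) = 1"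
| "counit (Kinv_gen i) = 1"
| "counit _ = 0"

text \<open>
  The action of a generator on the \<open>r\<close>-th tensor power, splitting off the first tensor factor by the
  comultiplication. The zeroth power carries the trivial module, so that \<open>r = 1\<close> gives the action on
  the affine space itself.
\<close>

primrec tensor_value ::
    "nat \<Rightarrow> 'k::field \<Rightarrow> nat \<Rightarrow> qaff_gen \<Rightarrow> (int list \<Rightarrow>\<^sub>0 'k) \<Rightarrow> (int list \<Rightarrow>\<^sub>0 'k)" where
  "tensor_value n \<epsilon> 0 g v = pm_scale (counit g) v"
| "tensor_value n \<epsilon> (Suc r) g v =
     linear_ext (\<lambda>i. \<Sum>(a, b)\<leftarrow>comult n g.
        tensor_Cons (foldr (\<lambda>x. linear_ext (omega_value n \<epsilon> x)) a (basis_vec (hd i)))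
                    (foldr (tensor_value n \<epsilon> r) b (basis_vec (tl i)))) v"

definition zeta ::
    "nat \<Rightarrow> nat \<Rightarrow> 'k::field \<Rightarrow>
     (qaff_gen word \<Rightarrow>\<^sub>0 'k) set \<Rightarrow> (int list \<Rightarrow>\<^sub>0 'k) \<Rightarrow> (int list \<Rightarrow>\<^sub>0 'k)" where
  "zeta n r \<epsilon> =
     (THE \<zeta>. \<zeta> \<in> extensional (carrier (qaff_alg n \<epsilon>)) \<and>
        \<zeta> \<in> alg_hom (qaff_alg n \<epsilon>) (schur_alg n r \<epsilon>) \<and>
        (\<forall>g\<in>qaff_gens n. \<forall>v\<in>tensor_space r.
           \<zeta> (qaff_elem n \<epsilon> g) v = tensor_value n \<epsilon> r g v))"

end

theory Submission
  imports Defs "HOL-Combinatorics.Permutations"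
begin

text \<open>Write \<open>\<Omega>\<close> for the affine tensor space and \<open>\<omega>\<close> for the basis vector \<open>\<omega>\<^sub>1 \<otimes> \<dots> \<otimes> \<omega>\<^sub>1\<close>. Both equalities follow from
one claim: an endomorphism \<open>f\<close> of \<open>\<Omega>\<close> that commutes with the Hecke algebra and with \<open>U\<close> lies in
\<open>Z(n,r)\<close> (\<open>commutant_central\<close>). The claim applies to \<open>f = \<zeta>(z)\<close> for a central \<open>z\<close> of \<open>U\<close> and to a central
\<open>f\<close> of \<open>S\<close>. The other inclusions are easy: the generators \<open>z\<^sub>m\<close> are central in \<open>U\<close>, and they act
as the power sums \<open>\<Sum>\<^sub>t X\<^sub>t\<^sup>m\<close>, \<open>m\<close> a nonzero integer, so every element of \<open>S\<close> commutes with them.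

For the claim put \<open>u = f \<omega>\<close>. As \<open>\<omega>\<close> is an eigenvector of \<open>K\<^sub>1\<close> for \<open>\<epsilon>\<^sup>r\<close> and \<open>\<epsilon>\<close> is not a root of
unity, only tuples with all entries congruent to \<open>1\<close> modulo \<open>n\<close> occur in \<open>u\<close>. As \<open>\<omega>\<close> is
an eigenvector of every \<open>T\<^sub>k\<close> for \<open>\<epsilon>\<^sup>2\<close>, the vector \<open>u\<close> is symmetric under permutations of the tensor
factors (\<open>T_eigenvector_symmetric\<close>). In characteristic \<open>0\<close> symmetric Laurent polynomials are polynomials in the
power sums with positive and negative exponents, hence \<open>u = \<zeta>(p) \<omega>\<close> with \<open>p\<close> in \<open>Z(n)\<close> (\<open>symmetric_in_orbit\<close>).

It remains to see that a map \<open>g\<close> commuting with all \<open>E\<^sub>j\<close>, \<open>X\<^sub>t\<close> and \<open>T\<^sub>k\<close> and killing \<open>\<omega>\<close> is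
zero (\<open>commuting_map_zero\<close>); it is applied to \<open>g = f - \<zeta>(p)\<close>. By the Hecke action only \<open>\<omega>\<^sub>i\<close> with entries in \<open>{1..n}\<close>
matter, and the order of the entries does not, so one can induct on the sum of the entries. If
\<open>j + 1\<close> is an entry, arrange \<open>i\<close> as \<open>a\<close> entries \<open>j\<close>, then \<open>b > 0\<close> entries \<open>j + 1\<close>, then the rest. Iterated
\<open>q\<close>-commutators of all \<open>E\<close>'s give an operator of imaginary weight (\<open>split_op\<close>), which acts on \<open>\<omega>\<^sub>i\<close> as
\<open>X\<^sub>1 + \<dots> + X\<^sub>a - \<epsilon>\<^sup>2 (X\<^bsub>a+1\<^esub> + \<dots> + X\<^bsub>a+b\<^esub>)\<close>. Hence \<open>g \<omega>\<^sub>i\<close> satisfies the same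
equation, and this equation forces all tuples in \<open>g \<omega>\<^sub>i\<close> to have the same pattern of residues \<open>j\<close> and \<open>j + 1\<close> as \<open>i\<close>
(\<open>eigen_prefix\<close>). On vectors with this pattern \<open>E\<^sub>j\<close> is injective (\<open>E_injective_prefix\<close>), whereas \<open>E\<^sub>j \<omega>\<^sub>i\<close> is a
combination of \<open>\<omega>\<^sub>l\<close> with smaller sum, so that \<open>E\<^sub>j (g \<omega>\<^sub>i) = g (E\<^sub>j \<omega>\<^sub>i) = 0\<close> by induction. Therefore \<open>g \<omega>\<^sub>i = 0\<close>.

The objects of the theorem are defined by universal properties, so that both actions also have to be
constructed. Here the operators are written down explicitly on \<open>\<Omega>\<close>, the defining
relations are verified for them, and uniqueness identifies them with the given \<open>hecke_action\<close> and \<open>zeta\<close>.\<close>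

section \<open>Linear maps between spaces of finitely supported functions\<close>

notation pm_scale (infixr "\<cdot>" 75)

lemma lookup_pm_scale [simp]: "Poly_Mapping.lookup (c \<cdot> v) i = c * Poly_Mapping.lookup v i"
  by (simp add: pm_scale_def Poly_Mapping.map.rep_eq when_def)

lemma lookup_basis_vec: "Poly_Mapping.lookup (basis_vec i) j = (if i = j then 1 else 0)"
  by (simp add: basis_vec_def lookup_single when_def)

lemmas pm_lookup = lookup_add lookup_minus lookup_basis_vec

lemma pm_scale_simps [simp]:
  "c \<cdot> d \<cdot> v = (c * d) \<cdot> v" "1 \<cdot> v = v" "0 \<cdot> v = 0" "c \<cdot> (0 :: _ \<Rightarrow>\<^sub>0 'k::field) = 0"
  "c \<cdot> (- v) = - (c \<cdot> v)" "(- 1) \<cdot> v = - v"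
  by (auto intro!: poly_mapping_eqI simp: pm_lookup)

lemma pm_scale_distrib:
  "c \<cdot> (u + v) = c \<cdot> u + c \<cdot> v" "c \<cdot> (u - v) = c \<cdot> u - c \<cdot> v"
  "(c + d) \<cdot> v = c \<cdot> v + d \<cdot> v" "(c - d) \<cdot> v = c \<cdot> v - d \<cdot> v"
  by (auto intro!: poly_mapping_eqI simp: pm_lookup algebra_simps)

lemma pm_scale_sum: "c \<cdot> sum f A = (\<Sum>i\<in>A. c \<cdot> f i)"
  by (rule poly_mapping_eqI) (simp add: lookup_sum sum_distrib_left)

lemma pm_scale_eq_0_iff [simp]: "c \<cdot> v = 0 \<longleftrightarrow> c = 0 \<or> v = 0"
  by (auto simp: poly_mapping_eq_iff fun_eq_iff)

lemma pm_scale_cancel: "c \<noteq> 0 \<Longrightarrow> c \<cdot> u = c \<cdot> v \<longleftrightarrow> u = v"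
  by (auto simp: poly_mapping_eq_iff fun_eq_iff)

lemma keys_basis_vec [simp]: "Poly_Mapping.keys (basis_vec i :: _ \<Rightarrow>\<^sub>0 'k::field) = {i}"
  by (simp add: basis_vec_def)

definition lin :: "(('a \<Rightarrow>\<^sub>0 'k::field) \<Rightarrow> ('b \<Rightarrow>\<^sub>0 'k)) \<Rightarrow> bool" where
  "lin F \<longleftrightarrow> (\<forall>u v. F (u + v) = F u + F v) \<and> (\<forall>c v. F (c \<cdot> v) = c \<cdot> F v)"

lemma lin_add: "lin F \<Longrightarrow> F (u + v) = F u + F v"
  and lin_scale: "lin F \<Longrightarrow> F (c \<cdot> v) = c \<cdot> F v"
  by (auto simp: lin_def)

lemma lin_zero: "lin F \<Longrightarrow> F 0 = 0"
  using lin_scale[of F 0 0] by simp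

lemma lin_uminus: "lin F \<Longrightarrow> F (- v) = - F v"
  using lin_scale[of F "-1" v] by simp

lemma lin_diff: "lin F \<Longrightarrow> F (u - v) = F u - F v"
  using lin_add[of F u "- v"] lin_uminus[of F v] by simp

lemma lin_sum: "lin F \<Longrightarrow> F (sum f A) = (\<Sum>i\<in>A. F (f i))"
  by (induction A rule: infinite_finite_induct) (auto simp: lin_zero lin_add)

lemmas lin_rules = lin_add lin_scale lin_zero lin_uminus lin_diff lin_sum

named_theorems lin_intro

lemma lin_ident [lin_intro]: "lin (\<lambda>v. v)"
  and lin_const_zero [lin_intro]: "lin (\<lambda>v. 0)"
  by (auto simp: lin_def)

lemma lin_plus [lin_intro]: "lin F \<Longrightarrow> lin G \<Longrightarrow> lin (\<lambda>v. F v + G v)"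
  and lin_minus [lin_intro]: "lin F \<Longrightarrow> lin G \<Longrightarrow> lin (\<lambda>v. F v - G v)"
  and lin_neg [lin_intro]: "lin F \<Longrightarrow> lin (\<lambda>v. - F v)"
  and lin_cscale [lin_intro]: "lin F \<Longrightarrow> lin (\<lambda>v. c \<cdot> F v)"
  by (auto simp: lin_def pm_scale_distrib mult.commute)

lemma lin_sumI [lin_intro]: "(\<And>i. i \<in> A \<Longrightarrow> lin (F i)) \<Longrightarrow> lin (\<lambda>v. \<Sum>i\<in>A. F i v)"
  by (induction A rule: infinite_finite_induct) (auto intro: lin_intro)

lemma lin_if [lin_intro]: "lin F \<Longrightarrow> lin G \<Longrightarrow> lin (\<lambda>v. if b then F v else G v)"
  by (cases b) auto

lemma lin_compose: "lin F \<Longrightarrow> lin G \<Longrightarrow> lin (\<lambda>v. F (G v))"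
  by (auto simp: lin_def)

lemma linear_ext_superset:
  assumes "finite A" "Poly_Mapping.keys v \<subseteq> A"
  shows "linear_ext f v = (\<Sum>i\<in>A. Poly_Mapping.lookup v i \<cdot> f i)"
  unfolding linear_ext_def
  by (rule sum.mono_neutral_left) (use assms in \<open>auto simp: in_keys_iff\<close>)

lemma lin_linear_ext: "lin (linear_ext f)"
  unfolding lin_def
proof safe
  fix u v :: "'a \<Rightarrow>\<^sub>0 'b" and c
  let ?A = "Poly_Mapping.keys u \<union> Poly_Mapping.keys v"
  have "Poly_Mapping.keys (u + v) \<subseteq> ?A" "Poly_Mapping.keys (c \<cdot> v) \<subseteq> ?A"
    by (auto simp: in_keys_iff lookup_add)
  then show "linear_ext f (u + v) = linear_ext f u + linear_ext f v"
      "linear_ext f (c \<cdot> v) = c \<cdot> linear_ext f v"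
    by (simp_all add: linear_ext_superset[of ?A] lookup_add pm_scale_distrib sum.distrib pm_scale_sum)
qed

lemma lin_linear_ext' [lin_intro]: "lin G \<Longrightarrow> lin (\<lambda>v. linear_ext f (G v))"
  by (rule lin_compose[OF lin_linear_ext])

lemma linear_ext_basis [simp]: "linear_ext f (basis_vec i) = f i"
  by (simp add: linear_ext_def lookup_basis_vec)

lemma basis_expansion:
  assumes "finite A" "Poly_Mapping.keys v \<subseteq> A"
  shows "v = (\<Sum>i\<in>A. Poly_Mapping.lookup v i \<cdot> basis_vec i)"
proof (rule poly_mapping_eqI)
  fix j
  have "(\<Sum>i\<in>A. Poly_Mapping.lookup v i * (if i = j then 1 else 0)) =
      (if j \<in> A then Poly_Mapping.lookup v j else 0)"
    using assms by (simp add: if_distrib cong: if_cong)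
  then show "Poly_Mapping.lookup v j =
      Poly_Mapping.lookup (\<Sum>i\<in>A. Poly_Mapping.lookup v i \<cdot> basis_vec i) j"
    using assms by (auto simp: lookup_sum lookup_basis_vec in_keys_iff)
qed

text \<open>The vectors supported on indices with property \<open>Q\<close>. All subspaces below, including the
tensor spaces, are of this form, so that \<open>sp_induct\<close> reduces linear statements to basis vectors.\<close>
definition sp :: "('a \<Rightarrow> bool) \<Rightarrow> ('a \<Rightarrow>\<^sub>0 'k::field) set" where
  "sp Q = {v. \<forall>i\<in>Poly_Mapping.keys v. Q i}"

lemma tensor_space_eq_sp: "tensor_space r = sp (\<lambda>i. length i = r)"
  by (simp add: tensor_space_def sp_def)

lemma sp_UNIV [simp]: "v \<in> sp (\<lambda>i. True)"
  by (simp add: sp_def)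

lemma sp_0 [simp]: "0 \<in> sp Q"
  and sp_basis [simp]: "basis_vec i \<in> sp Q \<longleftrightarrow> Q i"
  by (auto simp: sp_def)

lemma sp_add [intro]: "u \<in> sp Q \<Longrightarrow> v \<in> sp Q \<Longrightarrow> u + v \<in> sp Q"
  and sp_diff [intro]: "u \<in> sp Q \<Longrightarrow> v \<in> sp Q \<Longrightarrow> u - v \<in> sp Q"
  and sp_scale [intro]: "v \<in> sp Q \<Longrightarrow> c \<cdot> v \<in> sp Q"
  and sp_uminus [intro]: "v \<in> sp Q \<Longrightarrow> - v \<in> sp Q"
  by (fastforce simp: sp_def in_keys_iff lookup_add lookup_minus)+

lemma sp_sum [intro]: "(\<And>i. i \<in> A \<Longrightarrow> f i \<in> sp Q) \<Longrightarrow> sum f A \<in> sp Q"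
  by (induction A rule: infinite_finite_induct) auto

lemma sp_expansion:
  "v = (\<Sum>i\<in>Poly_Mapping.keys v. Poly_Mapping.lookup v i \<cdot> basis_vec i)"
  by (rule basis_expansion) auto

lemma sp_induct [consumes 1, case_names zero add scale basis]:
  assumes "v \<in> sp Q" "P 0" "\<And>u v. P u \<Longrightarrow> P v \<Longrightarrow> P (u + v)" "\<And>c v. P v \<Longrightarrow> P (c \<cdot> v)"
    "\<And>i. Q i \<Longrightarrow> P (basis_vec i)"
  shows "P v"
proof -
  have "A \<subseteq> Poly_Mapping.keys v \<Longrightarrow> finite A \<Longrightarrow>
      P (\<Sum>i\<in>A. Poly_Mapping.lookup v i \<cdot> basis_vec i)" for A
    by (rotate_tac 1, induction A rule: finite_induct)
      (use assms in \<open>auto simp: sp_def\<close>)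
  then show ?thesis
    by (subst sp_expansion) auto
qed

lemma lin_maps_sp:
  assumes "lin F" "v \<in> sp Q" "\<And>i. Q i \<Longrightarrow> F (basis_vec i) \<in> sp Q'"
  shows "F v \<in> sp Q'"
  using assms(2) by (induction rule: sp_induct) (use assms in \<open>auto simp: lin_rules\<close>)

lemma lin_eq_on_sp:
  assumes "lin F" "lin G" "\<And>i. Q i \<Longrightarrow> F (basis_vec i) = G (basis_vec i)" "v \<in> sp Q"
  shows "F v = G v"
  using assms(4) by (induction rule: sp_induct) (use assms in \<open>auto simp: lin_rules\<close>)

lemma lin_eqI:
  assumes "lin F" "lin G" "\<And>i. F (basis_vec i) = G (basis_vec i)"
  shows "F v = G v"
  by (rule lin_eq_on_sp[OF assms(1,2), where Q = "\<lambda>_. True"]) (use assms in auto)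

section \<open>Splitting off the first tensor factor\<close>

text \<open>\<open>cns s v\<close> is \<open>\<omega>\<^sub>s \<otimes> v\<close>. Together with its left inverse \<open>part s\<close>, which extracts the
coefficient of \<open>\<omega>\<^sub>s\<close> in the first factor, it allows induction on the number of tensor factors.\<close>
definition cns :: "int \<Rightarrow> (int list \<Rightarrow>\<^sub>0 'k::field) \<Rightarrow> (int list \<Rightarrow>\<^sub>0 'k)" where
  "cns s = linear_ext (\<lambda>i. basis_vec (s # i))"

lemma lin_cns: "lin (cns s)"
  by (simp add: cns_def lin_linear_ext)

lemma lin_cns' [lin_intro]: "lin G \<Longrightarrow> lin (\<lambda>v. cns s (G v))"
  by (rule lin_compose[OF lin_cns])

lemmas cns_lin [simp] = lin_rules[OF lin_cns]

lemma cns_basis [simp]: "cns s (basis_vec i) = basis_vec (s # i)"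
  by (simp add: cns_def)

definition part :: "int \<Rightarrow> (int list \<Rightarrow>\<^sub>0 'k::field) \<Rightarrow> (int list \<Rightarrow>\<^sub>0 'k)" where
  "part s = linear_ext (\<lambda>i. if i \<noteq> [] \<and> hd i = s then basis_vec (tl i) else 0)"

lemma lin_part: "lin (part s)"
  by (simp add: part_def lin_linear_ext)

lemma lin_part' [lin_intro]: "lin G \<Longrightarrow> lin (\<lambda>v. part s (G v))"
  by (rule lin_compose[OF lin_part])

lemmas part_lin [simp] = lin_rules[OF lin_part]

lemma part_cns: "part s (cns t v) = (if s = t then v else 0)"
  by (rule lin_eqI) (auto intro!: lin_intro simp: part_def)

lemma cns_eq_0_iff [simp]: "cns s v = 0 \<longleftrightarrow> v = 0"
  by (metis part_cns cns_lin(3) part_lin(3))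

lemma lookup_part: "Poly_Mapping.lookup (part s v) i = Poly_Mapping.lookup v (s # i)"
proof -
  have "v \<in> sp (\<lambda>_. True)" by simp
  then show ?thesis
  proof (induction rule: sp_induct)
    case (basis j)
    then show ?case by (cases j) (auto simp: part_def lookup_basis_vec)
  qed (auto simp: lookup_add)
qed

lemma keys_part: "i \<in> Poly_Mapping.keys (part s v) \<longleftrightarrow> s # i \<in> Poly_Mapping.keys v"
  by (simp add: in_keys_iff lookup_part)

lemma eq_by_parts:
  assumes "v \<in> tensor_space (Suc r)" "w \<in> tensor_space (Suc r)" "\<And>s. part s v = part s w"
  shows "v = w"
proof (rule poly_mapping_eqI)
  fix i show "Poly_Mapping.lookup v i = Poly_Mapping.lookup w i"
  proof (cases i)
    case Nil
    then have "i \<notin> Poly_Mapping.keys v" "i \<notin> Poly_Mapping.keys w"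
      using assms(1,2) by (auto simp: tensor_space_def)
    then show ?thesis by (simp add: in_keys_iff)
  next
    case (Cons s i')
    then show ?thesis by (metis assms(3) lookup_part)
  qed
qed

lemma part_in_tensor_space [simp]: "v \<in> tensor_space (Suc r) \<Longrightarrow> part s v \<in> tensor_space r"
  by (fastforce simp: tensor_space_def keys_part)

lemma cns_in_tensor_space [simp]: "v \<in> tensor_space r \<Longrightarrow> cns s v \<in> tensor_space (Suc r)"
  unfolding tensor_space_eq_sp by (rule lin_maps_sp[OF lin_cns]) auto

text \<open>A vector involves only finitely many \<open>\<omega>\<^sub>s\<close> in its first factor. This finiteness is what later
forbids nonzero solutions of shift equations.\<close>
lemma finite_parts: "finite {s. part s v \<noteq> 0}"
proof -
  have "{s. part s v \<noteq> 0} \<subseteq> hd ` Poly_Mapping.keys v"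
  proof
    fix s assume "s \<in> {s. part s v \<noteq> 0}"
    then obtain i where "Poly_Mapping.lookup (part s v) i \<noteq> 0"
      by (auto simp: poly_mapping_eq_iff fun_eq_iff)
    then have "s # i \<in> Poly_Mapping.keys v" by (simp add: lookup_part in_keys_iff)
    then show "s \<in> hd ` Poly_Mapping.keys v" by force
  qed
  then show ?thesis by (rule finite_subset) simp
qed

lemma tensor_Cons_basis: "tensor_Cons (basis_vec s) v = cns s v"
  by (simp add: tensor_Cons_def cns_def)

lemma lin_tensor_Cons_left: "lin (\<lambda>u. tensor_Cons u v)"
  by (simp add: tensor_Cons_def lin_linear_ext)

lemma linear_ext_vec_lin: "(\<And>i. lin (F i)) \<Longrightarrow> lin (\<lambda>v. linear_ext (\<lambda>i. F i v) u)"
  unfolding linear_ext_def by (auto intro!: lin_intro)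

section \<open>The operators on tensor space\<close>

text \<open>The operators are defined on finitely supported functions on all integer lists at once; they preserve
the length of lists and so restrict to every tensor power.\<close>
locale affine_params =
  fixes \<epsilon> :: "'k::field_char_0" and n :: nat
  assumes eps_nonzero: "\<epsilon> \<noteq> 0" and eps_not_root: "\<And>m. m \<ge> 1 \<Longrightarrow> \<epsilon> ^ m \<noteq> 1" and n_ge_2: "n \<ge> 2"
begin

definition cong_n :: "int \<Rightarrow> int \<Rightarrow> bool" where
  "cong_n s j \<longleftrightarrow> int n dvd s - j"

text \<open>The eigenvalue of \<open>K\<^sub>j K\<^bsub>j+1\<^esub>\<^sup>-\<^sup>1\<close> on \<open>\<omega>\<^sub>s\<close>.\<close>
definition kv :: "int \<Rightarrow> int \<Rightarrow> 'k" where
  "kv j s = (if cong_n s j then \<epsilon> else 1) * (if cong_n s (j + 1) then inverse \<epsilon> else 1)"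

text \<open>The group-like operator acting on every tensor factor \<open>\<omega>\<^sub>s\<close> by the scalar \<open>c s\<close>.\<close>
definition diag :: "(int \<Rightarrow> 'k) \<Rightarrow> (int list \<Rightarrow>\<^sub>0 'k) \<Rightarrow> (int list \<Rightarrow>\<^sub>0 'k)" where
  "diag c = linear_ext (\<lambda>i. prod_list (map c i) \<cdot> basis_vec i)"

text \<open>The values of \<open>E\<^sub>j\<close>, \<open>F\<^sub>j\<close> and of the primitive elements \<open>z\<^sub>m\<close> (with \<open>m < 0\<close> for the negative family) on basis
vectors: the comultiplication splits off the first tensor factor.\<close>
primrec valE :: "int \<Rightarrow> int list \<Rightarrow> (int list \<Rightarrow>\<^sub>0 'k)" where
  "valE j [] = 0"
| "valE j (s # i) = (if cong_n s (j + 1) then cns (s - 1) (diag (kv j) (basis_vec i)) else 0)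
     + cns s (valE j i)"

primrec valF :: "int \<Rightarrow> int list \<Rightarrow> (int list \<Rightarrow>\<^sub>0 'k)" where
  "valF j [] = 0"
| "valF j (s # i) = (if cong_n s j then cns (s + 1) (basis_vec i) else 0)
     + inverse (kv j s) \<cdot> cns s (valF j i)"

primrec valZ :: "int \<Rightarrow> int list \<Rightarrow> (int list \<Rightarrow>\<^sub>0 'k)" where
  "valZ m [] = 0"
| "valZ m (s # i) = cns (s - m * int n) (basis_vec i) + cns s (valZ m i)"

definition "opE j = linear_ext (valE j)"
definition "opF j = linear_ext (valF j)"
definition "opZ m = linear_ext (valZ m)"

definition xop :: "nat \<Rightarrow> int \<Rightarrow> (int list \<Rightarrow>\<^sub>0 'k) \<Rightarrow> (int list \<Rightarrow>\<^sub>0 'k)" where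
  "xop t c = linear_ext (\<lambda>i. basis_vec (i[t := i ! t + c]))"

text \<open>Every integer is \<open>a = res a - n * lev a\<close> with \<open>res a\<close> in \<open>{1..n}\<close>, so that \<open>\<omega>\<^sub>a = \<omega>\<^bsub>res a\<^esub> X\<^bsup>lev a\<^esup>\<close>.\<close>
definition res :: "int \<Rightarrow> int" where
  "res a = (a - 1) mod int n + 1"

definition lev :: "int \<Rightarrow> int" where
  "lev a = - ((a - 1) div int n)"

text \<open>\<open>T2 a b v\<close> is \<open>(\<omega>\<^sub>a \<otimes> \<omega>\<^sub>b) T\<^sub>1 \<otimes> v\<close>. The first line is the rule for entries in \<open>{1..n}\<close>, moved by the
levels. The two sums, of which at most one is nonempty, are the correction that arises from pushing \<open>T\<^sub>1\<close> through
the powers \<open>lev a\<close> and \<open>lev b\<close> of \<open>X\<^sub>1\<close> and \<open>X\<^sub>2\<close>.\<close>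
definition T2 :: "int \<Rightarrow> int \<Rightarrow> (int list \<Rightarrow>\<^sub>0 'k) \<Rightarrow> (int list \<Rightarrow>\<^sub>0 'k)" where
  "T2 a b v = (if res a = res b then \<epsilon>^2 else \<epsilon>) \<cdot> cns b (cns a v)
     + (if res a > res b then (\<epsilon>^2 - 1) \<cdot> cns (res a - int n * lev b) (cns (res b - int n * lev a) v) else 0)
     + (\<epsilon>^2 - 1) \<cdot> ((\<Sum>u\<in>{lev a..<lev b}. cns (res a - int n * u) (cns (res b - int n * (lev a + lev b - u)) v))
       - (\<Sum>u\<in>{lev b..<lev a}. cns (res a - int n * u) (cns (res b - int n * (lev a + lev b - u)) v)))"

fun valT :: "nat \<Rightarrow> int list \<Rightarrow> (int list \<Rightarrow>\<^sub>0 'k)" where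
  "valT 0 (a # b # i) = T2 a b (basis_vec i)"
| "valT (Suc k) (s # i) = cns s (valT k i)"
| "valT _ _ = 0"

definition "opT k = linear_ext (valT k)"

lemma lin_ops: "lin (diag d)" "lin (opE j)" "lin (opF j)" "lin (opZ m)" "lin (xop t c)" "lin (opT k)"
  by (simp_all add: diag_def opE_def opF_def opZ_def xop_def opT_def lin_linear_ext)

lemma lin_ops' [lin_intro]:
  "lin G \<Longrightarrow> lin (\<lambda>v. diag d (G v))" "lin G \<Longrightarrow> lin (\<lambda>v. opE j (G v))"
  "lin G \<Longrightarrow> lin (\<lambda>v. opF j (G v))" "lin G \<Longrightarrow> lin (\<lambda>v. opZ m (G v))"
  "lin G \<Longrightarrow> lin (\<lambda>v. xop t' c' (G v))" "lin G \<Longrightarrow> lin (\<lambda>v. opT k (G v))"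
  by (rule lin_compose[OF lin_ops(1)] lin_compose[OF lin_ops(2)] lin_compose[OF lin_ops(3)]
    lin_compose[OF lin_ops(4)] lin_compose[OF lin_ops(5)] lin_compose[OF lin_ops(6)]; assumption)+

lemmas ops_lin [simp] = lin_rules[OF lin_ops(1)] lin_rules[OF lin_ops(2)] lin_rules[OF lin_ops(3)]
  lin_rules[OF lin_ops(4)] lin_rules[OF lin_ops(5)] lin_rules[OF lin_ops(6)]

lemma diag_cns [simp]: "diag c (cns s v) = c s \<cdot> cns s (diag c v)"
  by (rule lin_eqI) (auto intro!: lin_intro simp: diag_def)

lemma diag_diag [simp]: "diag c (diag d v) = diag (\<lambda>s. c s * d s) v"
proof (rule lin_eqI[where F = "\<lambda>v. diag c (diag d v)"])
  fix i show "diag c (diag d (basis_vec i)) = diag (\<lambda>s. c s * d s) (basis_vec i)"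
    by (induction i) (simp_all flip: cns_basis add: mult_ac, simp add: diag_def)
qed (intro lin_intro)+

lemma opE_cns [simp]: "opE j (cns s v) = (if cong_n s (j + 1) then cns (s - 1) (diag (kv j) v) else 0) + cns s (opE j v)"
  by (rule lin_eqI) (auto intro!: lin_intro simp: opE_def)

lemma opF_cns [simp]: "opF j (cns s v) = (if cong_n s j then cns (s + 1) v else 0) + inverse (kv j s) \<cdot> cns s (opF j v)"
  by (rule lin_eqI) (auto intro!: lin_intro simp: opF_def)

lemma opZ_cns [simp]: "opZ m (cns s v) = cns (s - m * int n) v + cns s (opZ m v)"
  by (rule lin_eqI) (auto intro!: lin_intro simp: opZ_def)

lemma xop_cns [simp]: "xop 0 c (cns s v) = cns (s + c) v" "xop (Suc t) c (cns s v) = cns s (xop t c v)"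
  by (rule lin_eqI; auto intro!: lin_intro simp: xop_def)+

lemma lin_T2 [lin_intro]: "lin G \<Longrightarrow> lin (\<lambda>v. T2 a b (G v))"
  unfolding T2_def by (intro lin_intro)

lemma opT_cns [simp]: "opT 0 (cns a (cns b v)) = T2 a b v" "opT (Suc k) (cns s v) = cns s (opT k v)"
  by (rule lin_eqI; auto intro!: lin_intro simp: opT_def)+

lemma ops_Nil [simp]:
  "opE j (basis_vec []) = 0" "opF j (basis_vec []) = 0" "opZ m (basis_vec []) = 0"
  "diag c (basis_vec []) = basis_vec []"
  by (simp_all add: opE_def opF_def opZ_def diag_def)

lemma xop_basis: "xop t c (basis_vec i) = basis_vec (i[t := i ! t + c])"
  by (simp add: xop_def)

lemma xop_xop [simp]: "xop t c (xop t d v) = xop t (d + c) v"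
proof (rule lin_eqI[where F = "\<lambda>v. xop t c (xop t d v)"])
  fix i show "xop t c (xop t d (basis_vec i)) = xop t (d + c) (basis_vec i)"
    by (cases "t < length i") (simp_all add: xop_basis add.assoc list_update_beyond)
qed (intro lin_intro)+

lemma xop_0 [simp]: "xop t 0 v = v"
  by (rule lin_eqI) (auto intro!: lin_intro simp: xop_basis)

lemma xop_commute: "xop t c (xop u d v) = xop u d (xop t c v)"
proof (cases "t = u")
  case True
  then show ?thesis by (simp add: add.commute[of c d])
next
  case False
  show ?thesis
    by (rule lin_eqI) (use False in \<open>auto intro!: lin_intro simp: xop_basis list_update_swap\<close>)
qed

lemma xop_inj: "xop t c v = xop t c w \<longleftrightarrow> v = w"
  by (metis xop_0 xop_xop add.right_inverse)

lemma xop_eq_0_iff [simp]: "xop t c v = 0 \<longleftrightarrow> v = 0"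
  by (metis xop_inj lin_zero lin_ops(5))

lemma T2_base:
  assumes "1 \<le> a" "a \<le> int n" "1 \<le> b" "b \<le> int n"
  shows "T2 a b v = (if a = b then \<epsilon>^2 else \<epsilon>) \<cdot> cns b (cns a v)
     + (if a > b then (\<epsilon>^2 - 1) \<cdot> cns a (cns b v) else 0)"
  using assms by (simp add: T2_def res_def lev_def div_pos_pos_trivial)

text \<open>A property that is invariant under shifts by \<open>n\<close> need only be checked on \<open>{1..n}\<close>.\<close>
lemma int_shift_induct:
  assumes "\<And>a. 1 \<le> a \<Longrightarrow> a \<le> int n \<Longrightarrow> P a" "\<And>a. P (a - int n) \<longleftrightarrow> P a"
  shows "P a"
proof -
  have *: "P (a - int n * int m) \<longleftrightarrow> P a" for a m
  proof (induction m)
    case (Suc m)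
    show ?case using assms(2)[of "a - int n * int m"] Suc by (simp add: algebra_simps)
  qed simp
  have **: "P (a - int n * z) \<longleftrightarrow> P a" for a z
  proof (cases "z \<ge> 0")
    case True then show ?thesis using *[of a "nat z"] by simp
  next
    case False then show ?thesis using *[of "a - int n * z" "nat (- z)"] by simp
  qed
  have "a - int n * ((a - 1) div int n) = (a - 1) mod int n + 1"
    by (simp add: minus_mult_div_eq_mod [symmetric])
  moreover have "1 \<le> (a - 1) mod int n + 1" "(a - 1) mod int n + 1 \<le> int n"
    using n_ge_2 by (simp_all add: add1_zle_eq)
  ultimately show ?thesis using ** assms(1) by metis
qed

lemma res_shift: "res (a - int n) = res a" and lev_shift: "lev (a - int n) = lev a + 1"
proof -
  have "(a - int n - 1) = (a - 1) + (- 1) * int n" by simp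
  then show "res (a - int n) = res a" "lev (a - int n) = lev a + 1"
    unfolding res_def lev_def using n_ge_2 by (simp_all only: mod_mult_self1) (subst div_mult_self1, simp_all)
qed

lemma res_lev: "res a - int n * lev a = a"
  by (simp add: res_def lev_def)

text \<open>The Bernstein relation \<open>X\<^sub>1 T\<^sub>1 = T\<^sub>1 X\<^sub>2 - (\<epsilon>\<^sup>2 - 1) X\<^sub>2\<close> for right operators: raising \<open>lev a\<close> by one changes the
sums in \<open>T2\<close> by a single term.\<close>
lemma T2_shift_left:
  "T2 (a - int n) b v = xop (Suc 0) (- int n) (T2 a b v) - (\<epsilon>^2 - 1) \<cdot> cns a (cns (b - int n) v)"
proof (cases "lev a < lev b")
  case True
  then have "{lev a..<lev b} = insert (lev a) {lev a + 1..<lev b}" "{lev b..<lev a} = {}" "{lev b..<lev a + 1} = {}"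
    by auto
  then show ?thesis
    using res_lev[of a] res_lev[of b]
    by (simp add: T2_def res_shift lev_shift pm_scale_distrib algebra_simps)
next
  case False
  then have "{lev b..<lev a + 1} = insert (lev a) {lev b..<lev a}" "{lev a..<lev b} = {}" "{lev a + 1..<lev b} = {}"
    by auto
  then show ?thesis
    using res_lev[of a] res_lev[of b]
    by (simp add: T2_def res_shift lev_shift pm_scale_distrib algebra_simps)
qed

lemma sum_int_shift: "(\<Sum>u\<in>{x..<y::int}. g (u + 1)) = (\<Sum>u\<in>{x+1..<y+1}. g u)"
  by (rule sum.reindex_bij_witness[where i = "\<lambda>u. u - 1" and j = "\<lambda>u. u + 1"]) auto

lemma T2_shift_right:
  "T2 a (b - int n) v = xop 0 (- int n) (T2 a b v) + (\<epsilon>^2 - 1) \<cdot> cns a (cns (b - int n) v)"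
proof -
  define g where "g u = cns (res a - int n * u) (cns (res b - int n * (lev a + lev b + 1 - u)) v)" for u
  have g: "cns (res a - int n * u - int n) (cns (res b - int n * (lev a + lev b - u)) v) = g (u + 1)" for u
    by (simp add: g_def algebra_simps)
  have ga: "g (lev a) = cns a (cns (b - int n) v)"
    using res_lev[of a] res_lev[of b] by (simp add: g_def algebra_simps)
  \<comment> \<open>Moving the bound \<open>lev a\<close> by one costs the term at \<open>lev a\<close>, in whichever range is nonempty.\<close>
  have "(\<Sum>u\<in>{lev a..<lev b + 1}. g u) - (\<Sum>u\<in>{lev b + 1..<lev a}. g u)
      = (\<Sum>u\<in>{lev a + 1..<lev b + 1}. g u) - (\<Sum>u\<in>{lev b + 1..<lev a + 1}. g u) + g (lev a)"
  proof (cases "lev a < lev b + 1")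
    case True
    then have "{lev a..<lev b + 1} = insert (lev a) {lev a + 1..<lev b + 1}" "{lev b + 1..<lev a + 1} = {}" "{lev b + 1..<lev a} = {}"
      by auto
    then show ?thesis by simp
  next
    case False
    then have "{lev b + 1..<lev a + 1} = insert (lev a) {lev b + 1..<lev a}" "{lev a..<lev b + 1} = {}" "{lev a + 1..<lev b + 1} = {}"
      by auto
    then show ?thesis by simp
  qed
  moreover have "T2 a (b - int n) v = (if res a = res b then \<epsilon>^2 else \<epsilon>) \<cdot> cns (b - int n) (cns a v)
     + (if res a > res b then (\<epsilon>^2 - 1) \<cdot> cns (res a - int n * lev b - int n) (cns (res b - int n * lev a) v) else 0)
     + (\<epsilon>^2 - 1) \<cdot> ((\<Sum>u\<in>{lev a..<lev b + 1}. g u) - (\<Sum>u\<in>{lev b + 1..<lev a}. g u))"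
    unfolding T2_def res_shift lev_shift g_def by (simp add: algebra_simps)
  moreover have "xop 0 (- int n) (T2 a b v) = (if res a = res b then \<epsilon>^2 else \<epsilon>) \<cdot> cns (b - int n) (cns a v)
     + (if res a > res b then (\<epsilon>^2 - 1) \<cdot> cns (res a - int n * lev b - int n) (cns (res b - int n * lev a) v) else 0)
     + (\<epsilon>^2 - 1) \<cdot> ((\<Sum>u\<in>{lev a + 1..<lev b + 1}. g u) - (\<Sum>u\<in>{lev b + 1..<lev a + 1}. g u))"
    unfolding sum_int_shift[symmetric] g[symmetric] T2_def by simp
  ultimately show ?thesis
    by (simp add: ga pm_scale_distrib)
qed

section \<open>Relations of the affine Hecke algebra\<close>

lemma long_list_cases:
  assumes "Suc (Suc 0) \<le> length (i::'a list)" obtains a b i' where "i = a # b # i'"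
  using assms by (cases i; cases "tl i") auto

abbreviation longer :: "nat \<Rightarrow> (int list \<Rightarrow>\<^sub>0 'k) set" where
  "longer m \<equiv> sp (\<lambda>i. m \<le> length i)"

text \<open>Operators attached to a tensor position are shifts of those at position \<open>0\<close>, hence so are their identities.\<close>
lemma positions_induct:
  assumes "\<And>k. lin (F k)" "\<And>k. lin (G k)"
    "\<And>k s v. F (Suc k) (cns s v) = cns s (F k v)" "\<And>k s v. G (Suc k) (cns s v) = cns s (G k v)"
    "\<And>i. m \<le> length i \<Longrightarrow> F 0 (basis_vec i) = G 0 (basis_vec i)"
    "v \<in> longer (m + k)"
  shows "F k v = G k v"
proof (rule lin_eq_on_sp[OF assms(1,2) _ assms(6)])
  show "m + k \<le> length i \<Longrightarrow> F k (basis_vec i) = G k (basis_vec i)" for i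
  proof (induction k arbitrary: i)
    case (Suc k)
    then obtain s i' where "i = s # i'" by (cases i) auto
    then show ?case using Suc assms(3,4)[of k s "basis_vec i'"] by simp
  qed (use assms(5) in simp)
qed

lemma T_x:
  assumes "v \<in> longer (Suc (Suc k))"
  shows "opT k (xop k (- int n) v) = xop (Suc k) (- int n) (opT k v) - (\<epsilon>^2 - 1) \<cdot> xop (Suc k) (- int n) v"
proof (rule positions_induct[where F = "\<lambda>k v. opT k (xop k (- int n) v)" and m = "Suc (Suc 0)", OF _ _ _ _ _ _])
  fix i :: "int list" assume "Suc (Suc 0) \<le> length i"
  then obtain a b i' where i: "i = a # b # i'" by (rule long_list_cases)
  show "opT 0 (xop 0 (- int n) (basis_vec i)) = xop (Suc 0) (- int n) (opT 0 (basis_vec i)) - (\<epsilon>^2 - 1) \<cdot> xop (Suc 0) (- int n) (basis_vec i)"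
    unfolding i by (simp flip: cns_basis add: T2_shift_left)
qed (use assms in \<open>(intro lin_intro | simp)+\<close>)

lemma T_y:
  assumes "v \<in> longer (Suc (Suc k))"
  shows "opT k (xop (Suc k) (- int n) v) = xop k (- int n) (opT k v) + (\<epsilon>^2 - 1) \<cdot> xop (Suc k) (- int n) v"
proof (rule positions_induct[where F = "\<lambda>k v. opT k (xop (Suc k) (- int n) v)" and m = "Suc (Suc 0)", OF _ _ _ _ _ _])
  fix i :: "int list" assume "Suc (Suc 0) \<le> length i"
  then obtain a b i' where i: "i = a # b # i'" by (rule long_list_cases)
  show "opT 0 (xop (Suc 0) (- int n) (basis_vec i)) = xop 0 (- int n) (opT 0 (basis_vec i)) + (\<epsilon>^2 - 1) \<cdot> xop (Suc 0) (- int n) (basis_vec i)"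
    unfolding i by (simp flip: cns_basis add: T2_shift_right)
qed (use assms in \<open>(intro lin_intro | simp)+\<close>)

lemma ts_intro:
  "u \<in> tensor_space r \<Longrightarrow> v \<in> tensor_space r \<Longrightarrow> u + v \<in> tensor_space r"
  "u \<in> tensor_space r \<Longrightarrow> v \<in> tensor_space r \<Longrightarrow> u - v \<in> tensor_space r"
  "v \<in> tensor_space r \<Longrightarrow> c \<cdot> v \<in> tensor_space r"
  "(\<And>i. i \<in> A \<Longrightarrow> f i \<in> tensor_space r) \<Longrightarrow> sum f A \<in> tensor_space r"
  "v \<in> tensor_space r \<Longrightarrow> cns s v \<in> tensor_space (Suc r)"
  "0 \<in> tensor_space r"
  by (simp_all add: tensor_space_eq_sp sp_add sp_diff sp_scale sp_sum)
    (simp flip: tensor_space_eq_sp)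

lemma T2_len: "v \<in> tensor_space r \<Longrightarrow> T2 a b v \<in> tensor_space (Suc (Suc r))"
  unfolding T2_def by (auto intro!: ts_intro)

lemma cong_n_shift [simp]: "cong_n (s - int n) j = cong_n s j" "cong_n (s + int n) j = cong_n s j"
proof -
  have "s - int n - j = (s - j) - int n" "s + int n - j = (s - j) + int n" by simp_all
  then show "cong_n (s - int n) j = cong_n s j" "cong_n (s + int n) j = cong_n s j"
    unfolding cong_n_def by (metis dvd_diff_commute dvd_minus_iff dvd_diff_right_iff dvd_refl, metis dvd_add_left_iff dvd_refl)
qed

lemma kv_shift [simp]: "kv j (s - int n) = kv j s"
  by (simp add: kv_def)

lemma valT_len: "valT k i \<in> tensor_space (length i)"
proof (induction k i rule: valT.induct)
  case (1 a b i)
  have "basis_vec i \<in> tensor_space (length i)" by (simp add: tensor_space_eq_sp)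
  then show ?case by (auto intro!: T2_len)
qed (auto intro: ts_intro)

lemma diag_basis: "diag c (basis_vec i) = prod_list (map c i) \<cdot> basis_vec i"
  by (simp add: diag_def)

lemma diag_len: "diag c (basis_vec i) \<in> tensor_space (length i)"
  by (simp add: diag_basis tensor_space_eq_sp sp_scale)

lemma valE_len: "valE j i \<in> tensor_space (length i)"
  and valF_len: "valF j i \<in> tensor_space (length i)"
  and valZ_len: "valZ m i \<in> tensor_space (length i)"
proof (induction i)
  case (Cons s i)
  have *: "basis_vec i \<in> tensor_space (length i)" by (simp add: tensor_space_eq_sp)
  { case 1 then show ?case using Cons * by (auto intro!: ts_intro diag_len simp del: cns_basis) }
  { case 2 then show ?case using Cons * by (auto intro!: ts_intro simp del: cns_basis) }
  { case 3 then show ?case using Cons * by (auto intro!: ts_intro simp del: cns_basis) }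
qed (simp_all add: ts_intro)

lemma len_preserving:
  assumes "lin F" "\<And>i. F (basis_vec i) \<in> tensor_space (length i)" "v \<in> sp (\<lambda>i. Q (length i))"
  shows "F v \<in> sp (\<lambda>i. Q (length i))"
proof (rule lin_maps_sp[OF assms(1,3)])
  show "F (basis_vec i) \<in> sp (\<lambda>i. Q (length i))" if "Q (length i)" for i
    using that assms(2)[of i] by (auto simp: tensor_space_def sp_def)
qed

lemma ops_basis_len:
  "opE j (basis_vec i) \<in> tensor_space (length i)" "opF j (basis_vec i) \<in> tensor_space (length i)"
  "opZ m (basis_vec i) \<in> tensor_space (length i)" "opT k (basis_vec i) \<in> tensor_space (length i)"
  "xop t c (basis_vec i) \<in> tensor_space (length i)"
  by (simp_all add: opE_def opF_def opZ_def opT_def xop_def valE_len valF_len valZ_len valT_len)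
    (simp add: tensor_space_eq_sp)

lemmas ops_sp_Q = len_preserving[OF lin_ops(1) diag_len] len_preserving[OF lin_ops(2) ops_basis_len(1)]
  len_preserving[OF lin_ops(3) ops_basis_len(2)] len_preserving[OF lin_ops(4) ops_basis_len(3)]
  len_preserving[OF lin_ops(5) ops_basis_len(5)] len_preserving[OF lin_ops(6) ops_basis_len(4)]

lemmas ops_ts [simp] = ops_sp_Q[where Q = "\<lambda>l. l = r" for r, folded tensor_space_eq_sp]

lemmas ops_long [simp] = ops_sp_Q[where Q = "\<lambda>l. m \<le> l" for m]

lemma cns_long [simp]: "v \<in> sp (\<lambda>i. m \<le> length i) \<Longrightarrow> cns s v \<in> sp (\<lambda>i. Suc m \<le> length i)"
  by (rule lin_maps_sp[OF lin_cns]) auto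

lemma sp_longer_0 [simp]: "v \<in> longer 0"
  by (simp add: sp_def)

text \<open>If an identity at two neighbouring positions is stable under the lattice shifts of these positions, it
suffices to verify it for entries in \<open>{1..n}\<close>. This replaces computations with the sums in \<open>T2\<close> by
computations with the finite rule.\<close>
lemma positions2_induct:
  assumes lin: "\<And>k. lin (F k)" "\<And>k. lin (G k)"
    and cns: "\<And>k s v. F (Suc k) (cns s v) = cns s (F k v)" "\<And>k s v. G (Suc k) (cns s v) = cns s (G k v)"
    and base: "\<And>a b v. 1 \<le> a \<Longrightarrow> a \<le> int n \<Longrightarrow> 1 \<le> b \<Longrightarrow> b \<le> int n \<Longrightarrow> F 0 (cns a (cns b v)) = G 0 (cns a (cns b v))"
    and shift: "\<And>v. v \<in> longer (Suc (Suc 0)) \<Longrightarrow> F 0 (xop 0 (- int n) v) = G 0 (xop 0 (- int n) v) \<longleftrightarrow> F 0 v = G 0 v"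
      "\<And>v. v \<in> longer (Suc (Suc 0)) \<Longrightarrow> F 0 (xop (Suc 0) (- int n) v) = G 0 (xop (Suc 0) (- int n) v) \<longleftrightarrow> F 0 v = G 0 v"
    and v: "v \<in> longer (Suc (Suc k))"
  shows "F k v = G k v"
proof (rule positions_induct[where F = F and G = G and m = "Suc (Suc 0)", OF lin cns])
  fix i :: "int list" assume "Suc (Suc 0) \<le> length i"
  then obtain a b i' where i: "i = a # b # i'" by (rule long_list_cases)
  have "F 0 (cns a (cns b w)) = G 0 (cns a (cns b w))" if "1 \<le> a" "a \<le> int n" for a b w
    by (rule int_shift_induct[of "\<lambda>b. F 0 (cns a (cns b w)) = G 0 (cns a (cns b w))"])
      (use base that shift(2)[of "cns a (cns b w)" for b] in auto)
  then have "F 0 (cns a (cns b w)) = G 0 (cns a (cns b w))" for a b w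
    by (rule int_shift_induct[of "\<lambda>a. F 0 (cns a (cns b w)) = G 0 (cns a (cns b w))"])
      (use shift(1)[of "cns a (cns b w)" for a] in auto)
  then show "F 0 (basis_vec i) = G 0 (basis_vec i)"
    by (simp add: i flip: cns_basis)
qed (use v in simp)

lemma T_xy_0:
  assumes "v \<in> longer (Suc (Suc 0))"
  shows "opT 0 (xop 0 (- int n) v) = xop (Suc 0) (- int n) (opT 0 v) - (\<epsilon>^2 - 1) \<cdot> xop (Suc 0) (- int n) v"
    "opT 0 (xop (Suc 0) (- int n) v) = xop 0 (- int n) (opT 0 v) + (\<epsilon>^2 - 1) \<cdot> xop (Suc 0) (- int n) v"
  using T_x[of v 0] T_y[of v 0] assms by simp_all

lemma eq_shift_cong: "A - B = xop t c (A' - B') \<Longrightarrow> A = B \<longleftrightarrow> A' = B'"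
  by (metis eq_iff_diff_eq_0 xop_eq_0_iff)

text \<open>By the Bernstein relations the defect of the quadratic relation intertwines \<open>X\<^sub>1\<close> with itself and \<open>X\<^sub>2\<close> with itself, so
it vanishes everywhere once it vanishes for entries in \<open>{1..n}\<close>.\<close>
lemma T_quadratic:
  assumes "v \<in> longer (Suc (Suc k))"
  shows "opT k (opT k v) = (\<epsilon>^2 - 1) \<cdot> opT k v + \<epsilon>^2 \<cdot> v"
proof (rule positions2_induct[where F = "\<lambda>k v. opT k (opT k v)", OF _ _ _ _ _ _ _ assms])
  fix a b :: int and v assume "1 \<le> a" "a \<le> int n" "1 \<le> b" "b \<le> int n"
  then show "opT 0 (opT 0 (cns a (cns b v))) = (\<epsilon>^2 - 1) \<cdot> opT 0 (cns a (cns b v)) + \<epsilon>^2 \<cdot> cns a (cns b v)"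
    by (intro poly_mapping_eqI) (auto simp: T2_base pm_lookup algebra_simps power2_eq_square)
next
  fix v :: "int list \<Rightarrow>\<^sub>0 'k" assume v: "v \<in> longer (Suc (Suc 0))"
  show "opT 0 (opT 0 (xop 0 (- int n) v)) = (\<epsilon>^2 - 1) \<cdot> opT 0 (xop 0 (- int n) v) + \<epsilon>^2 \<cdot> xop 0 (- int n) v
    \<longleftrightarrow> opT 0 (opT 0 v) = (\<epsilon>^2 - 1) \<cdot> opT 0 v + \<epsilon>^2 \<cdot> v"
    by (rule eq_shift_cong[where t = 0 and c = "- int n"], rule poly_mapping_eqI)
      (use v in \<open>simp add: T_xy_0 pm_lookup algebra_simps\<close>)
  show "opT 0 (opT 0 (xop (Suc 0) (- int n) v)) = (\<epsilon>^2 - 1) \<cdot> opT 0 (xop (Suc 0) (- int n) v) + \<epsilon>^2 \<cdot> xop (Suc 0) (- int n) v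
    \<longleftrightarrow> opT 0 (opT 0 v) = (\<epsilon>^2 - 1) \<cdot> opT 0 v + \<epsilon>^2 \<cdot> v"
    by (rule eq_shift_cong[where t = 1 and c = "- int n"], rule poly_mapping_eqI)
      (use v in \<open>simp add: T_xy_0 pm_lookup algebra_simps\<close>)
qed (intro lin_intro | simp)+

lemma T_far: "opT k (opT (Suc (Suc (k + d))) v) = opT (Suc (Suc (k + d))) (opT k v)"
  if "v \<in> longer (Suc (Suc k))"
proof (rule positions_induct[where F = "\<lambda>k v. opT k (opT (Suc (Suc (k + d))) v)"
      and G = "\<lambda>k v. opT (Suc (Suc (k + d))) (opT k v)" and m = "Suc (Suc 0)"])
  fix i :: "int list" assume "Suc (Suc 0) \<le> length i"
  then obtain a b i' where i: "i = a # b # i'" by (rule long_list_cases)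
  show "opT 0 (opT (Suc (Suc (0 + d))) (basis_vec i)) = opT (Suc (Suc (0 + d))) (opT 0 (basis_vec i))"
    unfolding i by (simp add: T2_def flip: cns_basis)
qed (use that in \<open>(intro lin_intro | simp)+\<close>)

lemma T_x_right: "opT k (xop (Suc (Suc (k + d))) c v) = xop (Suc (Suc (k + d))) c (opT k v)"
  if "v \<in> longer (Suc (Suc k))"
proof (rule positions_induct[where F = "\<lambda>k v. opT k (xop (Suc (Suc (k + d))) c v)"
      and G = "\<lambda>k v. xop (Suc (Suc (k + d))) c (opT k v)" and m = "Suc (Suc 0)"])
  fix i :: "int list" assume "Suc (Suc 0) \<le> length i"
  then obtain a b i' where i: "i = a # b # i'" by (rule long_list_cases)
  show "opT 0 (xop (Suc (Suc (0 + d))) c (basis_vec i)) = xop (Suc (Suc (0 + d))) c (opT 0 (basis_vec i))"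
    unfolding i by (simp add: T2_def flip: cns_basis)
qed (use that in \<open>(intro lin_intro | simp)+\<close>)

lemma T_x_left: "opT (Suc (k + d)) (xop k c v) = xop k c (opT (Suc (k + d)) v)"
  if "v \<in> longer (Suc k)"
proof (rule positions_induct[where F = "\<lambda>k v. opT (Suc (k + d)) (xop k c v)"
      and G = "\<lambda>k v. xop k c (opT (Suc (k + d)) v)" and m = "Suc 0"])
  fix i :: "int list" assume "Suc 0 \<le> length i"
  then obtain a i' where i: "i = a # i'" by (cases i) auto
  show "opT (Suc (0 + d)) (xop 0 c (basis_vec i)) = xop 0 c (opT (Suc (0 + d)) (basis_vec i))"
    unfolding i by (simp flip: cns_basis)
qed (use that in \<open>(intro lin_intro | simp)+\<close>)

lemma longer_mono: "v \<in> longer (Suc m) \<Longrightarrow> v \<in> longer m"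
  by (auto simp: sp_def)

text \<open>The difference of the two sides of the braid relation commutes with the \<open>X\<^sub>t\<close> up to the longest
permutation of the three positions; the lower order terms cancel by the quadratic relation.\<close>
lemma braid_defect_shift:
  assumes v: "v \<in> longer (Suc (Suc (Suc 0)))"
  defines "B \<equiv> \<lambda>v. opT 0 (opT (Suc 0) (opT 0 v)) - opT (Suc 0) (opT 0 (opT (Suc 0) v))"
  shows "B (xop 0 (- int n) v) = xop (Suc (Suc 0)) (- int n) (B v)"
    "B (xop (Suc 0) (- int n) v) = xop (Suc 0) (- int n) (B v)"
    "B (xop (Suc (Suc 0)) (- int n) v) = xop 0 (- int n) (B v)"
proof -
  note l2 = longer_mono[of _ "Suc (Suc 0)"]
  have T0: "opT 0 (xop 0 (- int n) u) = xop (Suc 0) (- int n) (opT 0 u) - (\<epsilon>^2 - 1) \<cdot> xop (Suc 0) (- int n) u"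
     "opT 0 (xop (Suc 0) (- int n) u) = xop 0 (- int n) (opT 0 u) + (\<epsilon>^2 - 1) \<cdot> xop (Suc 0) (- int n) u"
     "opT 0 (xop (Suc (Suc 0)) (- int n) u) = xop (Suc (Suc 0)) (- int n) (opT 0 u)"
     "opT (Suc 0) (xop (Suc 0) (- int n) u) = xop (Suc (Suc 0)) (- int n) (opT (Suc 0) u) - (\<epsilon>^2 - 1) \<cdot> xop (Suc (Suc 0)) (- int n) u"
     "opT (Suc 0) (xop (Suc (Suc 0)) (- int n) u) = xop (Suc 0) (- int n) (opT (Suc 0) u) + (\<epsilon>^2 - 1) \<cdot> xop (Suc (Suc 0)) (- int n) u"
     "opT (Suc 0) (xop 0 (- int n) u) = xop 0 (- int n) (opT (Suc 0) u)"
     "opT 0 (opT 0 u) = (\<epsilon>^2 - 1) \<cdot> opT 0 u + \<epsilon>^2 \<cdot> u"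
     "opT (Suc 0) (opT (Suc 0) u) = (\<epsilon>^2 - 1) \<cdot> opT (Suc 0) u + \<epsilon>^2 \<cdot> u"
     if "u \<in> longer (Suc (Suc (Suc 0)))" for u
    using that l2[OF that] longer_mono[OF l2[OF that]]
      T_x[of u 0] T_y[of u 0] T_x[of u "Suc 0"] T_y[of u "Suc 0"] T_x_right[of u 0 0 "- int n"] T_x_left[of u 0 0 "- int n"]
      T_quadratic[of u 0] T_quadratic[of u "Suc 0"] by simp_all
  show "B (xop 0 (- int n) v) = xop (Suc (Suc 0)) (- int n) (B v)"
    "B (xop (Suc 0) (- int n) v) = xop (Suc 0) (- int n) (B v)"
    "B (xop (Suc (Suc 0)) (- int n) v) = xop 0 (- int n) (B v)"
    using v unfolding B_def
    by (intro poly_mapping_eqI; simp add: T0 pm_lookup; simp add: algebra_simps)+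
qed

lemma T_braid:
  assumes "v \<in> longer (Suc (Suc (Suc k)))"
  shows "opT k (opT (Suc k) (opT k v)) = opT (Suc k) (opT k (opT (Suc k) v))"
proof (rule positions_induct[where F = "\<lambda>k v. opT k (opT (Suc k) (opT k v))"
      and G = "\<lambda>k v. opT (Suc k) (opT k (opT (Suc k) v))" and m = "Suc (Suc (Suc 0))"])
  fix i :: "int list" assume "Suc (Suc (Suc 0)) \<le> length i"
  then obtain a b c i' where i: "i = a # b # c # i'" by (metis Suc_le_length_iff)
  define B where "B v = opT 0 (opT (Suc 0) (opT 0 v)) - opT (Suc 0) (opT 0 (opT (Suc 0) v))" for v
  have Bx: "B (cns (a - int n) (cns b (cns c w))) = xop (Suc (Suc 0)) (- int n) (B (cns a (cns b (cns c w))))"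
    "B (cns a (cns (b - int n) (cns c w))) = xop (Suc 0) (- int n) (B (cns a (cns b (cns c w))))"
    "B (cns a (cns b (cns (c - int n) w))) = xop 0 (- int n) (B (cns a (cns b (cns c w))))" for a b c w
    using braid_defect_shift[of "cns a (cns b (cns c w))", folded B_def] by simp_all
  have base: "B (cns a (cns b (cns c w))) = 0"
    if "1 \<le> a" "a \<le> int n" "1 \<le> b" "b \<le> int n" "1 \<le> c" "c \<le> int n" for a b c w
    using that unfolding B_def
    by (intro poly_mapping_eqI; cases a b rule: linorder_cases; cases b c rule: linorder_cases; cases a c rule: linorder_cases;
      simp add: T2_base pm_lookup; simp add: algebra_simps power2_eq_square)
  have "B (cns a (cns b (cns c w))) = 0" if "1 \<le> a" "a \<le> int n" "1 \<le> b" "b \<le> int n" for a b c w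
    by (rule int_shift_induct[of "\<lambda>c. B (cns a (cns b (cns c w))) = 0"]) (use base that Bx in auto)
  then have "B (cns a (cns b (cns c w))) = 0" if "1 \<le> a" "a \<le> int n" for a b c w
    by (rule int_shift_induct[of "\<lambda>b. B (cns a (cns b (cns c w))) = 0"]) (use that Bx in auto)
  then have "B (cns a (cns b (cns c w))) = 0" for a b c w
    by (rule int_shift_induct[of "\<lambda>a. B (cns a (cns b (cns c w))) = 0"]) (use Bx in auto)
  then show "opT 0 (opT (Suc 0) (opT 0 (basis_vec i))) = opT (Suc 0) (opT 0 (opT (Suc 0) (basis_vec i)))"
    by (simp add: i B_def flip: cns_basis)
qed (use assms in \<open>(intro lin_intro | simp)+\<close>)

section \<open>The Hecke operators commute with the quantum group operators\<close>

text \<open>An operator commuting with the \<open>X\<^sub>t\<close> commutes with \<open>T\<^sub>1\<close> as soon as it does so on entries in \<open>{1..n}\<close>, because the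
commutator is again compatible with the shifts.\<close>
lemma commute_T:
  assumes lin: "lin E" and shift: "\<And>t v. E (xop t (- int n) v) = xop t (- int n) (E v)"
    and len: "\<And>v. v \<in> longer (Suc (Suc 0)) \<Longrightarrow> E v \<in> longer (Suc (Suc 0))"
    and base: "\<And>a b v. 1 \<le> a \<Longrightarrow> a \<le> int n \<Longrightarrow> 1 \<le> b \<Longrightarrow> b \<le> int n \<Longrightarrow>
       E (opT 0 (cns a (cns b v))) = opT 0 (E (cns a (cns b v)))"
    and v: "v \<in> longer (Suc (Suc 0))"
  shows "E (opT 0 v) = opT 0 (E v)"
proof -
  have s: "E (opT 0 (xop 0 (- int n) v)) = opT 0 (E (xop 0 (- int n) v)) \<longleftrightarrow> E (opT 0 v) = opT 0 (E v)"
     if "v \<in> longer (Suc (Suc 0))" for v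
    by (rule eq_shift_cong[where t = "Suc 0" and c = "- int n"])
      (use that in \<open>simp add: T_xy_0 shift lin_rules[OF lin] len\<close>)
  have s': "E (opT 0 (xop (Suc 0) (- int n) v)) = opT 0 (E (xop (Suc 0) (- int n) v)) \<longleftrightarrow> E (opT 0 v) = opT 0 (E v)"
     if "v \<in> longer (Suc (Suc 0))" for v
    by (rule eq_shift_cong[where t = 0 and c = "- int n"])
      (use that in \<open>simp add: T_xy_0 shift lin_rules[OF lin] len\<close>)
  show ?thesis
  proof (rule lin_eq_on_sp[OF _ _ _ v])
    fix i :: "int list" assume "Suc (Suc 0) \<le> length i"
    then obtain a b i' where i: "i = a # b # i'" by (rule long_list_cases)
    let ?P = "\<lambda>a b w. E (opT 0 (cns a (cns b w))) = opT 0 (E (cns a (cns b w)))"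
    have "?P a b w" if "1 \<le> a" "a \<le> int n" for a b w
      by (rule int_shift_induct[of "\<lambda>b. ?P a b w"])
        (use base that s'[of "cns a (cns b w)" for b] in auto)
    then have "?P a b w" for a b w
      by (rule int_shift_induct[of "\<lambda>a. ?P a b w"])
        (use s[of "cns a (cns b w)" for a] in auto)
    then show "E (opT 0 (basis_vec i)) = opT 0 (E (basis_vec i))"
      by (simp add: i flip: cns_basis)
  qed (intro lin_compose[OF lin] lin_intro lin_compose[OF lin_ops(6) lin] lin_ops)+
qed

lemma xop_diag: "(\<And>s. c (s - int n) = c s) \<Longrightarrow> diag c (xop t (- int n) v) = xop t (- int n) (diag c v)"
proof (rule lin_eqI[where F = "\<lambda>v. diag c (xop t (- int n) v)"])
  fix i assume *: "\<And>s. c (s - int n) = c s"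
  show "diag c (xop t (- int n) (basis_vec i)) = xop t (- int n) (diag c (basis_vec i))"
  proof (induction i arbitrary: t)
    case (Cons s i)
    then show ?case by (cases t) (simp_all add: * flip: cns_basis)
  qed (simp add: xop_basis)
qed (intro lin_intro)+

lemma xop_E: "opE j (xop t (- int n) v) = xop t (- int n) (opE j v)"
proof (rule lin_eqI[where F = "\<lambda>v. opE j (xop t (- int n) v)"])
  fix i
  show "opE j (xop t (- int n) (basis_vec i)) = xop t (- int n) (opE j (basis_vec i))"
  proof (induction i arbitrary: t)
    case (Cons s i)
    then show ?case by (cases t) (simp_all add: xop_diag algebra_simps flip: cns_basis)
  qed (simp add: xop_basis)
qed (intro lin_intro)+

lemma xop_F: "opF j (xop t (- int n) v) = xop t (- int n) (opF j v)"
proof (rule lin_eqI[where F = "\<lambda>v. opF j (xop t (- int n) v)"])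
  fix i
  show "opF j (xop t (- int n) (basis_vec i)) = xop t (- int n) (opF j (basis_vec i))"
  proof (induction i arbitrary: t)
    case (Cons s i)
    then show ?case by (cases t) (simp_all add: algebra_simps flip: cns_basis)
  qed (simp add: xop_basis)
qed (intro lin_intro)+

lemma xop_Z: "opZ m (xop t c v) = xop t c (opZ m v)"
proof (rule lin_eqI[where F = "\<lambda>v. opZ m (xop t c v)"])
  fix i
  show "opZ m (xop t c (basis_vec i)) = xop t c (opZ m (basis_vec i))"
  proof (induction i arbitrary: t)
    case (Cons s i)
    then show ?case by (cases t) (simp_all add: algebra_simps flip: cns_basis)
  qed (simp add: xop_basis)
qed (intro lin_intro)+

lemma cong_n_base:
  assumes "1 \<le> a" "a \<le> int n" "0 \<le> j" "j < int n"
  shows "cong_n a (j + 1) \<longleftrightarrow> a = j + 1" "cong_n a j \<longleftrightarrow> (if j = 0 then a = int n else a = j)"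
proof -
  have 1: "cong_n a (j + 1) \<longleftrightarrow> a = j + 1" if "0 \<le> j" "j < int n" for j
  proof
    assume "cong_n a (j + 1)"
    then obtain k where k: "a - (j + 1) = int n * k" by (auto simp: cong_n_def)
    have "int n * k < int n * 1" "int n * (- 1) < int n * k"
      unfolding k[symmetric] using assms that by linarith+
    moreover have "0 < int n" using n_ge_2 by simp
    ultimately have "k < 1" "- 1 < k" unfolding mult_less_cancel_left_pos[OF \<open>0 < int n\<close>] by blast+
    then have "k = 0" by simp
    with k show "a = j + 1" by simp
  qed (simp add: cong_n_def)
  show "cong_n a (j + 1) \<longleftrightarrow> a = j + 1" using assms by (intro 1)
  show "cong_n a j \<longleftrightarrow> (if j = 0 then a = int n else a = j)"
  proof (cases "j = 0")
    case True
    have "cong_n a 0 = cong_n a (int n - 1 + 1)" using cong_n_shift(1)[of a 0] by (simp add: cong_n_def)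
    also have "\<dots> \<longleftrightarrow> a = int n" using 1[of "int n - 1"] n_ge_2 by simp
    finally show ?thesis using True by simp
  next
    case False
    then show ?thesis using 1[of "j - 1"] assms by simp
  qed
qed

lemma cong_n_mod: "cong_n s (j mod int n) = cong_n s j" "cong_n s (j mod int n + 1) = cong_n s (j + 1)"
proof -
  show *: "cong_n s (j mod int n) = cong_n s j" for s
    unfolding cong_n_def mod_eq_dvd_iff[symmetric] by simp
  show "cong_n s (j mod int n + 1) = cong_n s (j + 1)"
    using *[of "s - 1"] by (simp add: cong_n_def algebra_simps)
qed

lemma kv_mod: "kv (j mod int n) = kv j"
  by (auto simp: kv_def cong_n_mod fun_eq_iff)

lemma E_mod: "opE (j mod int n) = opE j"
proof -
  have "valE (j mod int n) i = valE j i" for i by (induction i) (simp_all add: cong_n_mod kv_mod)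
  then have "valE (j mod int n) = valE j" by (rule ext)
  then show ?thesis by (simp add: opE_def)
qed

lemma F_mod: "opF (j mod int n) = opF j"
proof -
  have "valF (j mod int n) i = valF j i" for i by (induction i) (simp_all add: cong_n_mod kv_mod)
  then have "valF (j mod int n) = valF j" by (rule ext)
  then show ?thesis by (simp add: opF_def)
qed

lemma kv_base:
  assumes "1 \<le> a" "a \<le> int n" "0 \<le> j" "j < int n"
  shows "kv j a = (if a = (if j = 0 then int n else j) then \<epsilon> else if a = j + 1 then inverse \<epsilon> else 1)"
  using cong_n_base[OF assms] assms n_ge_2 by (auto simp: kv_def)

lemma T2_zero_left:
  "1 \<le> b \<Longrightarrow> b \<le> int n \<Longrightarrow> T2 0 b v = xop (Suc 0) (- int n) (T2 (int n) b v) - (\<epsilon>^2 - 1) \<cdot> cns (int n) (cns (b - int n) v)"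
  using T2_shift_left[of "int n" b v] by simp

lemma T2_zero_right:
  "T2 a 0 v = xop 0 (- int n) (T2 a (int n) v) + (\<epsilon>^2 - 1) \<cdot> cns a (cns 0 v)"
  using T2_shift_right[of a "int n" v] by simp

lemma T2_top_left:
  "T2 (int n + 1) b v = xop (Suc 0) (int n) (T2 1 b v) + (\<epsilon>^2 - 1) \<cdot> cns (int n + 1) (cns b v)"
  using arg_cong[OF T2_shift_left[of "int n + 1" b v], of "xop (Suc 0) (int n)"] by simp

lemma T2_top_right:
  "T2 a (int n + 1) v = xop 0 (int n) (T2 a 1 v) - (\<epsilon>^2 - 1) \<cdot> cns (a + int n) (cns 1 v)"
  using arg_cong[OF T2_shift_right[of a "int n + 1" v], of "xop 0 (int n)"] by simp

lemma diag_T_0: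
  assumes "\<And>s. c (s - int n) = c s" "v \<in> longer (Suc (Suc 0))"
  shows "diag c (opT 0 v) = opT 0 (diag c v)"
  by (rule commute_T[OF _ _ _ _ assms(2)])
    (auto simp: lin_ops T2_base xop_diag[of c] assms(1) pm_scale_distrib mult_ac)

text \<open>The index of \<open>E\<^sub>j\<close> is normalised to \<open>0 \<le> i < n\<close>, and the claim is a finite check by the positions of \<open>a\<close> and
\<open>b\<close> relative to \<open>i\<close> and \<open>i + 1\<close>. For \<open>i = 0\<close> the operator lowers \<open>1\<close> to \<open>0\<close>, which leaves \<open>{1..n}\<close>, and \<open>T2\<close> is
evaluated at \<open>0\<close> by one lattice shift from \<open>n\<close>.\<close>
lemma E_T_0:
  assumes "v \<in> longer (Suc (Suc 0))"
  shows "opE j (opT 0 v) = opT 0 (opE j v)"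
proof -
  define i where "i = j mod int n"
  have i: "0 \<le> i" "i < int n" using n_ge_2 by (auto simp: i_def)
  have "opE i (opT 0 v) = opT 0 (opE i v)"
  proof (rule commute_T[OF _ _ _ _ assms])
    fix a b v assume ab: "1 \<le> a" "a \<le> int n" "1 \<le> b" "b \<le> int n"
    have e: "cong_n x (i + 1) \<longleftrightarrow> x = i + 1" if "1 \<le> x" "x \<le> int n" for x
      using cong_n_base[OF that i] by simp
    have k: "kv i x = (if x = (if i = 0 then int n else i) then \<epsilon> else if x = i + 1 then inverse \<epsilon> else 1)"
      if "1 \<le> x" "x \<le> int n" for x
      using kv_base[OF that i] by simp
    show "opE i (opT 0 (cns a (cns b v))) = opT 0 (opE i (cns a (cns b v)))"
    proof (cases "i = 0")
      case True
      note e = e[unfolded True, simplified] and k = k[unfolded True, simplified]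
      have n: "1 < int n" using n_ge_2 by simp
      show ?thesis unfolding True using n eps_nonzero ab
        apply (intro poly_mapping_eqI)
        apply (cases "a = 1"; cases "b = 1"; cases "a = int n"; cases "b = int n"; cases a b rule: linorder_cases)
        apply (simp_all add: e k T2_base T2_zero_left T2_zero_right pm_lookup del: of_nat_eq_numeral_iff of_nat_eq_1_iff)
        apply (simp_all add: field_simps power2_eq_square)
        done
    next
      case False
      then have "1 \<le> i" using i by simp
      then show ?thesis using i eps_nonzero False ab
        apply (intro poly_mapping_eqI)
        apply (cases "a = i + 1"; cases "b = i + 1"; cases "a = i"; cases "b = i"; cases a b rule: linorder_cases)
        apply (simp_all add: e k T2_base pm_lookup)
        apply (simp_all add: field_simps power2_eq_square)
        done
    qed
  qed (simp_all add: lin_ops xop_E)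
  then show ?thesis by (simp add: i_def E_mod)
qed

lemma eps_cancel [simp]: "\<epsilon> * (inverse \<epsilon> * x) = x" "inverse \<epsilon> * (\<epsilon> * x) = x"
  "\<epsilon> * inverse \<epsilon> = 1" "inverse \<epsilon> * \<epsilon> = 1"
  using eps_nonzero by (simp_all flip: mult.assoc)

text \<open>As for \<open>E\<^sub>j\<close>; for \<open>i = 0\<close> the operator raises \<open>n\<close> to \<open>n + 1\<close>, a lattice shift of \<open>1\<close>.\<close>
lemma F_T_0:
  assumes "v \<in> longer (Suc (Suc 0))"
  shows "opF j (opT 0 v) = opT 0 (opF j v)"
proof -
  define i where "i = j mod int n"
  have i: "0 \<le> i" "i < int n" using n_ge_2 by (auto simp: i_def)
  have "opF i (opT 0 v) = opT 0 (opF i v)"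
  proof (rule commute_T[OF _ _ _ _ assms])
    fix a b v assume ab: "1 \<le> a" "a \<le> int n" "1 \<le> b" "b \<le> int n"
    have e: "cong_n x i \<longleftrightarrow> (if i = 0 then x = int n else x = i)" if "1 \<le> x" "x \<le> int n" for x
      using cong_n_base[OF that i] by simp
    have k: "kv i x = (if x = (if i = 0 then int n else i) then \<epsilon> else if x = i + 1 then inverse \<epsilon> else 1)"
      if "1 \<le> x" "x \<le> int n" for x
      using kv_base[OF that i] by simp
    show "opF i (opT 0 (cns a (cns b v))) = opT 0 (opF i (cns a (cns b v)))"
    proof (cases "i = 0")
      case True
      note e = e[unfolded True, simplified] and k = k[unfolded True, simplified]
      have n: "1 < int n" using n_ge_2 by simp
      note simps = e k T2_base T2_top_left T2_top_right add.commute[of 1 "int n"] pm_lookup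
      note [simp del] = of_nat_eq_numeral_iff of_nat_eq_1_iff
      consider "a = int n" "b = int n" | "a = int n" "b = 1" | "a = int n" "1 < b" "b < int n"
        | "a = 1" "b = int n" | "1 < a" "a < int n" "b = int n" | "a < int n" "b < int n"
        using ab by linarith
      then have "opF 0 (opT 0 (cns a (cns b v))) = opT 0 (opF 0 (cns a (cns b v)))"
      proof cases
        case 1 then show ?thesis using ab n eps_nonzero
          by (intro poly_mapping_eqI) (simp add: simps, simp add: algebra_simps power2_eq_square)
      next
        case 2 then show ?thesis using ab n eps_nonzero
          by (intro poly_mapping_eqI) (simp add: simps, simp add: algebra_simps power2_eq_square)
      next
        case 3 then show ?thesis using ab n eps_nonzero
          by (intro poly_mapping_eqI) (simp add: simps, simp add: algebra_simps power2_eq_square)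
      next
        case 4 then show ?thesis using ab n eps_nonzero
          by (intro poly_mapping_eqI) (simp add: simps, simp add: algebra_simps power2_eq_square)
      next
        case 5 then show ?thesis using ab n eps_nonzero
          by (intro poly_mapping_eqI) (simp add: simps, simp add: algebra_simps power2_eq_square)
      next
        case 6
        then show ?thesis using ab by (simp add: e T2_base pm_scale_distrib mult_ac)
      qed
      then show ?thesis by (simp add: True)
    next
      case False
      then have "1 \<le> i" using i by linarith
      note simps = e k T2_base pm_lookup
      consider "a = i" "b = i" | "a = i" "b = i + 1" | "a = i" "b < i" | "a = i" "b > i + 1"
        | "b = i" "a = i + 1" | "b = i" "a < i" | "b = i" "a > i + 1" | "a \<noteq> i" "b \<noteq> i"
        by linarith
      then show ?thesis
      proof cases
        case 1 then show ?thesis using i eps_nonzero \<open>1 \<le> i\<close> ab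
          by (intro poly_mapping_eqI) (simp add: simps, simp add: algebra_simps power2_eq_square)
      next
        case 2 then show ?thesis using i eps_nonzero \<open>1 \<le> i\<close> ab
          by (intro poly_mapping_eqI) (simp add: simps, simp add: algebra_simps power2_eq_square)
      next
        case 3 then show ?thesis using i eps_nonzero \<open>1 \<le> i\<close> ab
          by (intro poly_mapping_eqI) (simp add: simps, simp add: algebra_simps power2_eq_square)
      next
        case 4 then show ?thesis using i eps_nonzero \<open>1 \<le> i\<close> ab
          by (intro poly_mapping_eqI) (simp add: simps, simp add: algebra_simps power2_eq_square)
      next
        case 5 then show ?thesis using i eps_nonzero \<open>1 \<le> i\<close> ab
          by (intro poly_mapping_eqI) (simp add: simps, simp add: algebra_simps power2_eq_square)
      next
        case 6 then show ?thesis using i eps_nonzero \<open>1 \<le> i\<close> ab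
          by (intro poly_mapping_eqI) (simp add: simps, simp add: algebra_simps power2_eq_square)
      next
        case 7 then show ?thesis using i eps_nonzero \<open>1 \<le> i\<close> ab
          by (intro poly_mapping_eqI) (simp add: simps, simp add: algebra_simps power2_eq_square)
      next
        case 8
        then show ?thesis using ab False by (simp add: e T2_base pm_scale_distrib mult_ac)
      qed
    qed
  qed (simp_all add: lin_ops xop_F)
  then show ?thesis by (simp add: i_def F_mod)
qed

lemma diag_T:
  assumes per: "\<And>s. c (s - int n) = c s" and v: "v \<in> longer (Suc (Suc k))"
  shows "diag c (opT k v) = opT k (diag c v)"
proof -
  have "diag c (opT k (basis_vec i)) = opT k (diag c (basis_vec i))" if "Suc (Suc k) \<le> length i" for i
    using that
  proof (induction k arbitrary: i)
    case (Suc k)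
    then obtain s i' where i: "i = s # i'" by (cases i) auto
    show ?case using Suc by (simp add: i flip: cns_basis)
  next
    case 0
    show ?case by (rule diag_T_0) (use per 0 in simp_all)
  qed
  then show ?thesis
    by (intro lin_eq_on_sp[where F = "\<lambda>v. diag c (opT k v)" and G = "\<lambda>v. opT k (diag c v)", OF _ _ _ v] lin_intro)
qed

lemma E_T:
  assumes "v \<in> longer (Suc (Suc k))"
  shows "opE j (opT k v) = opT k (opE j v)"
proof -
  have "opE j (opT k (basis_vec i)) = opT k (opE j (basis_vec i))" if "Suc (Suc k) \<le> length i" for i
    using that
  proof (induction k arbitrary: i)
    case (Suc k)
    then obtain s i' where i: "i = s # i'" by (cases i) auto
    show ?case using Suc by (simp add: i kv_shift diag_T flip: cns_basis)
  qed (simp add: E_T_0)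
  then show ?thesis
    by (intro lin_eq_on_sp[where F = "\<lambda>v. opE j (opT k v)" and G = "\<lambda>v. opT k (opE j v)", OF _ _ _ assms] lin_intro)
qed

lemma F_T:
  assumes "v \<in> longer (Suc (Suc k))"
  shows "opF j (opT k v) = opT k (opF j v)"
proof -
  have "opF j (opT k (basis_vec i)) = opT k (opF j (basis_vec i))" if "Suc (Suc k) \<le> length i" for i
    using that
  proof (induction k arbitrary: i)
    case (Suc k)
    then obtain s i' where i: "i = s # i'" by (cases i) auto
    show ?case using Suc by (simp add: i flip: cns_basis)
  qed (simp add: F_T_0)
  then show ?thesis
    by (intro lin_eq_on_sp[where F = "\<lambda>v. opF j (opT k v)" and G = "\<lambda>v. opT k (opF j v)", OF _ _ _ assms] lin_intro)
qed

text \<open>\<open>T\<^sub>1\<close> commutes with \<open>X\<^sub>1 + X\<^sub>2\<close> and \<open>X\<^sub>1 X\<^sub>2\<close>, hence with all power sums by Newton's recursion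
\<open>p\<^bsub>m+2\<^esub> = (X\<^sub>1 + X\<^sub>2) p\<^bsub>m+1\<^esub> - X\<^sub>1 X\<^sub>2 p\<^sub>m\<close>.\<close>
lemma T_power_sum_nat:
  assumes "v \<in> longer (Suc (Suc 0))"
  shows "opT 0 (xop 0 (- int n * int m) v + xop (Suc 0) (- int n * int m) v)
    = xop 0 (- int n * int m) (opT 0 v) + xop (Suc 0) (- int n * int m) (opT 0 v)"
proof (induction m rule: less_induct)
  case (less m)
  let ?x = "xop 0 (- int n)" and ?y = "xop (Suc 0) (- int n)"
  define P where "P m u = xop 0 (- int n * int m) u + xop (Suc 0) (- int n * int m) u" for m u
  have rec: "P (Suc (Suc m)) u = ?x (P (Suc m) u) + ?y (P (Suc m) u) - ?x (?y (P m u))" for m u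
  proof -
    have step: "xop t (- int n) (xop t (- int n * int m) u) = xop t (- int n * int (Suc m)) u" for t m u
      unfolding xop_xop by (rule arg_cong[where f = "\<lambda>c. xop t c u"]) (simp add: algebra_simps)
    have "?y (xop 0 (- int n * int (Suc m)) u) = ?x (?y (xop 0 (- int n * int m) u))"
      "?x (xop (Suc 0) (- int n * int (Suc m)) u) = ?x (?y (xop (Suc 0) (- int n * int m) u))"
      by (simp_all only: step[symmetric] xop_commute[of "Suc 0" _ 0])
    then show ?thesis by (simp only: P_def ops_lin step) simp
  qed
  have P_long: "P m u \<in> longer (Suc (Suc 0))" if "u \<in> longer (Suc (Suc 0))" for u m
    using that by (auto simp: P_def)
  have T1: "opT 0 (?x u + ?y u) = ?x (opT 0 u) + ?y (opT 0 u)" "opT 0 (?x (?y u)) = ?x (?y (opT 0 u))"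
    if "u \<in> longer (Suc (Suc 0))" for u
    using that by (simp_all add: T_xy_0 xop_commute[of "Suc 0" _ 0])
  show ?case
  proof (cases m)
    case 0 then show ?thesis by simp
  next
    case (Suc m')
    show ?thesis
    proof (cases m')
      case 0 then show ?thesis using T1(1)[OF assms] Suc by simp
    next
      case (Suc m'')
      have IH: "opT 0 (P m'' v) = P m'' (opT 0 v)" "opT 0 (P (Suc m'') v) = P (Suc m'') (opT 0 v)"
        using less.IH[of m''] less.IH[of "Suc m''"] Suc \<open>m = Suc m'\<close> by (simp_all add: P_def)
      have "opT 0 (P (Suc (Suc m'')) v) = P (Suc (Suc m'')) (opT 0 v)"
        using T1[OF P_long[OF assms, of "Suc m''"]] T1[OF P_long[OF assms, of m'']] IH
        unfolding rec lin_diff[OF lin_ops(6)] by simp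
      then show ?thesis using Suc \<open>m = Suc m'\<close> by (simp add: P_def)
    qed
  qed
qed

lemma T_e2_inverse:
  assumes "v \<in> longer (Suc (Suc 0))"
  shows "opT 0 (xop 0 (int n * int m) (xop (Suc 0) (int n * int m) v))
    = xop 0 (int n * int m) (xop (Suc 0) (int n * int m) (opT 0 v))"
proof (induction m)
  case (Suc m)
  let ?x = "xop 0 (- int n)" and ?y = "xop (Suc 0) (- int n)"
  have T1: "opT 0 (?x (?y u)) = ?x (?y (opT 0 u))" if "u \<in> longer (Suc (Suc 0))" for u
    using that by (simp add: T_xy_0 xop_commute[of "Suc 0" _ 0])
  let ?u = "xop 0 (int n * int (Suc m)) (xop (Suc 0) (int n * int (Suc m)) v)"
  have "?x (?y (opT 0 ?u)) = opT 0 (?x (?y ?u))"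
    using assms by (intro T1[symmetric]) simp
  also have "?x (?y ?u) = xop 0 (int n * int m) (xop (Suc 0) (int n * int m) v)"
    by (simp add: algebra_simps xop_commute[of "Suc 0" _ 0])
  also have "opT 0 \<dots> = xop 0 (int n * int m) (xop (Suc 0) (int n * int m) (opT 0 v))"
    by (rule Suc)
  also have "\<dots> = ?x (?y (xop 0 (int n * int (Suc m)) (xop (Suc 0) (int n * int (Suc m)) (opT 0 v))))"
    by (simp add: algebra_simps xop_commute[of "Suc 0" _ 0])
  finally show ?case by (simp only: xop_inj)
qed simp

text \<open>Negative power sums are positive ones divided by a power of \<open>X\<^sub>1 X\<^sub>2\<close>.\<close>
lemma T_power_sum:
  assumes "v \<in> longer (Suc (Suc 0))"
  shows "opT 0 (xop 0 (- m * int n) v + xop (Suc 0) (- m * int n) v)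
    = xop 0 (- m * int n) (opT 0 v) + xop (Suc 0) (- m * int n) (opT 0 v)"
proof (cases "m \<ge> 0")
  case True
  then show ?thesis using T_power_sum_nat[OF assms, of "nat m"] by (simp add: mult.commute)
next
  case False
  define k where "k = nat (- m)"
  have m: "m = - int k" using False by (simp add: k_def)
  define u where "u = xop 0 (int n * int k) (xop (Suc 0) (int n * int k) v)"
  have *: "xop 0 (- m * int n) w + xop (Suc 0) (- m * int n) w =
     xop 0 (- int n * int k) (xop 0 (int n * int k) (xop (Suc 0) (int n * int k) w))
     + xop (Suc 0) (- int n * int k) (xop 0 (int n * int k) (xop (Suc 0) (int n * int k) w))" for w
    by (simp add: m xop_commute[of "Suc 0" _ 0] mult.commute)
  show ?thesis unfolding *
    using T_power_sum_nat[of u k] assms T_e2_inverse[OF assms, of k] by (simp add: u_def)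
qed

text \<open>Only the two factors touched by \<open>T\<^sub>k\<close> matter, and there \<open>z\<^sub>m\<close> is the power sum of the \<open>X\<close>'s.\<close>
lemma Z_T:
  assumes v: "v \<in> longer (Suc (Suc k))"
  shows "opZ m (opT k v) = opT k (opZ m v)"
proof -
  have "opZ m (opT k (basis_vec i)) = opT k (opZ m (basis_vec i))" if "Suc (Suc k) \<le> length i" for i
    using that
  proof (induction k arbitrary: i)
    case (Suc k)
    then obtain s i' where i: "i = s # i'" by (cases i) auto
    show ?case using Suc by (simp add: i flip: cns_basis)
  next
    case 0
    then obtain a b i' where i: "i = a # b # i'" by (rule long_list_cases)
    have *: "opZ m (cns a (cns b w)) = xop 0 (- m * int n) (cns a (cns b w)) + xop (Suc 0) (- m * int n) (cns a (cns b w))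
       + cns a (cns b (opZ m w))" for a b w by simp
    have **: "opZ m (T2 a b w) = xop 0 (- m * int n) (T2 a b w) + xop (Suc 0) (- m * int n) (T2 a b w) + T2 a b (opZ m w)" for w
      unfolding T2_def by (simp add: pm_scale_distrib sum.distrib)
    show ?case
      unfolding i by (simp only: flip: cns_basis)
        (subst *, simp only: lin_add[OF lin_ops(6)] T_power_sum[unfolded lin_add[OF lin_ops(6)]] cns_long sp_longer_0 opT_cns **)
  qed
  then show ?thesis
    by (intro lin_eq_on_sp[where F = "\<lambda>v. opZ m (opT k v)" and G = "\<lambda>v. opT k (opZ m v)", OF _ _ _ v] lin_intro)
qed

section \<open>Relations of quantum affine gl(n)\<close>

lemma E_diag:
  assumes "\<And>s. cong_n s (j + 1) \<Longrightarrow> c (s - 1) = l * c s"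
  shows "diag c (opE j v) = l \<cdot> opE j (diag c v)"
proof (rule lin_eqI[where F = "\<lambda>v. diag c (opE j v)"])
  show "diag c (opE j (basis_vec i)) = l \<cdot> opE j (diag c (basis_vec i))" for i
    by (induction i) (simp_all add: assms pm_scale_distrib mult_ac flip: cns_basis)
qed (intro lin_intro)+

lemma F_diag:
  assumes "\<And>s. cong_n s j \<Longrightarrow> c (s + 1) = l * c s"
  shows "diag c (opF j v) = l \<cdot> opF j (diag c v)"
proof (rule lin_eqI[where F = "\<lambda>v. diag c (opF j v)"])
  show "diag c (opF j (basis_vec i)) = l \<cdot> opF j (diag c (basis_vec i))" for i
    by (induction i) (simp_all add: assms pm_scale_distrib mult_ac flip: cns_basis)
qed (intro lin_intro)+

lemma Z_diag:
  assumes "\<And>s m. c (s - m * int n) = c s"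
  shows "diag c (opZ m v) = opZ m (diag c v)"
proof (rule lin_eqI[where F = "\<lambda>v. diag c (opZ m v)"])
  show "diag c (opZ m (basis_vec i)) = opZ m (diag c (basis_vec i))" for i
    by (induction i) (simp_all add: assms pm_scale_distrib flip: cns_basis)
qed (intro lin_intro)+

lemma cong_n_shift_mult [simp]: "cong_n (s - m * int n) j = cong_n s j" "cong_n (s + m * int n) j = cong_n s j"
proof -
  have "s - m * int n - j = (s - j) + (- m) * int n" "s + m * int n - j = (s - j) + m * int n" by simp_all
  then show "cong_n (s - m * int n) j = cong_n s j" "cong_n (s + m * int n) j = cong_n s j"
    unfolding cong_n_def by (simp_all only: dvd_add_times_triv_right_iff)
qed

lemma kv_shift_mult [simp]: "kv j (s - m * int n) = kv j s"
  by (simp add: kv_def)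

lemma Z_E: "opZ m (opE j v) = opE j (opZ m v)"
proof (rule lin_eqI[where F = "\<lambda>v. opZ m (opE j v)"])
  show "opZ m (opE j (basis_vec i)) = opE j (opZ m (basis_vec i))" for i
    by (induction i) (simp_all add: Z_diag algebra_simps flip: cns_basis)
qed (intro lin_intro)+

lemma Z_F: "opZ m (opF j v) = opF j (opZ m v)"
proof (rule lin_eqI[where F = "\<lambda>v. opZ m (opF j v)"])
  show "opZ m (opF j (basis_vec i)) = opF j (opZ m (basis_vec i))" for i
    by (induction i) (simp_all add: algebra_simps pm_scale_distrib flip: cns_basis)
qed (intro lin_intro)+

lemma Z_Z: "opZ m (opZ l v) = opZ l (opZ m v)"
proof (rule lin_eqI[where F = "\<lambda>v. opZ m (opZ l v)"])
  show "opZ m (opZ l (basis_vec i)) = opZ l (opZ m (basis_vec i))" for i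
    by (induction i) (simp_all add: algebra_simps flip: cns_basis)
qed (intro lin_intro)+

lemma cong_n_cong: "cong_n s t \<Longrightarrow> cong_n (s + d) j = cong_n (t + d) j"
proof -
  assume "cong_n s t"
  moreover have "s + d - j = (s - t) + (t + d - j)" by simp
  ultimately show ?thesis unfolding cong_n_def by (simp only: dvd_add_right_iff)
qed

lemma cong_n_refl [simp]: "cong_n s s"
  by (simp add: cong_n_def)

lemma cong_n_cancel [simp]: "cong_n (s + d) (j + d) = cong_n s j" "cong_n (s - d) (j - d) = cong_n s j"
  by (simp_all add: cong_n_def)

lemma cong_n_cong0: "cong_n s t \<Longrightarrow> cong_n s j = cong_n t j"
  using cong_n_cong[of s t 0 j] by simp

lemma cong_n_cong_minus: "cong_n s t \<Longrightarrow> cong_n (s - d) j = cong_n (t - d) j"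
  using cong_n_cong[of s t "- d" j] by simp

lemma cong_n_sym: "cong_n s t = cong_n t s"
  unfolding cong_n_def by (simp add: dvd_diff_commute)

lemma kv_cong: "cong_n s t \<Longrightarrow> kv j s = kv j t"
  by (simp add: kv_def cong_n_cong0)

lemma kv_nonzero [simp]: "kv j s \<noteq> 0"
  using eps_nonzero by (simp add: kv_def)

lemma kv_ratio_sym: "kv i j * kv j (i + 1) = kv j i * kv i (j + 1)"
  using eps_nonzero by (simp add: kv_def cong_n_sym[of j] cong_n_sym[of "j + 1"])

lemma eps_sq: "\<epsilon>^2 \<noteq> 1" "\<epsilon> \<noteq> inverse \<epsilon>" "\<epsilon> - inverse \<epsilon> \<noteq> 0"
proof -
  show *: "\<epsilon>^2 \<noteq> 1" using eps_not_root[of 2] by simp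
  then show "\<epsilon> \<noteq> inverse \<epsilon>" using eps_nonzero by (auto simp: power2_eq_square field_simps)
  then show "\<epsilon> - inverse \<epsilon> \<noteq> 0" by simp
qed

lemma not_cong_n_Suc [simp]: "\<not> cong_n s (s + 1)" "\<not> cong_n (s + 1) s" "\<not> cong_n s (s - 1)" "\<not> cong_n (s - 1) s"
  using n_ge_2 by (auto simp: cong_n_def)

lemma kE: "diag (kv i) (opE j v) = (kv i j / kv i (j + 1)) \<cdot> opE j (diag (kv i) v)"
proof (rule E_diag)
  fix s assume s: "cong_n s (j + 1)"
  then have "kv i s = kv i (j + 1)" "kv i (s - 1) = kv i j"
    using cong_n_cong_minus[OF s, of 1 j] by (simp_all add: kv_cong)
  then show "kv i (s - 1) = kv i j / kv i (j + 1) * kv i s" by simp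
qed

lemma kF: "diag (kv i) (opF j v) = (kv i (j + 1) / kv i j) \<cdot> opF j (diag (kv i) v)"
proof (rule F_diag)
  fix s assume "cong_n s j"
  then have "kv i s = kv i j" "kv i (s + 1) = kv i (j + 1)" by (simp_all add: kv_cong)
  then show "kv i (s + 1) = kv i (j + 1) / kv i j * kv i s" by simp
qed

lemma inverse_ratio:
  "c * a = d * b \<Longrightarrow> a \<noteq> 0 \<Longrightarrow> b \<noteq> 0 \<Longrightarrow> c \<noteq> 0 \<Longrightarrow> d \<noteq> 0 \<Longrightarrow> inverse a * (b / c) = inverse (d :: 'k)"
  by (simp add: field_simps)

text \<open>Induction on the number of tensor factors. The terms with \<open>E\<close> and \<open>F\<close> in different factors cancel, and the
first factor contributes through the \<open>sl\<^sub>2\<close>-identity \<open>(\<epsilon> - \<epsilon>\<^sup>-\<^sup>1) / (\<epsilon> - \<epsilon>\<^sup>-\<^sup>1) = 1\<close>.\<close>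
lemma EF_relation:
  "opE i (opF j v) - opF j (opE i v)
    = ((if cong_n i j then 1 else 0) / (\<epsilon> - inverse \<epsilon>)) \<cdot> (diag (kv i) v - diag (\<lambda>s. inverse (kv i s)) v)"
proof (rule lin_eqI[where F = "\<lambda>v. opE i (opF j v) - opF j (opE i v)"])
  fix l
  define d where "d = (if cong_n i j then 1 else 0) / (\<epsilon> - inverse \<epsilon>)"
  show "opE i (opF j (basis_vec l)) - opF j (opE i (basis_vec l))
    = d \<cdot> (diag (kv i) (basis_vec l) - diag (\<lambda>s. inverse (kv i s)) (basis_vec l))"
  proof (induction l)
    case (Cons s l)
    let ?v = "basis_vec l :: int list \<Rightarrow>\<^sub>0 'k"
    have IH: "opE i (opF j ?v) = opF j (opE i ?v) + d \<cdot> (diag (kv i) ?v - diag (\<lambda>s. inverse (kv i s)) ?v)"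
      using Cons by (metis add.commute diff_add_cancel)
    consider "cong_n s i" | "cong_n s (i + 1)" | "\<not> cong_n s i" "\<not> cong_n s (i + 1)" by blast
    then show ?case
    proof cases
      case 1
      then have [simp]: "cong_n s i = True" "cong_n s (i + 1) = False" "cong_n (s + 1) (i + 1)" "kv i s = \<epsilon>" "cong_n s j = cong_n i j" "kv j s = kv j i"
        by (simp_all add: cong_n_cong0[OF 1] cong_n_cong[OF 1] kv_def)
      have d: "cong_n i j \<Longrightarrow> d * (\<epsilon> - inverse \<epsilon>) = 1" "\<not> cong_n i j \<Longrightarrow> d = 0"
        using eps_sq by (simp_all add: d_def)
      have "d * (\<epsilon> * x) = x + d * (inverse \<epsilon> * x)" if "cong_n i j" for x :: 'k
      proof -
        have "d * (\<epsilon> - inverse \<epsilon>) * x = x" using d(1)[OF that] by simp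
        then show ?thesis by (simp add: algebra_simps)
      qed
      moreover have "cong_n i j \<Longrightarrow> kv j i = \<epsilon>" using kv_cong[of i j j] by (simp add: kv_def)
      ultimately show ?thesis using d
        apply (intro poly_mapping_eqI)
        apply (cases "cong_n i j")
        apply (simp_all add: IH pm_lookup pm_scale_distrib flip: cns_basis)
        apply (simp_all add: algebra_simps)
        done
    next
      case 2
      have s1 [simp]: "cong_n (s - 1) i" using cong_n_cong[of s "i + 1" "- 1" i] 2 by simp
      have [simp]: "kv j s = kv j (i + 1)" "kv j (s - 1) = kv j i" by (rule kv_cong, fact)+
      have [simp]: "cong_n s i = False" "cong_n s j = cong_n (i + 1) j" "cong_n (s - 1) j = cong_n i j"
        "cong_n s (i + 1) = True" "cong_n (s + 1) (i + 1) = False"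
        using 2 cong_n_cong0[OF s1] by (simp_all add: cong_n_cong0[OF 2] cong_n_cong[OF 2])
      have [simp]: "kv i s = inverse \<epsilon>" by (simp add: kv_def)
      have d: "cong_n i j \<Longrightarrow> d * (\<epsilon> - inverse \<epsilon>) = 1" "\<not> cong_n i j \<Longrightarrow> d = 0"
        using eps_sq by (simp_all add: d_def)
      have "d * (\<epsilon> * x) = x + d * (inverse \<epsilon> * x)" if "cong_n i j" for x :: 'k
      proof -
        have "d * (\<epsilon> - inverse \<epsilon>) * x = x" using d(1)[OF that] by simp
        then show ?thesis by (simp add: algebra_simps)
      qed
      moreover have "inverse (kv j (i + 1)) * (kv i (j + 1) / kv i j) = inverse (kv j i)"
        by (rule inverse_ratio[OF kv_ratio_sym]) simp_all
      moreover have "cong_n i j \<Longrightarrow> kv j (i + 1) = inverse \<epsilon>" "cong_n i j \<Longrightarrow> cong_n (i + 1) j = False"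
        unfolding kv_def using cong_n_cong[of i j 1] by (simp_all add: cong_n_sym[of j])
      ultimately show ?thesis using d
        apply (intro poly_mapping_eqI)
        apply (cases "cong_n i j")
        apply (simp_all add: IH kF pm_lookup pm_scale_distrib flip: cns_basis)
        apply (simp_all add: algebra_simps)
        done
    next
      case 3
      then have [simp]: "kv i s = 1" "cong_n (s + 1) (i + 1) = False" by (simp_all add: kv_def)
      have *: "cong_n s (i + 1) = False" "cong_n s i = False" using 3 by simp_all
      show ?thesis
      proof (cases "cong_n i j")
        case True
        then have "kv j s = kv i s"
          unfolding kv_def cong_n_sym[of s] cong_n_cong0[OF True] using cong_n_cong[OF True, of 1 s] by simp
        then have [simp]: "kv j s = 1" by simp
        have sj: "cong_n s j = False" using * cong_n_cong0[OF True, of s] by (simp add: cong_n_sym[of s])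
        show ?thesis by (simp add: IH * sj flip: cns_basis)
      next
        case False
        then have d0: "d = 0" by (simp add: d_def)
        have IH0: "opE i (opF j ?v) = opF j (opE i ?v)" using IH by (simp add: d0)
        show ?thesis
        proof (cases "cong_n s j")
          case True
          show ?thesis by (simp add: IH0 * d0 True flip: cns_basis)
        next
          case False
          show ?thesis by (simp add: IH0 * d0 False flip: cns_basis)
        qed
      qed
    qed
  qed simp
qed (intro lin_intro)+

lemma opE_cong: "cong_n i j \<Longrightarrow> opE i = opE j"
  unfolding cong_n_def by (metis E_mod mod_eq_dvd_iff)

lemma opF_cong: "cong_n i j \<Longrightarrow> opF i = opF j"
  unfolding cong_n_def by (metis F_mod mod_eq_dvd_iff)

lemma list_op_eqI:
  assumes "lin F" "lin G" "F (basis_vec []) = G (basis_vec [])"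
    "\<And>s i. F (basis_vec i) = G (basis_vec i) \<Longrightarrow> F (cns s (basis_vec i)) = G (cns s (basis_vec i))"
  shows "F v = G v"
proof (rule lin_eqI[OF assms(1,2)])
  show "F (basis_vec i) = G (basis_vec i)" for i
    by (induction i) (use assms(3,4) in \<open>auto simp: simp flip: cns_basis\<close>)
qed

lemma E_commute_far:
  assumes "\<not> cong_n i j" "\<not> cong_n i (j + 1)" "\<not> cong_n (i + 1) j"
  shows "opE i (opE j v) = opE j (opE i v)"
proof (rule list_op_eqI[where F = "\<lambda>v. opE i (opE j v)"])
  fix s l assume IH: "opE i (opE j (basis_vec l)) = opE j (opE i (basis_vec l))"
  have k: "diag (kv i) (opE j v) = opE j (diag (kv i) v)" "diag (kv j) (opE i v) = opE i (diag (kv j) v)" for v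
    using assms by (simp_all add: kE kv_def cong_n_sym[of j] cong_n_sym[of "j + 1"])
  have s: "\<not> cong_n s (j + 1)" "\<not> cong_n (s - 1) (j + 1)" if h: "cong_n s (i + 1)"
    using assms cong_n_cong0[OF h, of "j + 1"] cong_n_cong_minus[OF h, of 1 "j + 1"] by simp_all
  have s': "\<not> cong_n (s - 1) (i + 1)" if h: "cong_n s (j + 1)"
    using assms cong_n_cong_minus[OF h, of 1 "i + 1"] cong_n_sym[of j "i + 1"] by simp
  from s s' show "opE i (opE j (cns s (basis_vec l))) = opE j (opE i (cns s (basis_vec l)))"
    by (auto simp add: IH k simp flip: cns_basis)
qed (intro lin_intro | simp)+

lemma F_commute_far:
  assumes "\<not> cong_n i j" "\<not> cong_n i (j + 1)" "\<not> cong_n (i + 1) j"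
  shows "opF i (opF j v) = opF j (opF i v)"
proof (rule list_op_eqI[where F = "\<lambda>v. opF i (opF j v)"])
  fix s l assume IH: "opF i (opF j (basis_vec l)) = opF j (opF i (basis_vec l))"
  have s: "\<not> cong_n s j" "\<not> cong_n s (j + 1)" "\<not> cong_n (s + 1) j" "\<not> cong_n (s + 1) (j + 1)" if h: "cong_n s i"
    using assms cong_n_cong0[OF h, of j] cong_n_cong0[OF h, of "j + 1"] cong_n_cong[OF h, of 1 j] cong_n_cong[OF h, of 1 "j + 1"] by simp_all
  have s': "\<not> cong_n s (i + 1)" "\<not> cong_n (s + 1) i" "\<not> cong_n (s + 1) (i + 1)" if h: "cong_n s j"
    using assms cong_n_cong0[OF h, of "i + 1"] cong_n_cong[OF h, of 1 i] cong_n_cong[OF h, of 1 "i + 1"]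
      cong_n_sym[of j "i + 1"] cong_n_sym[of "j + 1" i] cong_n_sym[of i j] by simp_all
  from s s' show "opF i (opF j (cns s (basis_vec l))) = opF j (opF i (cns s (basis_vec l)))"
    by (cases "cong_n s i"; cases "cong_n s j") (auto simp add: IH kv_def mult_ac pm_scale_distrib simp flip: cns_basis)
qed (intro lin_intro | simp)+

lemma cong_n_rel: "cong_n s t \<Longrightarrow> cong_n s' w \<longleftrightarrow> int n dvd s' - s + t - w"
  using cong_n_cong[of s t "s' - s" w] by (simp add: cong_n_def algebra_simps)

lemma not_dvd_small:
  "\<not> int n dvd 1" "\<not> int n dvd - 1" "n \<ge> 3 \<Longrightarrow> \<not> int n dvd 2" "n \<ge> 3 \<Longrightarrow> \<not> int n dvd - 2"
  using n_ge_2 zdvd_imp_le[of "int n" 2] by auto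

text \<open>The Serre relation is inherited by \<open>\<omega>\<^sub>s \<otimes> v\<close> from \<open>v\<close>: in the first factor at most one \<open>E\<^sub>i\<close> and one
\<open>E\<^sub>j\<close> can act, and the remaining terms carry powers of \<open>\<epsilon>\<close> that cancel. The hypotheses \<open>k\<close> and \<open>e\<close> collect the arithmetic
modulo \<open>n\<close>, so that both orders of the neighbours \<open>i\<close> and \<open>j\<close> are covered.\<close>
lemma opE_serre2_step:
  fixes l :: "int list"
  defines "v \<equiv> basis_vec l :: int list \<Rightarrow>\<^sub>0 'k"
  assumes IH: "opE i (opE i (opE j v)) + opE j (opE i (opE i v)) = (\<epsilon> + inverse \<epsilon>) \<cdot> opE i (opE j (opE i v))"
    and k: "kv i i = \<epsilon>" "kv i (i + 1) = inverse \<epsilon>" "kv j j = \<epsilon>" "kv j (j + 1) = inverse \<epsilon>"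
      "kv i (j + 1) = \<epsilon> * kv i j" "kv j (i + 1) = \<epsilon> * kv j i"
    and e: "\<not> (cong_n s (i + 1) \<and> cong_n s (j + 1))" "cong_n s (i + 1) \<Longrightarrow> \<not> cong_n (s - 1) (i + 1)"
     "cong_n s (j + 1) \<Longrightarrow> \<not> cong_n (s - 1) (j + 1)"
     "cong_n s (i + 1) \<Longrightarrow> \<not> cong_n (s - 2) (i + 1)" "cong_n s (j + 1) \<Longrightarrow> cong_n (s - 1) (i + 1) \<Longrightarrow> \<not> cong_n (s - 2) (i + 1)"
  shows "opE i (opE i (opE j (cns s v))) + opE j (opE i (opE i (cns s v))) = (\<epsilon> + inverse \<epsilon>) \<cdot> opE i (opE j (opE i (cns s v)))"
proof -
  have IH': "opE i (opE i (opE j v)) = (\<epsilon> + inverse \<epsilon>) \<cdot> opE i (opE j (opE i v)) - opE j (opE i (opE i v))"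
    using IH by (simp add: eq_diff_eq)
  have "kv i j / kv i (j + 1) = inverse \<epsilon>" "kv j i / kv j (i + 1) = inverse \<epsilon>" "kv i i / kv i (i + 1) = \<epsilon>^2" "kv j j / kv j (j + 1) = \<epsilon>^2"
    using eps_nonzero kv_nonzero unfolding k by (simp_all add: field_simps power2_eq_square)
  then have k: "diag (kv i) (opE i v) = \<epsilon>^2 \<cdot> opE i (diag (kv i) v)" "diag (kv i) (opE j v) = inverse \<epsilon> \<cdot> opE j (diag (kv i) v)"
    "diag (kv j) (opE i v) = inverse \<epsilon> \<cdot> opE i (diag (kv j) v)" "diag (kv j) (opE j v) = \<epsilon>^2 \<cdot> opE j (diag (kv j) v)" for v
    by (simp_all only: kE)
  consider "cong_n s (i + 1)" "cong_n (s - 1) (j + 1)" | "cong_n s (i + 1)" "\<not> cong_n (s - 1) (j + 1)"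
     | "cong_n s (j + 1)" "cong_n (s - 1) (i + 1)" | "cong_n s (j + 1)" "\<not> cong_n (s - 1) (i + 1)"
     | "\<not> cong_n s (i + 1)" "\<not> cong_n s (j + 1)" by blast
  then show ?thesis
  proof cases
    case 1 show ?thesis
      by (rule poly_mapping_eqI, use 1 e in \<open>simp add: IH' k pm_lookup pm_scale_distrib\<close>)
        (simp add: algebra_simps power2_eq_square)
  next
    case 2 show ?thesis
      by (rule poly_mapping_eqI, use 2 e in \<open>simp add: IH' k pm_lookup pm_scale_distrib\<close>)
        (simp add: algebra_simps power2_eq_square)
  next
    case 3 show ?thesis
      by (rule poly_mapping_eqI, use 3 e in \<open>simp add: IH' k pm_lookup pm_scale_distrib\<close>)
        (simp add: algebra_simps power2_eq_square)
  next
    case 4 show ?thesis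
      by (rule poly_mapping_eqI, use 4 e in \<open>simp add: IH' k pm_lookup pm_scale_distrib\<close>)
        (simp add: algebra_simps power2_eq_square)
  next
    case 5 show ?thesis
      by (rule poly_mapping_eqI, use 5 e in \<open>simp add: IH' k pm_lookup pm_scale_distrib\<close>)
  qed
qed

lemma E_serre2:
  assumes n3: "n \<ge> 3" and ij: "j = i + 1 \<or> i = j + 1"
  shows "opE i (opE i (opE j v)) + opE j (opE i (opE i v)) = (\<epsilon> + inverse \<epsilon>) \<cdot> opE i (opE j (opE i v))"
proof (rule list_op_eqI[where F = "\<lambda>v. opE i (opE i (opE j v)) + opE j (opE i (opE i v))"], goal_cases)
  case (4 s l)
  have e1: "\<not> cong_n s (j + 1)" "\<not> cong_n (s - 1) (i + 1)" "\<not> cong_n (s - 2) (i + 1)"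
    if h: "cong_n s (i + 1)"
    using ij not_dvd_small n3 by (auto simp: cong_n_rel[OF h])
  have e2: "\<not> cong_n (s - 1) (j + 1)" "cong_n (s - 1) (i + 1) \<Longrightarrow> \<not> cong_n (s - 2) (i + 1)"
    if h: "cong_n s (j + 1)"
    using ij not_dvd_small n3 by (auto simp: cong_n_rel[OF h])
  have k: "kv i (j + 1) = \<epsilon> * kv i j" "kv j (i + 1) = \<epsilon> * kv j i" "kv i i = \<epsilon>" "kv i (i + 1) = inverse \<epsilon>"
    "kv j j = \<epsilon>" "kv j (j + 1) = inverse \<epsilon>"
    using ij not_dvd_small n3 by (auto simp: kv_def cong_n_def)
  show ?case by (rule opE_serre2_step) (use 4 e1 e2 k in blast)+
qed (intro lin_intro | simp)+

lemma kv_values: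
  "kv i i = \<epsilon>" "kv i (i + 1) = inverse \<epsilon>"
  by (simp_all add: kv_def)

lemma opF_serre2_step:
  fixes l :: "int list"
  defines "v \<equiv> basis_vec l :: int list \<Rightarrow>\<^sub>0 'k"
  assumes IH: "opF i (opF i (opF j v)) + opF j (opF i (opF i v)) = (\<epsilon> + inverse \<epsilon>) \<cdot> opF i (opF j (opF i v))"
    and k: "cong_n s i \<Longrightarrow> kv i s = \<epsilon> \<and> kv i (s + 1) = inverse \<epsilon> \<and> kv j (s + 1) = \<epsilon> * kv j s"
      "cong_n s j \<Longrightarrow> kv j s = \<epsilon> \<and> kv j (s + 1) = inverse \<epsilon> \<and> kv i (s + 1) = \<epsilon> * kv i s"
      "cong_n s i \<Longrightarrow> cong_n (s + 1) j \<Longrightarrow> kv i (s + 2) = 1 \<and> kv j s = 1 \<and> kv j (s + 2) = inverse \<epsilon>"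
      "cong_n s j \<Longrightarrow> cong_n (s + 1) i \<Longrightarrow> kv j (s + 2) = 1 \<and> kv i s = 1 \<and> kv i (s + 2) = inverse \<epsilon>"
    and e: "\<not> (cong_n s i \<and> cong_n s j)" "cong_n s i \<Longrightarrow> \<not> cong_n (s + 1) i"
     "cong_n s j \<Longrightarrow> \<not> cong_n (s + 1) j" "cong_n s i \<Longrightarrow> \<not> cong_n (s + 2) i"
     "cong_n s j \<Longrightarrow> cong_n (s + 1) i \<Longrightarrow> \<not> cong_n (s + 2) i"
  shows "opF i (opF i (opF j (cns s v))) + opF j (opF i (opF i (cns s v))) = (\<epsilon> + inverse \<epsilon>) \<cdot> opF i (opF j (opF i (cns s v)))"
proof -
  have IH': "opF i (opF i (opF j v)) = (\<epsilon> + inverse \<epsilon>) \<cdot> opF i (opF j (opF i v)) - opF j (opF i (opF i v))"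
    using IH by (simp add: eq_diff_eq)
  consider "cong_n s i" "cong_n (s + 1) j" | "cong_n s i" "\<not> cong_n (s + 1) j"
     | "cong_n s j" "cong_n (s + 1) i" | "cong_n s j" "\<not> cong_n (s + 1) i"
     | "\<not> cong_n s i" "\<not> cong_n s j" by blast
  then show ?thesis
  proof cases
    case 1 show ?thesis
      by (rule poly_mapping_eqI, use 1 e k in \<open>simp add: IH' pm_lookup pm_scale_distrib\<close>)
        (simp add: algebra_simps power2_eq_square)
  next
    case 2 show ?thesis
      by (rule poly_mapping_eqI, use 2 e k in \<open>simp add: IH' pm_lookup pm_scale_distrib\<close>)
        (simp add: algebra_simps power2_eq_square)
  next
    case 3 show ?thesis
      by (rule poly_mapping_eqI, use 3 e k in \<open>simp add: IH' pm_lookup pm_scale_distrib\<close>)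
        (simp add: algebra_simps power2_eq_square)
  next
    case 4 show ?thesis
      by (rule poly_mapping_eqI, use 4 e k in \<open>simp add: IH' pm_lookup pm_scale_distrib\<close>)
        (simp add: algebra_simps power2_eq_square)
  next
    case 5 show ?thesis
      by (rule poly_mapping_eqI, use 5 e in \<open>simp add: IH' pm_lookup pm_scale_distrib\<close>)
        (simp add: algebra_simps)
  qed
qed

lemma F_serre2:
  assumes n3: "n \<ge> 3" and ij: "j = i + 1 \<or> i = j + 1"
  shows "opF i (opF i (opF j v)) + opF j (opF i (opF i v)) = (\<epsilon> + inverse \<epsilon>) \<cdot> opF i (opF j (opF i v))"
proof (rule list_op_eqI[where F = "\<lambda>v. opF i (opF i (opF j v)) + opF j (opF i (opF i v))"], goal_cases)
  case (4 s l)
  have e1: "\<not> cong_n s j" "\<not> cong_n (s + 1) i" "\<not> cong_n (s + 2) i"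
     "kv i s = \<epsilon> \<and> kv i (s + 1) = inverse \<epsilon> \<and> kv j (s + 1) = \<epsilon> * kv j s"
     "cong_n (s + 1) j \<Longrightarrow> kv i (s + 2) = 1 \<and> kv j s = 1 \<and> kv j (s + 2) = inverse \<epsilon>"
    if h: "cong_n s i"
    using ij not_dvd_small n3 by (auto simp: cong_n_rel[OF h] kv_def)
  have e2: "\<not> cong_n (s + 1) j" "cong_n (s + 1) i \<Longrightarrow> \<not> cong_n (s + 2) i"
     "kv j s = \<epsilon> \<and> kv j (s + 1) = inverse \<epsilon> \<and> kv i (s + 1) = \<epsilon> * kv i s"
     "cong_n (s + 1) i \<Longrightarrow> kv j (s + 2) = 1 \<and> kv i s = 1 \<and> kv i (s + 2) = inverse \<epsilon>"
    if h: "cong_n s j"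
    using ij not_dvd_small n3 by (auto simp: cong_n_rel[OF h] kv_def)
  show ?case by (rule opF_serre2_step) (use 4 e1 e2 in blast)+
qed (intro lin_intro | simp)+

lemma power6_eq: "(x :: 'k) ^ 6 = x * x * x * x * x * x"
  by (simp add: eval_nat_numeral mult.assoc)

text \<open>For \<open>n = 2\<close> residues are parities, and only two cases for the first factor remain.\<close>
lemma E_serre3:
  assumes n2: "n = 2" and j: "cong_n j (i + 1)"
  defines "b \<equiv> \<epsilon>^2 + 1 + inverse \<epsilon>^2"
  shows "opE i (opE i (opE i (opE j v))) + b \<cdot> opE i (opE j (opE i (opE i v)))
    = b \<cdot> opE i (opE i (opE j (opE i v))) + opE j (opE i (opE i (opE i v)))"
proof (rule list_op_eqI[where F = "\<lambda>v. opE i (opE i (opE i (opE j v))) + b \<cdot> opE i (opE j (opE i (opE i v)))"], goal_cases)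
  case (4 s l)
  have eq2: "cong_n x y \<longleftrightarrow> even (x - y)" for x y
    unfolding cong_n_def using n2 by simp
  let ?v = "basis_vec l :: int list \<Rightarrow>\<^sub>0 'k"
  have IH: "opE i (opE i (opE i (opE j ?v))) = b \<cdot> opE i (opE i (opE j (opE i ?v))) + opE j (opE i (opE i (opE i ?v))) - b \<cdot> opE i (opE j (opE i (opE i ?v)))"
    using 4 by (simp add: eq_diff_eq)
  have p: "cong_n (s - 1) x = (\<not> cong_n s x)" "cong_n (s - 2) x = cong_n s x" "cong_n (s - 3) x = (\<not> cong_n s x)" "cong_n s (j + 1) = (\<not> cong_n s (i + 1))" for x
    using j unfolding eq2 by presburger+
  have kvs: "kv i j = inverse \<epsilon>" "kv i (j + 1) = \<epsilon>" "kv j i = inverse \<epsilon>" "kv j (i + 1) = \<epsilon>"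
  proof -
    have "cong_n j i = False" "cong_n i j = False" "cong_n (j + 1) i" "cong_n (i + 1) j" "cong_n j (i + 1)" "cong_n i (j + 1)" "cong_n (j + 1) (i + 1) = False" "cong_n (i + 1) (j + 1) = False"
      using j unfolding eq2 by presburger+
    then show "kv i j = inverse \<epsilon>" "kv i (j + 1) = \<epsilon>" "kv j i = inverse \<epsilon>" "kv j (i + 1) = \<epsilon>"
      by (simp_all add: kv_def)
  qed
  have k: "diag (kv i) (opE i v) = \<epsilon>^2 \<cdot> opE i (diag (kv i) v)" "diag (kv i) (opE j v) = inverse \<epsilon>^2 \<cdot> opE j (diag (kv i) v)"
    "diag (kv j) (opE i v) = inverse \<epsilon>^2 \<cdot> opE i (diag (kv j) v)" "diag (kv j) (opE j v) = \<epsilon>^2 \<cdot> opE j (diag (kv j) v)" for v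
    by (simp_all add: kE kvs kv_values power2_eq_square divide_inverse)
  show ?case
  proof (cases "cong_n s (i + 1)")
    case True
    show ?thesis unfolding b_def
      by (rule poly_mapping_eqI, simp add: True p k IH[unfolded b_def] pm_lookup pm_scale_distrib flip: cns_basis)
        (simp add: algebra_simps power2_eq_square power4_eq_xxxx power6_eq)
  next
    case False
    show ?thesis unfolding b_def
      by (rule poly_mapping_eqI, simp add: False p k IH[unfolded b_def] pm_lookup pm_scale_distrib flip: cns_basis)
        (simp add: algebra_simps power2_eq_square power4_eq_xxxx power6_eq)
  qed
qed (intro lin_intro | simp)+

lemma F_serre3:
  assumes n2: "n = 2" and j: "cong_n j (i + 1)"
  defines "b \<equiv> \<epsilon>^2 + 1 + inverse \<epsilon>^2"
  shows "opF i (opF i (opF i (opF j v))) + b \<cdot> opF i (opF j (opF i (opF i v)))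
    = b \<cdot> opF i (opF i (opF j (opF i v))) + opF j (opF i (opF i (opF i v)))"
proof (rule list_op_eqI[where F = "\<lambda>v. opF i (opF i (opF i (opF j v))) + b \<cdot> opF i (opF j (opF i (opF i v)))"], goal_cases)
  case (4 s l)
  have eq2: "cong_n x y \<longleftrightarrow> even (x - y)" for x y
    unfolding cong_n_def using n2 by simp
  let ?v = "basis_vec l :: int list \<Rightarrow>\<^sub>0 'k"
  have IH: "opF i (opF i (opF i (opF j ?v))) = b \<cdot> opF i (opF i (opF j (opF i ?v))) + opF j (opF i (opF i (opF i ?v))) - b \<cdot> opF i (opF j (opF i (opF i ?v)))"
    using 4 by (simp add: eq_diff_eq)
  have p: "cong_n (y + 1) x = (\<not> cong_n y x)" "cong_n (y + 2) x = cong_n y x" "cong_n (y + 3) x = (\<not> cong_n y x)" "cong_n y (x + 1) = (\<not> cong_n y x)" "cong_n y j = (\<not> cong_n y i)" for x y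
    using j unfolding eq2 by presburger+
  have kv: "kv i y = (if cong_n y i then \<epsilon> else inverse \<epsilon>)" "kv j y = (if cong_n y i then inverse \<epsilon> else \<epsilon>)" for y
    unfolding kv_def p by simp_all
  show ?case
  proof (cases "cong_n s i")
    case True
    show ?thesis unfolding b_def
      by (rule poly_mapping_eqI, simp add: True p kv IH[unfolded b_def] pm_lookup pm_scale_distrib flip: cns_basis)
        (simp add: True p algebra_simps power2_eq_square power4_eq_xxxx power6_eq)
  next
    case False
    show ?thesis unfolding b_def
      by (rule poly_mapping_eqI, simp add: False p kv IH[unfolded b_def] pm_lookup pm_scale_distrib flip: cns_basis)
        (simp add: False p algebra_simps power2_eq_square power4_eq_xxxx power6_eq)
  qed
qed (intro lin_intro | simp)+

end

text \<open>Adjacent transpositions generate all permutations.\<close>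
lemma swap_closed_perm:
  assumes swap: "\<And>xs a b ys. Q (xs @ a # b # ys) \<Longrightarrow> Q (xs @ b # a # ys)"
    and "mset xs = mset ys" "Q xs"
  shows "Q ys"
proof -
  have front: "Q (zs @ us @ y # vs) \<Longrightarrow> Q (zs @ y # us @ vs)" for zs us vs y
  proof (induction us arbitrary: vs rule: rev_induct)
    case (snoc u us)
    then have "Q ((zs @ us) @ u # y # vs)" by simp
    from swap[OF this] show ?case using snoc.IH[of "u # vs"] by simp
  qed simp
  have "mset xs = mset ys \<Longrightarrow> Q (zs @ xs) \<Longrightarrow> Q (zs @ ys)" for zs
  proof (induction ys arbitrary: xs zs)
    case (Cons y ys)
    then have "y \<in> set xs" by (metis list.set_intros(1) mset_eq_setD)
    then obtain us vs where xs: "xs = us @ y # vs" by (meson split_list)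
    have "mset (us @ vs) = mset ys" using Cons.prems(1) by (simp add: xs)
    moreover have "Q ((zs @ [y]) @ us @ vs)" using front[of zs us y vs] Cons.prems(2) by (simp add: xs)
    ultimately show ?case using Cons.IH[of "us @ vs" "zs @ [y]"] by simp
  qed simp
  from this[of "[]"] show ?thesis using assms by simp
qed

lemma pm_scale_minus_left [simp]: "(- c) \<cdot> v = - (c \<cdot> v)"
  by (rule poly_mapping_eqI) simp

lemma expand_parts:
  assumes "w \<in> tensor_space (Suc r)" "finite S" "{s. part s w \<noteq> 0} \<subseteq> S"
  shows "w = (\<Sum>s\<in>S. cns s (part s w))"
proof (rule eq_by_parts[OF assms(1)])
  show "(\<Sum>s\<in>S. cns s (part s w)) \<in> tensor_space (Suc r)"
    using assms(1) unfolding tensor_space_eq_sp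
    by (intro sp_sum) (simp flip: tensor_space_eq_sp)
  fix s
  have "part s (\<Sum>t\<in>S. cns t (part t w)) = (\<Sum>t\<in>S. if s = t then part t w else 0)"
    by (simp add: part_cns)
  then show "part s w = part s (\<Sum>s\<in>S. cns s (part s w))"
    using assms(2,3) by (auto simp: sum.delta')
qed

context affine_params begin

section \<open>A triangular operator separating two neighbouring residues\<close>

text \<open>The iterated \<open>\<epsilon>\<close>-commutator of \<open>E\<^bsub>j+1\<^esub>, \<dots>, E\<^bsub>j+1+m\<^esub>\<close>, a real root vector that lowers an entry by \<open>m + 1\<close>.\<close>
primrec root_op :: "int \<Rightarrow> nat \<Rightarrow> (int list \<Rightarrow>\<^sub>0 'k) \<Rightarrow> (int list \<Rightarrow>\<^sub>0 'k)" where
  "root_op j 0 v = opE (j + 1) v"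
| "root_op j (Suc m) v = root_op j m (opE (j + int m + 2) v) - \<epsilon> \<cdot> opE (j + int m + 2) (root_op j m v)"

text \<open>What \<open>root_op j m\<close> leaves on the other factors when it lowers the first entry by \<open>l\<close>; see \<open>root_op_cns\<close>.\<close>
primrec root_tail :: "int \<Rightarrow> nat \<Rightarrow> nat \<Rightarrow> (int list \<Rightarrow>\<^sub>0 'k) \<Rightarrow> (int list \<Rightarrow>\<^sub>0 'k)" where
  "root_tail j 0 l v = diag (kv (j + 1)) v"
| "root_tail j (Suc m) l v = (if l = m + 2 then root_tail j m (m + 1) (diag (kv (j + int m + 2)) v)
     else root_tail j m l (opE (j + int m + 2) v) - \<epsilon> \<cdot> opE (j + int m + 2) (root_tail j m l v))"

lemma lin_root_op: "lin (root_op j m)"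
proof (induction m)
  case 0
  have "root_op j 0 = opE (j + 1)" by (rule ext) simp
  then show ?case by (simp add: lin_ops)
next
  case (Suc m)
  have "lin (\<lambda>v. root_op j m (opE (j + int m + 2) v) - \<epsilon> \<cdot> opE (j + int m + 2) (root_op j m v))"
    by (intro lin_intro lin_compose[OF Suc] lin_ops Suc)
  moreover have "root_op j (Suc m) = (\<lambda>v. root_op j m (opE (j + int m + 2) v) - \<epsilon> \<cdot> opE (j + int m + 2) (root_op j m v))"
    by (rule ext) simp
  ultimately show ?case by simp
qed

lemma lin_root_tail: "lin (root_tail j m l)"
proof (induction m arbitrary: l)
  case 0
  have "root_tail j 0 l = diag (kv (j + 1))" by (rule ext) simp
  then show ?case by (simp add: lin_ops)
next
  case (Suc m)
  have "root_tail j (Suc m) l = (if l = m + 2 then (\<lambda>v. root_tail j m (m + 1) (diag (kv (j + int m + 2)) v))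
     else (\<lambda>v. root_tail j m l (opE (j + int m + 2) v) - \<epsilon> \<cdot> opE (j + int m + 2) (root_tail j m l v)))"
    by (rule ext) simp
  moreover have "lin (\<lambda>v. root_tail j m l (opE (j + int m + 2) v) - \<epsilon> \<cdot> opE (j + int m + 2) (root_tail j m l v))"
    by (intro lin_intro lin_compose[OF Suc] lin_ops Suc)
  moreover have "lin (\<lambda>v. root_tail j m (m + 1) (diag (kv (j + int m + 2)) v))"
    by (intro lin_compose[OF Suc] lin_ops)
  ultimately show ?case by simp
qed

lemmas root_lin [simp] = lin_rules[OF lin_root_op] lin_rules[OF lin_root_tail]

lemma cong_n_shift_right [simp]: "cong_n s (j + int n) = cong_n s j"
  using cong_n_cancel(2)[of s "int n" "j + int n"] by simp

lemma not_dvd_between: "0 < d \<Longrightarrow> d < int n \<Longrightarrow> \<not> int n dvd d" "- int n < d \<Longrightarrow> d < 0 \<Longrightarrow> \<not> int n dvd d"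
  using zdvd_imp_le[of "int n" d] zdvd_imp_le[of "int n" "- d"] by auto

lemma kv_eq_1: "\<not> cong_n s j \<Longrightarrow> \<not> cong_n s (j + 1) \<Longrightarrow> kv j s = 1"
  by (simp add: kv_def)

lemma diag_root_op_far:
  assumes "\<And>t. t \<le> m \<Longrightarrow> kv c (j + 1 + int t) = kv c (j + 1 + int t + 1)"
  shows "diag (kv c) (root_op j m v) = root_op j m (diag (kv c) v)"
  using assms
proof (induction m arbitrary: v)
  case 0
  then show ?case using 0[of 0] kE[of c "j + 1" v] by simp
next
  case (Suc m)
  have "diag (kv c) (opE (j + int m + 2) v) = opE (j + int m + 2) (diag (kv c) v)" for v
    using Suc.prems[of "Suc m"] kE[of c "j + int m + 2" v] by (simp add: algebra_simps)
  then show ?case using Suc by simp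
qed

text \<open>Only the last commutator factor fails to commute with this diagonal operator. The factor \<open>\<epsilon>\<^sup>-\<^sup>1\<close> is the reason for
the coefficient \<open>\<epsilon>\<close> in the definition of \<open>root_op\<close>: it cancels the terms in which the last
generator acts on the first tensor factor and the others on the remaining factors.\<close>
lemma diag_root_op_last:
  assumes "m + 3 \<le> n"
  shows "diag (kv (j + int m + 2)) (root_op j m v) = inverse \<epsilon> \<cdot> root_op j m (diag (kv (j + int m + 2)) v)"
proof -
  let ?c = "j + int m + 2"
  have "\<not> cong_n (?c - 1) ?c" "\<not> cong_n (?c - 1) (?c + 1)"
    using not_dvd_between(2)[of "- 1"] not_dvd_between(2)[of "- 2"] assms by (auto simp: cong_n_def)
  then have 1: "kv ?c (?c - 1) = 1" by (rule kv_eq_1)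
  have 2: "kv ?c ?c = \<epsilon>" by (rule kv_values)
  have last: "diag (kv ?c) (opE (j + int m + 1) v) = inverse \<epsilon> \<cdot> opE (j + int m + 1) (diag (kv ?c) v)" for v
  proof -
    have "diag (kv c) (opE (c - 1) v) = inverse \<epsilon> \<cdot> opE (c - 1) (diag (kv c) v)"
      if "kv c (c - 1) = 1" "kv c c = \<epsilon>" for c
      using kE[of c "c - 1" v] that by (simp add: inverse_eq_divide)
    from this[OF 1 2] show ?thesis by (simp add: algebra_simps)
  qed
  show ?thesis
  proof (cases m)
    case 0
    then show ?thesis using last by simp
  next
    case (Suc m')
    have far: "diag (kv ?c) (root_op j m' v) = root_op j m' (diag (kv ?c) v)" for v
    proof (rule diag_root_op_far)
      fix t assume t: "t \<le> m'"
      have "\<not> cong_n (j + 1 + int t) ?c" "\<not> cong_n (j + 1 + int t) (?c + 1)" "\<not> cong_n (j + 1 + int t + 1) ?c" "\<not> cong_n (j + 1 + int t + 1) (?c + 1)"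
        unfolding cong_n_def using t Suc assms by (intro not_dvd_between(2); simp)+
      then show "kv ?c (j + 1 + int t) = kv ?c (j + 1 + int t + 1)"
        by (simp add: kv_eq_1)
    qed
    have "j + int m + 1 = j + int m' + 2" using Suc by simp
    then have last': "diag (kv ?c) (opE (j + int m' + 2) v) = inverse \<epsilon> \<cdot> opE (j + int m' + 2) (diag (kv ?c) v)" for v
      using last by metis
    show ?thesis using last' far Suc by (simp add: pm_scale_distrib mult.commute)
  qed
qed

text \<open>The first entry is either left alone or lowered in a single way, by the distance to the residue \<open>j + 1\<close>.\<close>
lemma root_op_cns:
  assumes "m + 2 \<le> n"
  shows "(\<And>l. 1 \<le> l \<Longrightarrow> l \<le> m + 1 \<Longrightarrow> \<not> cong_n s (j + 1 + int l)) \<Longrightarrow> root_op j m (cns s v) = cns s (root_op j m v)"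
    and "1 \<le> l \<Longrightarrow> l \<le> m + 1 \<Longrightarrow> cong_n s (j + 1 + int l) \<Longrightarrow>
      root_op j m (cns s v) = cns s (root_op j m v) + cns (s - int l) (root_tail j m l v)"
  using assms
proof (induction m arbitrary: s v l)
  case 0
  { case 1
    from 1(1)[of 1] show ?case by (simp add: algebra_simps) }
  { case 2
    then have "l = 1" by simp
    with 2 show ?case by (simp add: algebra_simps) }
next
  case (Suc m)
  let ?c = "j + int m + 2"
  { case 1
    from 1(1)[of "m + 2"] have c: "\<not> cong_n s (?c + 1)" by (simp add: algebra_simps)
    have "root_op j m (cns s v) = cns s (root_op j m v)" for v
      by (rule Suc.IH(1)) (use 1 in simp_all)
    then show ?case using c by simp }
  { case 2
    show ?case
    proof (cases "l = m + 2")
      case False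
      then have l: "l \<le> m + 1" using 2 by simp
      have c: "\<not> cong_n s (?c + 1)" "\<not> cong_n (s - int l) (?c + 1)"
        unfolding cong_n_rel[OF 2(3)] using l 2 by (intro not_dvd_between(2); simp)+
      have IH: "root_op j m (cns s v) = cns s (root_op j m v) + cns (s - int l) (root_tail j m l v)" for v
        by (rule Suc.IH(2)) (use 2 l in simp_all)
      show ?thesis using c False by (simp add: IH pm_scale_distrib)
    next
      case True
      have e: "cong_n s (?c + 1)" using 2(3) True by (simp add: algebra_simps)
      then have e': "cong_n (s - 1) (j + 1 + int (m + 1))" using cong_n_cancel(2)[of s 1 "?c + 1"] by (simp add: algebra_simps)
      have IH2: "root_op j m (cns (s - 1) v) = cns (s - 1) (root_op j m v) + cns (s - 1 - int (m + 1)) (root_tail j m (m + 1) v)" for v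
        by (rule Suc.IH(2)) (use 2 e' in simp_all)
      have IH1: "root_op j m (cns s v) = cns s (root_op j m v)" for v
      proof (rule Suc.IH(1))
        fix l assume "1 \<le> l" "l \<le> m + 1"
        then show "\<not> cong_n s (j + 1 + int l)"
          unfolding cong_n_rel[OF e] using 2 by (intro not_dvd_between(1)) simp_all
      qed (use 2 in simp)
      have "diag (kv ?c) (root_op j m v) = inverse \<epsilon> \<cdot> root_op j m (diag (kv ?c) v)"
        by (rule diag_root_op_last) (use 2 in simp)
      moreover have s: "s - 1 - int (m + 1) = s - int (m + 2)" by simp
      ultimately show ?thesis using e True by (simp add: IH1 IH2[unfolded s] pm_scale_distrib)
    qed }
qed

text \<open>A root vector of the imaginary root. The coefficient \<open>\<epsilon>\<^sup>2\<close> makes the mixed terms cancel in \<open>split_op_cns_self\<close>, so that the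
operator is triangular with respect to the residues \<open>j\<close> and \<open>j + 1\<close>.\<close>
definition split_op :: "int \<Rightarrow> (int list \<Rightarrow>\<^sub>0 'k) \<Rightarrow> (int list \<Rightarrow>\<^sub>0 'k)" where
  "split_op j v = opE j (root_op j (n - 2) v) - \<epsilon>^2 \<cdot> root_op j (n - 2) (opE j v)"

lemma lin_split_op: "lin (split_op j)"
proof -
  have "lin (\<lambda>v. opE j (root_op j (n - 2) v) - \<epsilon>^2 \<cdot> root_op j (n - 2) (opE j v))"
    by (intro lin_intro lin_compose[OF lin_root_op] lin_root_op lin_ops)
  moreover have "split_op j = (\<lambda>v. opE j (root_op j (n - 2) v) - \<epsilon>^2 \<cdot> root_op j (n - 2) (opE j v))"
    by (rule ext) (simp add: split_op_def)
  ultimately show ?thesis by simp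
qed

lemmas split_lin [simp] = lin_rules[OF lin_split_op]

abbreviation avoid1 :: "int \<Rightarrow> (int list \<Rightarrow>\<^sub>0 'k) set" where
  "avoid1 j \<equiv> sp (\<lambda>i. \<forall>s\<in>set i. \<not> cong_n s j)"
abbreviation avoid2 :: "int \<Rightarrow> (int list \<Rightarrow>\<^sub>0 'k) set" where
  "avoid2 j \<equiv> sp (\<lambda>i. \<forall>s\<in>set i. \<not> cong_n s j \<and> \<not> cong_n s (j + 1))"

lemma diag_sp: "v \<in> sp Q \<Longrightarrow> diag c v \<in> sp Q"
  by (erule lin_maps_sp[OF lin_ops(1)]) (simp add: diag_basis sp_scale)

lemma cns_sp: "v \<in> sp Q \<Longrightarrow> (\<And>i. Q i \<Longrightarrow> Q' (s # i)) \<Longrightarrow> cns s v \<in> sp Q'"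
  by (erule lin_maps_sp[OF lin_cns]) simp

lemma E_avoid1:
  assumes "v \<in> avoid1 j" "\<not> cong_n c j"
  shows "opE c v \<in> avoid1 j"
proof (rule lin_maps_sp[OF lin_ops(2) assms(1)])
  show "\<forall>s\<in>set i. \<not> cong_n s j \<Longrightarrow> opE c (basis_vec i) \<in> avoid1 j" for i
  proof (induction i)
    case (Cons s i)
    have "\<not> cong_n (s - 1) j" if "cong_n s (c + 1)" using cong_n_cong_minus[OF that, of 1 j] assms(2) by simp
    then show ?case using Cons
      by (auto intro!: sp_add cns_sp[where Q = "\<lambda>i. \<forall>s\<in>set i. \<not> cong_n s j"] diag_sp simp flip: cns_basis)
  qed simp
qed

lemma E_kills_avoid:
  assumes "v \<in> avoid1 j" "cong_n j (c + 1)"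
  shows "opE c v = 0"
proof (rule lin_eq_on_sp[OF lin_ops(2) lin_const_zero _ assms(1)])
  show "\<forall>s\<in>set i. \<not> cong_n s j \<Longrightarrow> opE c (basis_vec i) = 0" for i
  proof (induction i)
    case (Cons s i)
    have "\<not> cong_n s (c + 1)" using Cons.prems assms(2) cong_n_cong0[of s "c + 1" j] cong_n_sym by auto
    then show ?case using Cons by (simp flip: cns_basis)
  qed simp
qed

lemma avoid2_avoid1: "v \<in> avoid2 j \<Longrightarrow> v \<in> avoid1 j" "v \<in> avoid2 j \<Longrightarrow> v \<in> avoid1 (j + 1)"
  by (auto simp: sp_def)

lemma root_op_avoid1: "v \<in> avoid1 j \<Longrightarrow> m + 2 < n \<Longrightarrow> root_op j m v \<in> avoid1 j"
proof (induction m arbitrary: v)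
  case 0
  then show ?case by (auto intro!: E_avoid1)
next
  case (Suc m)
  have "\<not> cong_n (j + int m + 2) j" unfolding cong_n_def using Suc.prems by (intro not_dvd_between) simp_all
  then show ?case using Suc by (auto intro!: sp_diff sp_scale E_avoid1)
qed

lemma root_tail_avoid1: "v \<in> avoid1 j \<Longrightarrow> m + 2 < n \<Longrightarrow> root_tail j m l v \<in> avoid1 j"
proof (induction m arbitrary: v l)
  case 0
  then show ?case by (auto intro!: diag_sp)
next
  case (Suc m)
  have "\<not> cong_n (j + int m + 2) j" unfolding cong_n_def using Suc.prems by (intro not_dvd_between) simp_all
  then show ?case using Suc by (auto intro!: sp_diff sp_scale E_avoid1 diag_sp)
qed

text \<open>The last \<open>E\<close> in \<open>root_op j (n - 2)\<close> is \<open>E\<^bsub>j-1\<^esub>\<close>, which acts only on entries of residue \<open>j\<close>.\<close>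
lemma root_op_kills:
  assumes "v \<in> avoid1 j"
  shows "root_op j (n - 2) v = 0"
proof (cases "n = 2")
  case True
  have "cong_n j (j + 1 + 1)" unfolding cong_n_def using True by simp
  then have "opE (j + 1) v = 0" by (rule E_kills_avoid[OF assms])
  moreover have "n - 2 = 0" using True by simp
  ultimately show ?thesis by (simp only: root_op.simps)
next
  case False
  obtain m where m: "n - 2 = Suc m" "n = m + 3"
  proof
    show "n - 2 = Suc (n - 3)" "n = n - 3 + 3" using False n_ge_2 by simp_all
  qed
  have "j + int m + 2 + 1 = j + int n" using m(2) by simp
  then have c: "cong_n j (j + int m + 2 + 1)" by (metis cong_n_refl cong_n_shift_right)
  have "opE (j + int m + 2) v = 0" by (rule E_kills_avoid[OF assms c])
  moreover have "opE (j + int m + 2) (root_op j m v) = 0"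
    by (rule E_kills_avoid[OF root_op_avoid1 c]) (use assms m in simp_all)
  ultimately show ?thesis by (simp add: m(1))
qed

lemma root_tail_kills:
  assumes "v \<in> avoid1 j" "1 \<le> l" "l + 2 \<le> n"
  shows "root_tail j (n - 2) l v = 0"
proof -
  obtain m where m: "n - 2 = Suc m" "n = m + 3" "l \<noteq> m + 2"
  proof
    show "n - 2 = Suc (n - 3)" "n = n - 3 + 3" "l \<noteq> n - 3 + 2" using assms by simp_all
  qed
  have "j + int m + 2 + 1 = j + int n" using m(2) by simp
  then have c: "cong_n j (j + int m + 2 + 1)" by (metis cong_n_refl cong_n_shift_right)
  have "opE (j + int m + 2) v = 0" by (rule E_kills_avoid[OF assms(1) c])
  moreover have "opE (j + int m + 2) (root_tail j m l v) = 0"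
    by (rule E_kills_avoid[OF root_tail_avoid1 c]) (use assms m in simp_all)
  ultimately show ?thesis using m(3) by (simp add: m(1))
qed

text \<open>If the whole chain of generators acts on the first factor, a product of the diagonal operators remains, and this product
telescopes.\<close>
lemma root_tail_full: "root_tail j m (m + 1) v = diag (\<lambda>s. (if cong_n s (j + 1) then \<epsilon> else 1) * (if cong_n s (j + int m + 2) then inverse \<epsilon> else 1)) v"
proof (induction m arbitrary: v)
  case 0
  have "kv (j + 1) = (\<lambda>s. (if cong_n s (j + 1) then \<epsilon> else 1) * (if cong_n s (j + 2) then inverse \<epsilon> else 1))"
    by (rule ext) (simp add: kv_def algebra_simps)
  then show ?case by simp
next
  case (Suc m)
  have "(\<lambda>s. (if cong_n s (j + 1) then \<epsilon> else 1) * (if cong_n s (j + int m + 2) then inverse \<epsilon> else 1) * kv (j + int m + 2) s)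
    = (\<lambda>s. (if cong_n s (j + 1) then \<epsilon> else 1) * (if cong_n s (j + int (Suc m) + 2) then inverse \<epsilon> else 1))"
    by (rule ext) (simp add: kv_def algebra_simps)
  then show ?case by (simp add: Suc[simplified])
qed

lemma root_tail_top: "root_tail j (n - 2) (n - 1) v = diag (\<lambda>s. inverse (kv j s)) v"
proof -
  have "int (n - 2) = int n - 2" using n_ge_2 by (simp add: of_nat_diff)
  then have e: "cong_n s (j + int (n - 2) + 2) = cong_n s j" for s
    by simp
  have "n - 1 = n - 2 + 1" using n_ge_2 by simp
  then have "root_tail j (n - 2) (n - 1) v = root_tail j (n - 2) (n - 2 + 1) v" by simp
  also have "\<dots> = diag (\<lambda>s. inverse (kv j s)) v"
  proof -
    have "(\<lambda>s. (if cong_n s (j + 1) then \<epsilon> else 1) * (if cong_n s j then inverse \<epsilon> else 1)) = (\<lambda>s. inverse (kv j s))"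
      by (rule ext) (simp add: kv_def)
    then show ?thesis unfolding root_tail_full e by simp
  qed
  finally show ?thesis .
qed

lemma residue_cases:
  obtains "cong_n s j" | "cong_n s (j + 1)" | l where "1 \<le> l" "l + 2 \<le> n" "cong_n s (j + 1 + int l)" "\<not> cong_n s j" "\<not> cong_n s (j + 1)"
proof -
  define l where "l = nat ((s - j - 1) mod int n)"
  have l: "int l = (s - j - 1) mod int n" "l < n"
    using n_ge_2 by (auto simp: l_def nat_less_iff)
  have e: "cong_n s (j + 1 + int l)"
    unfolding cong_n_def l(1) by (metis diff_diff_eq mod_eq_dvd_iff mod_mod_trivial)
  show thesis
  proof (cases "l = 0 \<or> l = n - 1")
    case True
    then show ?thesis
    proof
      assume "l = 0" then show ?thesis using e that(2) by simp
    next
      assume "l = n - 1"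
      then have "j + 1 + int l = j + int n" using n_ge_2 by (simp add: of_nat_diff)
      then have "cong_n s j" using e by (metis cong_n_shift_right)
      then show ?thesis using that(1) by simp
    qed
  next
    case False
    then have l': "1 \<le> l" "l + 2 \<le> n" using l(2) by auto
    have "\<not> cong_n s j" "\<not> cong_n s (j + 1)"
      unfolding cong_n_rel[OF e] using l' by (intro not_dvd_between(1); simp)+
    then show ?thesis using that(3)[of l] l' e by simp
  qed
qed

lemma kv_inverse_diag [simp]: "diag (\<lambda>s. 1) v = v" "diag (\<lambda>s. kv j s * inverse (kv j s)) v = v" "diag (\<lambda>s. inverse (kv j s) * kv j s) v = v"
proof -
  have "prod_list (map (\<lambda>s. 1 :: 'k) i) = 1" for i :: "int list" by (induction i) simp_all
  then show [simp]: "diag (\<lambda>s. 1) v = v"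
    using lin_eqI[OF lin_ops(1) lin_ident, of "\<lambda>s. 1" v] by (simp add: diag_basis)
  then show "diag (\<lambda>s. kv j s * inverse (kv j s)) v = v" "diag (\<lambda>s. inverse (kv j s) * kv j s) v = v"
    by simp_all
qed

text \<open>A first factor of residue \<open>j\<close> is shifted with coefficient \<open>1\<close>: the terms in which \<open>split_op\<close> acts on both parts at once
cancel by the choice of the coefficient \<open>\<epsilon>\<^sup>2\<close>.\<close>
lemma split_op_cns_self:
  assumes "cong_n s j"
  shows "split_op j (cns s v) = cns s (split_op j v) + cns (s - int n) v"
proof -
  have n1: "int (n - 1) = int n - 1" "int (n - Suc 0) = int n - 1" using n_ge_2 by (simp_all add: of_nat_diff)
  have R: "root_op j (n - 2) (cns s v) = cns s (root_op j (n - 2) v) + cns (s - (int n - 1)) (diag (\<lambda>s. inverse (kv j s)) v)" for v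
  proof -
    have "cong_n s (j + 1 + int (n - 1))" using assms by (simp add: n1)
    then show ?thesis
      using root_op_cns(2)[of "n - 2" "n - 1" s j v] n_ge_2 root_tail_top[of j v] by (simp add: n1)
  qed
  have e: "\<not> cong_n s (j + 1)" "cong_n (s - (int n - 1)) (j + 1)"
  proof -
    show "\<not> cong_n s (j + 1)" using cong_n_cong0[OF assms, of "j + 1"] by simp
    have "s - (int n - 1) = s + 1 - int n" by simp
    then show "cong_n (s - (int n - 1)) (j + 1)" using assms by (simp only: cong_n_shift cong_n_cancel)
  qed
  have EG: "diag (\<lambda>s. inverse (kv j s)) (opE j v) = inverse (\<epsilon>^2) \<cdot> opE j (diag (\<lambda>s. inverse (kv j s)) v)" for v
  proof (rule E_diag)
    fix s assume s: "cong_n s (j + 1)"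
    have "kv j s = inverse \<epsilon>" "kv j (s - 1) = \<epsilon>"
      using kv_cong[OF s, of j] kv_cong[of "s - 1" j j] cong_n_cong_minus[OF s, of 1 j] by (simp_all add: kv_values)
    then show "inverse (kv j (s - 1)) = inverse (\<epsilon>^2) * inverse (kv j s)"
      using eps_nonzero by (simp add: power2_eq_square field_simps)
  qed
  have "s - (int n - 1) - 1 = s - int n" by simp
  then show ?thesis using e eps_nonzero
    by (simp add: split_op_def R EG pm_scale_distrib)
qed

text \<open>For residue \<open>j + 1\<close> the coefficient of the shift is \<open>- \<epsilon>\<^sup>2\<close>, up to a term whose first factor has residue \<open>j\<close>.\<close>
lemma split_op_cns_next:
  assumes "cong_n s (j + 1)"
  shows "split_op j (cns s v) = cns s (split_op j v) - \<epsilon>^2 \<cdot> cns (s - int n) v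
    + cns (s - 1) (diag (kv j) (root_op j (n - 2) v) - \<epsilon>^2 \<cdot> root_op j (n - 2) (diag (kv j) v))"
proof -
  have n1: "int (n - 1) = int n - 1" "int (n - Suc 0) = int n - 1" using n_ge_2 by (simp_all add: of_nat_diff)
  have s1: "cong_n (s - 1) j" using cong_n_cong_minus[OF assms, of 1 j] by simp
  have R1: "root_op j (n - 2) (cns (s - 1) v) = cns (s - 1) (root_op j (n - 2) v) + cns (s - int n) (diag (\<lambda>s. inverse (kv j s)) v)" for v
  proof -
    have "cong_n (s - 1) (j + 1 + int (n - 1))" using s1 by (simp add: n1)
    then show ?thesis
      using root_op_cns(2)[of "n - 2" "n - 1" "s - 1" j v] n_ge_2 root_tail_top[of j v] by (simp add: n1 algebra_simps)
  qed
  have R0: "root_op j (n - 2) (cns s v) = cns s (root_op j (n - 2) v)" for v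
  proof (rule root_op_cns(1))
    fix l assume "1 \<le> l" "l \<le> n - 2 + 1"
    then show "\<not> cong_n s (j + 1 + int l)"
      unfolding cong_n_rel[OF assms] using n_ge_2 by (intro not_dvd_between(2)) auto
  qed (use n_ge_2 in simp)
  show ?thesis using assms
    by (simp add: split_op_def R0 R1 pm_scale_distrib)
qed

lemma split_op_cns_other:
  assumes "1 \<le> l" "l + 2 \<le> n" "cong_n s (j + 1 + int l)" "\<not> cong_n s (j + 1)"
  shows "split_op j (cns s v) = cns s (split_op j v) + cns (s - int l - 1) (diag (kv j) (root_tail j (n - 2) l v))
    + cns (s - int l) (opE j (root_tail j (n - 2) l v) - \<epsilon>^2 \<cdot> root_tail j (n - 2) l (opE j v))"
proof -
  have R: "root_op j (n - 2) (cns s v) = cns s (root_op j (n - 2) v) + cns (s - int l) (root_tail j (n - 2) l v)" for v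
    by (rule root_op_cns(2)) (use assms in simp_all)
  have e: "cong_n (s - int l) (j + 1)" using cong_n_cong_minus[OF assms(3), of "int l" "j + 1"] by simp
  show ?thesis using e assms(4)
    by (simp add: split_op_def R pm_scale_distrib)
qed

lemma split_op_avoid2: "v \<in> avoid2 j \<Longrightarrow> split_op j v = 0"
  using root_op_kills[OF avoid2_avoid1(1)] E_kills_avoid[OF avoid2_avoid1(2), of v j j]
  by (simp add: split_op_def)

section \<open>Eigenvectors of the triangular operator\<close>

text \<open>How \<open>split_op j\<close> acts on tuples of the form \<open>blocks j a b\<close>; see \<open>split_op_eigenvector\<close>.\<close>
definition block_shift :: "nat \<Rightarrow> nat \<Rightarrow> (int list \<Rightarrow>\<^sub>0 'k) \<Rightarrow> (int list \<Rightarrow>\<^sub>0 'k)" where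
  "block_shift a b v = (\<Sum>t<a. xop t (- int n) v) - \<epsilon>^2 \<cdot> (\<Sum>t\<in>{a..<a+b}. xop t (- int n) v)"

lemma lin_block_shift: "lin (block_shift a b)"
proof -
  have "lin (\<lambda>v. (\<Sum>t<a. xop t (- int n) v) - \<epsilon>^2 \<cdot> (\<Sum>t\<in>{a..<a+b}. xop t (- int n) v))"
    by (intro lin_intro lin_ops)
  moreover have "block_shift a b = (\<lambda>v. (\<Sum>t<a. xop t (- int n) v) - \<epsilon>^2 \<cdot> (\<Sum>t\<in>{a..<a+b}. xop t (- int n) v))"
    by (rule ext) (simp add: block_shift_def)
  ultimately show ?thesis by simp
qed

lemmas block_shift_lin [simp] = lin_rules[OF lin_block_shift]

lemma block_shift_cns [simp]:
  "block_shift (Suc a) b (cns s v) = cns s (block_shift a b v) + cns (s - int n) v"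
  "block_shift 0 (Suc b) (cns s v) = cns s (block_shift 0 b v) - \<epsilon>^2 \<cdot> cns (s - int n) v"
  "block_shift 0 0 v = 0"
proof -
  have 1: "(\<Sum>t\<in>{Suc a..<Suc (a+b)}. xop t (- int n) (cns s v)) = (\<Sum>t\<in>{a..<a+b}. xop (Suc t) (- int n) (cns s v))"
    by (rule sum.shift_bounds_Suc_ivl)
  have 2: "(\<Sum>t<Suc a. xop t (- int n) (cns s v)) = xop 0 (- int n) (cns s v) + (\<Sum>t<a. xop (Suc t) (- int n) (cns s v))" for a
    by (rule sum.lessThan_Suc_shift)
  show "block_shift (Suc a) b (cns s v) = cns s (block_shift a b v) + cns (s - int n) v"
    unfolding block_shift_def add_Suc 1 2 by simp
  show "block_shift 0 (Suc b) (cns s v) = cns s (block_shift 0 b v) - \<epsilon>^2 \<cdot> cns (s - int n) v"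
    unfolding block_shift_def add_0 atLeast0LessThan 2 by (simp add: pm_scale_distrib)
  show "block_shift 0 0 v = 0" by (simp add: block_shift_def)
qed

fun blocks :: "int \<Rightarrow> nat \<Rightarrow> nat \<Rightarrow> int list \<Rightarrow> bool" where
  "blocks j (Suc a) b i = (i \<noteq> [] \<and> cong_n (hd i) j \<and> blocks j a b (tl i))"
| "blocks j 0 (Suc b) i = (i \<noteq> [] \<and> cong_n (hd i) (j + 1) \<and> blocks j 0 b (tl i))"
| "blocks j 0 0 i = (\<forall>s\<in>set i. \<not> cong_n s j \<and> \<not> cong_n s (j + 1))"

lemma blocks_0_avoid: "blocks j 0 b i \<Longrightarrow> s \<in> set i \<Longrightarrow> \<not> cong_n s j"
proof (induction b arbitrary: i)
  case (Suc b)
  then obtain t i' where i: "i = t # i'" "cong_n t (j + 1)" "blocks j 0 b i'" by (cases i) auto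
  have "\<not> cong_n t j" using cong_n_cong0[OF i(2), of j] by simp
  with Suc i show ?case by auto
qed auto

text \<open>The recursion determines the part at \<open>s\<close> by the parts at \<open>s - n\<close>, \<open>s - 2 n\<close>, and so on. Far enough these
vanish by finiteness of the support.\<close>
lemma finite_support_torsion:
  assumes c: "c \<noteq> 0" and \<Phi>: "\<Phi> 0 = 0"
    and rec: "\<And>m. c \<cdot> part (s + (m + 1) * int n) w = \<Phi> (part (s + m * int n) w)"
  shows "part s w = 0"
proof -
  define f where "f k = s + (- int k) * int n" for k
  have "inj f" using n_ge_2 by (auto simp: f_def inj_def)
  have "\<not> (\<forall>k. part (f k) w \<noteq> 0)"
  proof
    assume "\<forall>k. part (f k) w \<noteq> 0"
    then have "range f \<subseteq> {s. part s w \<noteq> 0}" by auto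
    then have "finite (range f)" by (rule finite_subset[OF _ finite_parts])
    with \<open>inj f\<close> show False using finite_imageD infinite_UNIV_nat by blast
  qed
  then obtain k where "part (f k) w = 0" by blast
  then show ?thesis
  proof (induction k)
    case (Suc k)
    have "c \<cdot> part (f k) w = \<Phi> (part (f (Suc k)) w)"
      using rec[of "- int (Suc k)"] by (simp add: f_def algebra_simps)
    then show ?case using Suc c \<Phi> by simp
  qed (simp add: f_def)
qed

text \<open>The coefficient with which \<open>split_op j\<close> shifts a first factor of residue \<open>s\<close>.\<close>
definition wt :: "int \<Rightarrow> int \<Rightarrow> 'k" where
  "wt j s = (if cong_n s j then 1 else if cong_n s (j + 1) then - (\<epsilon>^2) else 0)"

text \<open>Coefficient comparison in the first tensor factor for an operator that is a shift by \<open>n\<close> plus an operator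
on the other factors, at least as far as the component at \<open>s\<close> is concerned.\<close>
lemma part_sum_delta:
  assumes "w \<in> tensor_space (Suc r)" "lin H"
    and H: "\<And>s'. part s (H (cns s' (part s' w))) = part s (cns s' (\<Phi> (part s' w)) + c s' \<cdot> cns (s' - int n) (part s' w))"
    and \<Phi>: "\<Phi> 0 = 0"
  shows "part s (H w) = \<Phi> (part s w) + c (s + int n) \<cdot> part (s + int n) w"
proof -
  define S where "S = {s. part s w \<noteq> 0} \<union> {s, s + int n}"
  have S: "finite S" by (simp add: S_def finite_parts)
  have "H w = (\<Sum>s'\<in>S. H (cns s' (part s' w)))"
    by (subst expand_parts[OF assms(1) S]) (auto simp: S_def lin_sum[OF assms(2)])
  then have "part s (H w) = (\<Sum>s'\<in>S. part s (cns s' (\<Phi> (part s' w)) + c s' \<cdot> cns (s' - int n) (part s' w)))"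
    by (simp add: H)
  also have "\<dots> = (\<Sum>s'\<in>S. (if s = s' then \<Phi> (part s' w) else 0)) + (\<Sum>s'\<in>S. (if s + int n = s' then c s' \<cdot> part s' w else 0))"
    by (simp add: part_cns sum.distrib[symmetric]) (rule sum.cong; auto)
  also have "\<dots> = \<Phi> (part s w) + c (s + int n) \<cdot> part (s + int n) w"
    using S by (simp add: sum.delta' S_def)
  finally show ?thesis .
qed

lemma block_shift_part:
  assumes w: "w \<in> tensor_space (Suc r)"
  shows "part s (block_shift (Suc a) b w) = block_shift a b (part s w) + part (s + int n) w"
    "part s (block_shift 0 (Suc b) w) = block_shift 0 b (part s w) - \<epsilon>^2 \<cdot> part (s + int n) w"
  using part_sum_delta[OF w lin_block_shift, of s "Suc a" b "block_shift a b" "\<lambda>_. 1"]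
    part_sum_delta[OF w lin_block_shift, of s 0 "Suc b" "block_shift 0 b" "\<lambda>_. - (\<epsilon>^2)"]
  by (simp_all add: part_cns)

lemma split_op_part_other:
  assumes w: "w \<in> tensor_space (Suc r)" and s: "\<not> cong_n s j" "\<not> cong_n s (j + 1)"
  shows "part s (split_op j w) = split_op j (part s w)"
proof -
  have "part s (split_op j w) = split_op j (part s w) + wt j (s + int n) \<cdot> part (s + int n) w"
  proof (rule part_sum_delta[OF w lin_split_op])
    fix s'
    consider "cong_n s' j" | "cong_n s' (j + 1)" | l where "1 \<le> l" "l + 2 \<le> n" "cong_n s' (j + 1 + int l)" "\<not> cong_n s' j" "\<not> cong_n s' (j + 1)"
      by (rule residue_cases)
    then show "part s (split_op j (cns s' (part s' w))) = part s (cns s' (split_op j (part s' w)) + wt j s' \<cdot> cns (s' - int n) (part s' w))"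
    proof cases
      case 1 then show ?thesis by (simp add: split_op_cns_self wt_def)
    next
      case 2
      have "s \<noteq> s' - 1" using s cong_n_cong_minus[OF 2, of 1 j] by auto
      moreover have "\<not> cong_n s' j" using cong_n_cong0[OF 2, of j] by simp
      ultimately show ?thesis using 2 by (simp add: split_op_cns_next wt_def part_cns)
    next
      case 3
      have "s \<noteq> s' - int l" "s \<noteq> s' - int l - 1"
        using s cong_n_cong_minus[OF 3(3), of "int l" "j + 1"] cong_n_cong_minus[OF 3(3), of "int l + 1" j] by (auto simp: algebra_simps)
      then show ?thesis using 3 by (simp add: split_op_cns_other wt_def part_cns)
    qed
  qed simp
  then show ?thesis using s by (simp add: wt_def)
qed

lemma split_op_cns_avoid2:
  assumes "\<not> cong_n s j" "\<not> cong_n s (j + 1)" "v \<in> avoid2 j"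
  shows "split_op j (cns s v) = cns s (split_op j v)"
proof -
  from residue_cases[of s j] obtain l where l: "1 \<le> l" "l + 2 \<le> n" "cong_n s (j + 1 + int l)"
    using assms(1,2) by metis
  have "root_tail j (n - 2) l v = 0" "opE j v = 0"
    using root_tail_kills[OF avoid2_avoid1(1)[OF assms(3)] l(1,2)] E_kills_avoid[OF avoid2_avoid1(2)[OF assms(3)], of j] by simp_all
  then show ?thesis using split_op_cns_other[OF l assms(2)] by simp
qed

lemma split_op_part_next:
  assumes w: "w \<in> tensor_space (Suc r)" and s: "cong_n s (j + 1)"
    and other: "\<And>s'. \<not> cong_n s' j \<Longrightarrow> \<not> cong_n s' (j + 1) \<Longrightarrow> part s' w \<in> avoid2 j"
  shows "part s (split_op j w) = split_op j (part s w) - \<epsilon>^2 \<cdot> part (s + int n) w"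
proof -
  have sj: "\<not> cong_n s j" using cong_n_cong0[OF s, of j] by simp
  have "part s (split_op j w) = split_op j (part s w) + wt j (s + int n) \<cdot> part (s + int n) w"
  proof (rule part_sum_delta[OF w lin_split_op])
    fix s'
    consider "cong_n s' j" | "cong_n s' (j + 1)" | "\<not> cong_n s' j" "\<not> cong_n s' (j + 1)" by blast
    then show "part s (split_op j (cns s' (part s' w))) = part s (cns s' (split_op j (part s' w)) + wt j s' \<cdot> cns (s' - int n) (part s' w))"
    proof cases
      case 1 then show ?thesis by (simp add: split_op_cns_self wt_def)
    next
      case 2
      have "s \<noteq> s' - 1" using sj cong_n_cong_minus[OF 2, of 1 j] by auto
      moreover have "\<not> cong_n s' j" using cong_n_cong0[OF 2, of j] by simp
      ultimately show ?thesis using 2 by (simp add: split_op_cns_next wt_def part_cns)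
    next
      case 3
      then show ?thesis using other[OF 3] by (simp add: split_op_cns_avoid2 wt_def)
    qed
  qed simp
  then show ?thesis using s sj by (simp add: wt_def)
qed

lemma split_op_part_self:
  assumes w: "w \<in> tensor_space (Suc r)" and s: "cong_n s j"
    and other: "\<And>s'. \<not> cong_n s' j \<Longrightarrow> \<not> cong_n s' (j + 1) \<Longrightarrow> part s' w \<in> avoid2 j"
    and tail: "\<And>s'. cong_n s' (j + 1) \<Longrightarrow> part s' w \<in> avoid1 j"
  shows "part s (split_op j w) = split_op j (part s w) + part (s + int n) w"
proof -
  have "part s (split_op j w) = split_op j (part s w) + wt j (s + int n) \<cdot> part (s + int n) w"
  proof (rule part_sum_delta[OF w lin_split_op])
    fix s'
    consider "cong_n s' j" | "cong_n s' (j + 1)" | "\<not> cong_n s' j" "\<not> cong_n s' (j + 1)" by blast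
    then show "part s (split_op j (cns s' (part s' w))) = part s (cns s' (split_op j (part s' w)) + wt j s' \<cdot> cns (s' - int n) (part s' w))"
    proof cases
      case 1 then show ?thesis by (simp add: split_op_cns_self wt_def)
    next
      case 2
      have "\<not> cong_n s' j" using cong_n_cong0[OF 2, of j] by simp
      then show ?thesis using 2 tail[OF 2] diag_sp[OF tail[OF 2], of "kv j"]
        by (simp add: split_op_cns_next wt_def root_op_kills)
    next
      case 3
      then show ?thesis using other[OF 3] by (simp add: split_op_cns_avoid2 wt_def)
    qed
  qed simp
  then show ?thesis using s by (simp add: wt_def)
qed

lemma eps_sq_neg: "1 + \<epsilon>^2 \<noteq> 0"
proof
  assume "1 + \<epsilon>^2 = 0"
  then have "\<epsilon>^2 = - 1" by (simp add: eq_neg_iff_add_eq_0 add.commute)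
  then have "\<epsilon>^4 = 1" by (metis power2_minus power_one power_mult numeral_Bit0_eq_double mult_2_right num_double numeral_times_numeral power2_eq_square)
  then show False using eps_not_root[of 4] by simp
qed

text \<open>Induction on the number of tensor factors. Comparing coefficients in the first factor, the components along
\<open>s, s + n, s + 2 n, \<dots>\<close> satisfy a recursion whose leading coefficient is the difference of \<open>wt j s\<close> and the
coefficient \<open>A\<close> with which \<open>block_shift a b\<close> shifts the first factor. If these differ the component is zero by finite
support; if they agree the rest of the vector satisfies the equation for the remaining blocks. The three
residue classes have to be treated in the order other, \<open>j + 1\<close>, \<open>j\<close>, because \<open>split_op j\<close> is only triangular.\<close>
lemma eigen_prefix:
  assumes "w \<in> tensor_space r" "a + b \<le> r" "split_op j w = block_shift a b w"
  shows "w \<in> sp (blocks j a b)"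
  using assms
proof (induction r arbitrary: a b w)
  case 0
  then show ?case by (auto simp: sp_def tensor_space_def)
next
  case (Suc r)
  note w = Suc.prems(1)
  \<comment> \<open>The coefficient of the shift of the first factor in \<open>block_shift a b\<close>, and the blocks that remain.\<close>
  define A where "A = (if a > 0 then 1 else if b > 0 then - (\<epsilon>^2) else 0)"
  define a' where "a' = a - 1"
  define b' where "b' = (if a > 0 then b else b - 1)"
  have ab': "a' + b' \<le> r" using Suc.prems(2) by (auto simp: a'_def b'_def)
  have al: "part s (block_shift a b w) = block_shift a' b' (part s w) + A \<cdot> part (s + int n) w" for s
    by (cases a; cases b) (simp_all add: block_shift_part[OF w] A_def a'_def b'_def)
  have key: "part s w = 0 \<or> (wt j s = A \<and> part s w \<in> sp (blocks j a' b'))"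
    if h: "\<And>m. part (s + m * int n) (split_op j w) = split_op j (part (s + m * int n) w) + wt j s \<cdot> part (s + m * int n + int n) w" for s
  proof -
    have eq: "split_op j (part (s + m * int n) w) + wt j s \<cdot> part (s + m * int n + int n) w
      = block_shift a' b' (part (s + m * int n) w) + A \<cdot> part (s + m * int n + int n) w" for m
      using h[of m] al[of "s + m * int n"] Suc.prems(3) by simp
    show ?thesis
    proof (cases "wt j s = A")
      case True
      then have "split_op j (part s w) = block_shift a' b' (part s w)" using eq[of 0] by simp
      then show ?thesis using Suc.IH[OF part_in_tensor_space[OF w] ab'] True by blast
    next
      case False
      have "part s w = 0"
      proof (rule finite_support_torsion[where \<Phi> = "\<lambda>v. block_shift a' b' v - split_op j v" and c = "wt j s - A"])
        fix m show "(wt j s - A) \<cdot> part (s + (m + 1) * int n) w = block_shift a' b' (part (s + m * int n) w) - split_op j (part (s + m * int n) w)"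
          using eq[of m] by (simp add: pm_scale_distrib algebra_simps)
      qed (use False in simp_all)
      then show ?thesis ..
    qed
  qed
  have other: "part s w = 0 \<or> (A = 0 \<and> part s w \<in> sp (blocks j a' b'))" if "\<not> cong_n s j" "\<not> cong_n s (j + 1)" for s
    using key[of s] split_op_part_other[OF w, of "s + m * int n" j for m] that by (simp add: wt_def)
  have A0: "A = 0 \<longleftrightarrow> a = 0 \<and> b = 0" using eps_nonzero by (simp add: A_def)
  have other': "part s w \<in> avoid2 j" if "\<not> cong_n s j" "\<not> cong_n s (j + 1)" for s
    using other[OF that] A0 by (auto simp: a'_def b'_def sp_def)
  have nxt: "part s w = 0 \<or> (A = - (\<epsilon>^2) \<and> part s w \<in> sp (blocks j a' b'))" if s: "cong_n s (j + 1)" for s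
    using key[of s] split_op_part_next[OF w _ other', of "s + m * int n" for m] s cong_n_cong0[OF s, of j] by (auto simp: wt_def)
  have "- (\<epsilon>^2) \<noteq> 1"
  proof
    assume "- (\<epsilon>^2) = 1"
    then have "1 + \<epsilon>^2 = - (\<epsilon>^2) + \<epsilon>^2" by simp
    then show False using eps_sq_neg by simp
  qed
  then have ne: "- (\<epsilon>^2) \<noteq> 1" "1 \<noteq> - (\<epsilon>^2)" by simp_all
  have Ae: "A = - (\<epsilon>^2) \<longleftrightarrow> a = 0 \<and> b > 0"
    using eps_nonzero ne by (auto simp: A_def)
  have nxt': "part s w \<in> avoid1 j" if s: "cong_n s (j + 1)" for s
    using nxt[OF s] Ae blocks_0_avoid[of j b'] by (auto simp: a'_def sp_def)
  have self: "part s w = 0 \<or> (A = 1 \<and> part s w \<in> sp (blocks j a' b'))" if s: "cong_n s j" for s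
    using key[of s] split_op_part_self[OF w _ other' nxt', of "s + m * int n" for m] s by (simp add: wt_def)
  have A1: "A = 1 \<longleftrightarrow> a > 0"
    using eps_nonzero ne by (auto simp: A_def)
  show ?case unfolding sp_def
  proof safe
    fix i assume i: "i \<in> Poly_Mapping.keys w"
    then obtain s i' where s: "i = s # i'" using w by (cases i) (auto simp: tensor_space_def)
    have i': "i' \<in> Poly_Mapping.keys (part s w)" using i by (simp add: s keys_part)
    then have nz: "part s w \<noteq> 0" by auto
    consider "cong_n s j" | "cong_n s (j + 1)" | "\<not> cong_n s j" "\<not> cong_n s (j + 1)" by blast
    then show "blocks j a b i"
    proof cases
      case 1
      with self[OF 1] nz A1 i' obtain a0 where "a = Suc a0" "blocks j a0 b i'"
        by (cases a) (auto simp: a'_def b'_def sp_def)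
      then show ?thesis using 1 s by simp
    next
      case 2
      with nxt[OF 2] nz Ae i' obtain b0 where "a = 0" "b = Suc b0" "blocks j 0 b0 i'"
        by (cases b) (auto simp: a'_def b'_def sp_def)
      then show ?thesis using 2 s by simp
    next
      case 3
      with other[OF 3] nz A0 i' have "a = 0" "b = 0" "blocks j 0 0 i'"
        by (auto simp: a'_def b'_def sp_def)
      then show ?thesis using 3 s by simp
    qed
  qed
qed

lemma split_op_eigenvector: "blocks j a b i \<Longrightarrow> split_op j (basis_vec i) = block_shift a b (basis_vec i)"
proof (induction j a b i rule: blocks.induct)
  case (1 j a b i)
  then obtain s i' where i: "i = s # i'" by (cases i) auto
  with 1 show ?case by (simp add: split_op_cns_self flip: cns_basis)
next
  case (2 j b i)
  then obtain s i' where i: "i = s # i'" by (cases i) auto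
  with 2 have s: "cong_n s (j + 1)" "blocks j 0 b i'" by simp_all
  have av: "basis_vec i' \<in> avoid1 j" using blocks_0_avoid[OF s(2)] by simp
  show ?case using 2 s root_op_kills[OF av] root_op_kills[OF diag_sp[OF av]]
    by (simp add: i split_op_cns_next flip: cns_basis)
next
  case (3 j i)
  then show ?case by (simp add: split_op_avoid2)
qed

lemma E_part:
  assumes w: "w \<in> tensor_space (Suc r)"
  shows "part s (opE j w) = opE j (part s w) + (if cong_n s j then diag (kv j) (part (s + 1) w) else 0)"
proof (rule lin_eq_on_sp[where F = "\<lambda>w. part s (opE j w)", OF _ _ _ w[unfolded tensor_space_eq_sp]])
  fix i :: "int list" assume "length i = Suc r"
  then obtain t i' where i: "i = t # i'" by (cases i) auto
  have "cong_n (s + 1) (j + 1) = cong_n s j" by simp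
  then show "part s (opE j (basis_vec i)) = opE j (part s (basis_vec i)) + (if cong_n s j then diag (kv j) (part (s + 1) (basis_vec i)) else 0)"
    by (auto simp: i part_cns simp flip: cns_basis)
qed (intro lin_intro)+

lemma diag_kv_eq_0: "diag (kv j) v = 0 \<Longrightarrow> v = 0"
  using kv_inverse_diag(3)[of j v] diag_diag[of "\<lambda>s. inverse (kv j s)" "kv j" v] by simp

lemma part_zero_of_keys:
  "w \<in> sp Q \<Longrightarrow> (\<And>i. \<not> Q (s # i)) \<Longrightarrow> part s w = 0"
  by (rule poly_mapping_eqI) (metis (no_types, lifting) in_keys_iff lookup_part lookup_zero mem_Collect_eq sp_def)

lemma part_sp: "w \<in> sp Q \<Longrightarrow> (\<And>i. Q (s # i) \<Longrightarrow> Q' i) \<Longrightarrow> part s w \<in> sp Q'"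
  by (auto simp: sp_def keys_part)

text \<open>The only way in which \<open>E\<^sub>j\<close> can produce \<open>j\<close> after the leading block of \<open>j\<close>'s is from the first entry of the
following block, and this entry can be recovered.\<close>
lemma E_injective_prefix:
  assumes "w \<in> tensor_space r" "w \<in> sp (blocks j a (Suc b))" "a + Suc b \<le> r" "opE j w = 0"
  shows "w = 0"
  using assms
proof (induction a arbitrary: w r)
  case 0
  from 0(3) obtain r' where r: "r = Suc r'" by (cases r) simp_all
  note w = 0(1)[unfolded r]
  have nz: "part s w = 0" if "\<not> cong_n s (j + 1)" for s
    by (rule part_zero_of_keys[OF 0(2)]) (use that in simp)
  have "part s w = 0" for s
  proof (cases "cong_n s (j + 1)")
    case True
    have s1: "cong_n (s - 1) j" "\<not> cong_n (s - 1) (j + 1)" using cong_n_cong_minus[OF True, of 1 j] cong_n_cong_minus[OF True, of 1 "j + 1"] by simp_all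
    have "part (s - 1) (opE j w) = diag (kv j) (part s w)"
      using E_part[OF w, of "s - 1" j] s1 nz[OF s1(2)] by simp
    then have "diag (kv j) (part s w) = 0" using 0(4) by simp
    then show ?thesis by (rule diag_kv_eq_0)
  qed (rule nz)
  then show ?case using eq_by_parts[OF w ts_intro(6)] by simp
next
  case (Suc a)
  from Suc.prems(3) obtain r' where r: "r = Suc r'" by (cases r) simp_all
  note w = Suc.prems(1)[unfolded r]
  have nz: "part s w = 0" if "\<not> cong_n s j" for s
    by (rule part_zero_of_keys[OF Suc.prems(2)]) (use that in simp)
  have "part s w = 0" for s
  proof (cases "cong_n s j")
    case True
    have "\<not> cong_n (s + 1) j" using cong_n_cong[OF True, of 1 j] by simp
    then have "opE j (part s w) = part s (opE j w)"
      using E_part[OF w, of s j] nz by simp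
    then have "opE j (part s w) = 0" using Suc.prems(4) by simp
    moreover have "part s w \<in> sp (blocks j a (Suc b))"
      by (rule part_sp[OF Suc.prems(2)]) simp
    ultimately show ?thesis using Suc.IH[of "part s w" r'] w Suc.prems(3) r by simp
  qed (rule nz)
  then show ?case using eq_by_parts[OF w ts_intro(6)] by simp
qed

section \<open>Commuting maps are determined by one vector\<close>

text \<open>Tuples with entries in \<open>{1..n}\<close> form a fundamental domain for the lattice of shifts.\<close>
lemma base_lists_suffice:
  assumes base: "\<And>i. length i = r \<Longrightarrow> set i \<subseteq> {1..int n} \<Longrightarrow> Q i"
    and shift: "\<And>xs a ys. length (xs @ a # ys) = r \<Longrightarrow> Q (xs @ (a - int n) # ys) \<longleftrightarrow> Q (xs @ a # ys)"
    and "length i = r"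
  shows "Q i"
proof -
  have "length (xs @ ys) = r \<Longrightarrow> set ys \<subseteq> {1..int n} \<Longrightarrow> Q (xs @ ys)" for xs ys
  proof (induction xs arbitrary: ys rule: rev_induct)
    case (snoc x xs)
    have "length (xs @ x # ys) = r \<longrightarrow> Q (xs @ x # ys)" for x
    proof (rule int_shift_induct[of "\<lambda>x. length (xs @ x # ys) = r \<longrightarrow> Q (xs @ x # ys)"])
      fix a assume "1 \<le> a" "a \<le> int n"
      then show "length (xs @ a # ys) = r \<longrightarrow> Q (xs @ a # ys)"
        using snoc.IH[of "a # ys"] snoc.prems by simp
    next
      fix a show "(length (xs @ (a - int n) # ys) = r \<longrightarrow> Q (xs @ (a - int n) # ys)) \<longleftrightarrow>
        (length (xs @ a # ys) = r \<longrightarrow> Q (xs @ a # ys))"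
        using shift[of xs a ys] by auto
    qed
    then show ?case using snoc.prems by simp
  qed (use base in simp)
  from this[of i "[]"] assms(3) show ?thesis by simp
qed

lemma T_at:
  assumes "1 \<le> a" "a \<le> int n" "1 \<le> b" "b \<le> int n"
  shows "opT (length xs) (basis_vec (xs @ a # b # ys)) = (if a = b then \<epsilon>^2 else \<epsilon>) \<cdot> basis_vec (xs @ b # a # ys)
    + (if a > b then (\<epsilon>^2 - 1) \<cdot> basis_vec (xs @ a # b # ys) else 0)"
proof (induction xs)
  case (Cons x xs)
  then show ?case
    by (simp flip: cns_basis)
next
  case Nil
  show ?case using assms by (simp add: T2_base flip: cns_basis)
qed

lemma E_lowers_sum:
  assumes "set i \<subseteq> {1..int n}" "1 \<le> j" "j < int n"
  shows "opE j (basis_vec i) \<in> sp (\<lambda>i'. length i' = length i \<and> set i' \<subseteq> {1..int n} \<and> sum_list i' = sum_list i - 1)"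
  using assms
proof (induction i)
  case (Cons s i)
  have IH: "opE j (basis_vec i) \<in> sp (\<lambda>i'. length i' = length i \<and> set i' \<subseteq> {1..int n} \<and> sum_list i' = sum_list i - 1)"
    using Cons by simp
  have b: "basis_vec i \<in> sp (\<lambda>i'. length i' = length i \<and> set i' \<subseteq> {1..int n} \<and> sum_list i' = sum_list i)"
    using Cons by simp
  have s: "1 \<le> s" "s \<le> int n" using Cons.prems by auto
  have e: "cong_n s (j + 1) \<Longrightarrow> 2 \<le> s" using cong_n_base(1)[OF s, of j] assms by simp
  show ?case
    unfolding cns_basis[symmetric] opE_cns
    by (intro sp_add cns_sp[OF IH]) (use s e in \<open>auto intro!: cns_sp[OF diag_sp[OF b]] simp: subset_iff\<close>)
qed simp

text \<open>Sorting: entries \<open>j\<close> first, then entries \<open>j + 1\<close>, then the others.\<close>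
lemma base_prefix:
  assumes "set i \<subseteq> {1..int n}" "1 \<le> j" "j < int n" "j + 1 \<in> set i"
  obtains a b i' where "mset i' = mset i" "blocks j a (Suc b) i'" "a + Suc b \<le> length i"
proof -
  define a where "a = length (filter (\<lambda>s. s = j) i)"
  define b where "b = length (filter (\<lambda>s. s = j + 1) i)"
  define l where "l = filter (\<lambda>s. s \<noteq> j \<and> s \<noteq> j + 1) i"
  have "replicate a j = filter (\<lambda>s. s = j) i" "replicate b (j + 1) = filter (\<lambda>s. s = j + 1) i"
    unfolding a_def b_def by (induction i) auto
  moreover have "mset (filter (\<lambda>s. s = j) i @ filter (\<lambda>s. s = j + 1) i @ l) = mset i"
    unfolding l_def by (induction i) auto
  ultimately have ms: "mset (replicate a j @ replicate b (j + 1) @ l) = mset i" by simp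
  have l: "blocks j 0 0 l"
  proof -
    have "\<not> cong_n s j \<and> \<not> cong_n s (j + 1)" if "s \<in> set l" for s
    proof -
      have "s \<in> set i" "s \<noteq> j" "s \<noteq> j + 1" using that by (auto simp: l_def)
      moreover from this have "1 \<le> s" "s \<le> int n" using assms(1) by auto
      ultimately show ?thesis using cong_n_base[of s j] assms(2,3) by auto
    qed
    then show ?thesis by simp
  qed
  have b': "blocks j 0 b (replicate b (j + 1) @ l)"
    by (induction b) (use l in auto)
  have a': "blocks j a b (replicate a j @ replicate b (j + 1) @ l)"
    by (induction a) (use b' in auto)
  have "b > 0" using assms(4) by (auto simp: b_def filter_empty_conv)
  then obtain b0 where b0: "b = Suc b0" by (cases b) auto
  have "length (replicate a j @ replicate b (j + 1) @ l) = length i" using ms by (metis size_mset)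
  then have "a + Suc b0 \<le> length i" using b0 by simp
  then show thesis using that[OF ms, of a b0] a' b0 by simp
qed

text \<open>The operators \<open>E\<^sub>j\<close> lead from \<open>\<omega>\<^sub>i\<close> towards \<open>\<omega>\<close> and not back, so \<open>\<omega>\<^sub>i\<close> is not generated from \<open>\<omega>\<close>; instead
\<open>g \<omega>\<^sub>i\<close> is pinned down by the equations that it inherits from \<open>\<omega>\<^sub>i\<close>.\<close>
lemma commuting_map_zero:
  assumes g: "lin g" "\<And>v. v \<in> tensor_space r \<Longrightarrow> g v \<in> tensor_space r"
    and gE: "\<And>j v. v \<in> tensor_space r \<Longrightarrow> g (opE j v) = opE j (g v)"
    and gX: "\<And>t v. t < r \<Longrightarrow> v \<in> tensor_space r \<Longrightarrow> g (xop t (- int n) v) = xop t (- int n) (g v)"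
    and gT: "\<And>k v. Suc k < r \<Longrightarrow> v \<in> tensor_space r \<Longrightarrow> g (opT k v) = opT k (g v)"
    and one: "g (basis_vec (replicate r 1)) = 0"
    and v: "v \<in> tensor_space r"
  shows "g v = 0"
proof -
  have bt: "basis_vec i \<in> tensor_space r \<longleftrightarrow> length i = r" for i
    by (simp add: tensor_space_eq_sp)
  have transport: "g (basis_vec i') = 0"
    if "mset i = mset i'" "length i = r" "set i \<subseteq> {1..int n}" "g (basis_vec i) = 0" for i i'
  proof -
    define Q where "Q i \<longleftrightarrow> length i = r \<and> set i \<subseteq> {1..int n} \<and> g (basis_vec i) = 0" for i
    have "Q i'"
    proof (rule swap_closed_perm[where Q = Q and xs = i and ys = i'])
      fix xs ys and a b :: int
      assume Q: "Q (xs @ a # b # ys)"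
      then have ab: "1 \<le> a" "a \<le> int n" "1 \<le> b" "b \<le> int n" and k: "Suc (length xs) < r" by (auto simp: Q_def)
      have "g (opT (length xs) (basis_vec (xs @ a # b # ys))) = 0"
        using gT[OF k, of "basis_vec (xs @ a # b # ys)"] Q by (simp add: Q_def bt)
      then have "(if a = b then \<epsilon>^2 else \<epsilon>) \<cdot> g (basis_vec (xs @ b # a # ys)) = 0"
        using Q unfolding T_at[OF ab] by (auto simp: lin_rules[OF g(1)] Q_def split: if_splits)
      then show "Q (xs @ b # a # ys)" using Q eps_nonzero by (auto simp: Q_def split: if_splits)
    qed (use that in \<open>auto simp: Q_def\<close>)
    then show ?thesis by (simp add: Q_def)
  qed
  have g_root: "g (root_op j m v) = root_op j m (g v) \<and> root_op j m v \<in> tensor_space r" if "v \<in> tensor_space r" for j m v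
    using that
  proof (induction m arbitrary: v)
    case (Suc m)
    then show ?case by (simp add: gE lin_rules[OF g(1)] ts_intro)
  qed (simp add: gE)
  have g_split: "g (split_op j v) = split_op j (g v)" if "v \<in> tensor_space r" for j v
    using that g_root gE by (simp add: split_op_def lin_rules[OF g(1)])
  have g_block_shift: "g (block_shift a b v) = block_shift a b (g v)" if "v \<in> tensor_space r" "a + b \<le> r" for a b v
    using that by (simp add: block_shift_def lin_rules[OF g(1)] gX)
  have base: "g (basis_vec i) = 0" if "length i = r" "set i \<subseteq> {1..int n}" for i
    using that
  proof (induction "nat (sum_list i)" arbitrary: i rule: less_induct)
    case less
    show ?case
    proof (cases "\<forall>s\<in>set i. s = 1")
      case True
      then have "i = replicate r 1" using less.prems(1) by (metis replicate_eqI)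
      then show ?thesis using one by simp
    next
      case False
      then obtain s where s: "s \<in> set i" "s \<noteq> 1" by blast
      define j where "j = s - 1"
      have j: "1 \<le> j" "j < int n" "j + 1 \<in> set i" using s less.prems(2) by (auto simp: j_def)
      obtain a b i' where i': "mset i' = mset i" "blocks j a (Suc b) i'" "a + Suc b \<le> length i"
        using base_prefix[OF less.prems(2) j] by metis
      have len: "length i' = r" using i'(1) less.prems(1) by (metis size_mset)
      have set': "set i' = set i" using i'(1) by (metis set_mset_mset)
      have sum': "sum_list i' = sum_list i" using i'(1) by (metis sum_mset_sum_list)
      have pos: "0 < sum_list l" if "set l \<subseteq> {1..int n}" "l \<noteq> []" for l
        using that
      proof (induction l)
        case (Cons x l)
        then show ?case by (cases "l = []") auto
      qed simp
      have pos: "sum_list i > 0" using pos[OF less.prems(2)] s(1) by (cases i) simp_all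
      \<comment> \<open>\<open>w\<close> inherits the shape of \<open>i'\<close> and is killed by \<open>E\<^sub>j\<close>.\<close>
      define w where "w = g (basis_vec i')"
      have w: "w \<in> tensor_space r" unfolding w_def by (rule g(2)) (simp add: bt len)
      have "split_op j w = block_shift a (Suc b) w"
        unfolding w_def using g_split[of "basis_vec i'" j] g_block_shift[of "basis_vec i'" a "Suc b"]
          split_op_eigenvector[OF i'(2)] i'(3) less.prems(1) len by (simp add: bt)
      then have pw: "w \<in> sp (blocks j a (Suc b))"
        using eigen_prefix[OF w, of a "Suc b" j] i'(3) less.prems(1) by simp
      have "g (opE j (basis_vec i')) = 0"
      proof (rule lin_eq_on_sp[OF g(1) lin_const_zero _ E_lowers_sum[of i' j]])
        fix l assume "length l = length i' \<and> set l \<subseteq> {1..int n} \<and> sum_list l = sum_list i' - 1"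
        then show "g (basis_vec l) = 0"
          using less.hyps[of l] pos sum' len by simp
      qed (use less.prems set' j in auto)
      then have "opE j w = 0" using gE[of "basis_vec i'" j] len by (simp add: w_def bt)
      then have "w = 0" using E_injective_prefix[OF w pw] i'(3) less.prems(1) by simp
      then show ?thesis
        using transport[of i' i] i'(1) len set' less.prems by (simp add: w_def)
    qed
  qed
  have all: "g (basis_vec i) = 0" if "length i = r" for i
  proof (rule base_lists_suffice[of _ "\<lambda>i. g (basis_vec i) = 0", OF base _ that])
    fix xs ys and a :: int assume "length (xs @ a # ys) = r"
    moreover have "xop (length xs) (- int n) (basis_vec (xs @ a # ys)) = basis_vec (xs @ (a - int n) # ys)"
      by (simp add: xop_basis list_update_append)
    ultimately show "g (basis_vec (xs @ (a - int n) # ys)) = 0 \<longleftrightarrow> g (basis_vec (xs @ a # ys)) = 0"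
      using gX[of "length xs" "basis_vec (xs @ a # ys)"] by (simp add: bt)
  qed
  show ?thesis
    by (rule lin_eq_on_sp[OF g(1) lin_const_zero _ v[unfolded tensor_space_eq_sp]]) (rule all)
qed

end

section \<open>Algebras presented by generators and relations\<close>

lemma pm_scale_conv_mult: "c \<cdot> (p :: 'w::monoid_add \<Rightarrow>\<^sub>0 'k::field) = Poly_Mapping.single 0 c * p"
  by (simp add: pm_scale_def mult_map_scale_conv_mult)

lemma pm_scale_mult_left: "(c \<cdot> p) * q = c \<cdot> (p * (q :: 'w::monoid_add \<Rightarrow>\<^sub>0 'k::field))"
  by (simp add: pm_scale_conv_mult mult.assoc)

lemma lin_mult_right: "lin (\<lambda>p. p * (q :: 'w::monoid_add \<Rightarrow>\<^sub>0 'k::field))"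
  by (simp add: lin_def distrib_right pm_scale_mult_left)

lemma pm_scale_basis: "c \<cdot> basis_vec u = Poly_Mapping.single u (c::'k::field)"
  by (rule poly_mapping_eqI) (simp add: lookup_basis_vec lookup_single when_def)

lemma pm_scale_mult_right: "p * (c \<cdot> q) = c \<cdot> (p * (q :: 'w::monoid_add \<Rightarrow>\<^sub>0 'k::field))"
proof -
  have "p * Poly_Mapping.single 0 c = c \<cdot> p"
    by (rule lin_eqI[OF lin_mult_right lin_cscale[OF lin_ident]]) (simp add: pm_scale_basis, simp add: basis_vec_def mult_single)
  then have "p * (Poly_Mapping.single 0 c * q) = c \<cdot> (p * q)" by (simp flip: mult.assoc add: pm_scale_mult_left)
  then show ?thesis by (simp add: pm_scale_conv_mult)
qed

lemma lin_mult_left: "lin (\<lambda>p. (q :: 'w::monoid_add \<Rightarrow>\<^sub>0 'k::field) * p)"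
  by (simp add: lin_def distrib_left pm_scale_mult_right)

lemma basis_mult: "basis_vec u * basis_vec w = (basis_vec (u + w) :: 'w::monoid_add \<Rightarrow>\<^sub>0 'k::field)"
  by (simp add: basis_vec_def mult_single)

lemma basis_0: "(basis_vec 0 :: 'w::monoid_add \<Rightarrow>\<^sub>0 'k::field) = 1"
  by (simp add: basis_vec_def)

abbreviation words_in :: "'g set \<Rightarrow> 'g word \<Rightarrow> bool" where
  "words_in G w \<equiv> set (letters w) \<subseteq> G"

lemma letters_simps [simp]: "letters (0 :: 'g word) = []" "letters (u + w) = letters u @ letters w"
  by (simp_all add: zero_word_def plus_word_def)

lemma free_alg_simps [simp]:
  "carrier (free_alg G) = sp (words_in G)" "mult (free_alg G) = (*)" "one (free_alg G) = 1"
  "zero (free_alg G) = 0" "add (free_alg G) = (+)" "smult (free_alg G) = pm_scale"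
  by (simp_all add: free_alg_def sp_def)

lemma sp_words_mult:
  assumes "p \<in> sp (words_in G)" "q \<in> sp (words_in G)"
  shows "p * q \<in> sp (words_in G)"
  using keys_mult[of p q] assms by (fastforce simp: sp_def)

lemma sp_words_one: "1 \<in> sp (words_in G)"
  by (simp add: sp_def zero_word_def[symmetric])

lemma sp_words_letter: "g \<in> G \<Longrightarrow> letter g \<in> sp (words_in G)"
  by (simp add: sp_def letter_def)

lemma ring_free_alg: "ring (free_alg G :: ('k::field, 'g word \<Rightarrow>\<^sub>0 'k) module)"
proof (rule ringI)
  show "abelian_group (free_alg G :: ('k::field, 'g word \<Rightarrow>\<^sub>0 'k) module)"
  proof (rule abelian_groupI)
    fix x :: "'g word \<Rightarrow>\<^sub>0 'k" assume "x \<in> carrier (free_alg G)"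
    then show "\<exists>y\<in>carrier (free_alg G). y \<oplus>\<^bsub>free_alg G\<^esub> x = \<zero>\<^bsub>free_alg G\<^esub>"
      by (intro bexI[of _ "- x"]) auto
  qed (auto simp: add.assoc add.commute)
  show "monoid (free_alg G :: ('k::field, 'g word \<Rightarrow>\<^sub>0 'k) module)"
    by (rule monoidI) (auto simp: sp_words_mult sp_words_one mult.assoc)
qed (simp_all add: distrib_left distrib_right)

text \<open>The algebra presented by generators \<open>G\<close> and relations \<open>R\<close>, with \<open>proj\<close> the quotient map from the free algebra.\<close>
locale presentation =
  fixes G :: "'g set" and R :: "('g word \<Rightarrow>\<^sub>0 'k::field) set"
  assumes rels: "R \<subseteq> sp (words_in G)"
begin

definition "I = Idl\<^bsub>free_alg G\<^esub> R"
definition "A = presented_alg G R"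
definition "proj p = I +>\<^bsub>free_alg G\<^esub> p"

lemma ideal_I: "ideal I (free_alg G)"
  unfolding I_def by (rule ring.genideal_ideal[OF ring_free_alg]) (use rels in simp)

lemma R_subset_I: "R \<subseteq> I"
  unfolding I_def by (rule ring.genideal_self[OF ring_free_alg]) (use rels in simp)

sublocale I: ideal I "free_alg G" by (rule ideal_I)

lemma I_diff: "p \<in> I \<Longrightarrow> q \<in> I \<Longrightarrow> p + q \<in> I" "p \<in> I \<Longrightarrow> q \<in> sp (words_in G) \<Longrightarrow> p * q \<in> I"
  "p \<in> I \<Longrightarrow> q \<in> sp (words_in G) \<Longrightarrow> q * p \<in> I" "0 \<in> I"
  using additive_subgroup.a_closed[OF I.is_additive_subgroup, of p q] I.I_l_closed[of p q] I.I_r_closed[of p q] additive_subgroup.zero_closed[OF I.is_additive_subgroup] by auto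

lemma I_scale: "p \<in> I \<Longrightarrow> c \<cdot> p \<in> I"
proof -
  assume "p \<in> I"
  moreover have "c \<cdot> 1 \<in> sp (words_in G)" by (intro sp_scale sp_words_one)
  ultimately have "(c \<cdot> 1) * p \<in> I" using I_diff(3) by blast
  then show ?thesis by (simp add: pm_scale_mult_left)
qed

lemma I_uminus: "p \<in> I \<Longrightarrow> - p \<in> I"
  using I_scale[of p "- 1"] by (simp add: poly_mapping_eq_iff)

lemma proj_set: "proj p = (\<lambda>i. i + p) ` I"
  by (auto simp: proj_def a_r_coset_def r_coset_def)

lemma proj_eq_iff: "proj p = proj q \<longleftrightarrow> p - q \<in> I"
proof
  assume "proj p = proj q"
  moreover have "p \<in> proj p" unfolding proj_set using I_diff(4) by force
  ultimately obtain i where "i \<in> I" "p = i + q" unfolding proj_set by auto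
  then show "p - q \<in> I" by simp
next
  assume pq: "p - q \<in> I"
  show "proj p = proj q" unfolding proj_set
  proof safe
    fix i assume "i \<in> I"
    then have "i + (p - q) \<in> I" using pq by (rule I_diff(1))
    then show "i + p \<in> (\<lambda>i. i + q) ` I" by (intro image_eqI[of _ _ "i + (p - q)"]) auto
  next
    fix i assume "i \<in> I"
    then have "i + - (p - q) \<in> I" using pq by (intro I_diff(1) I_uminus)
    then show "i + q \<in> (\<lambda>i. i + p) ` I" by (intro image_eqI[of _ _ "i + - (p - q)"]) auto
  qed
qed

lemma A_carrier: "carrier A = proj ` sp (words_in G)"
  by (auto simp: A_def presented_alg_def quotient_alg_def FactRing_def A_RCOSETS_def' proj_def I_def)

lemma A_ops:
  assumes "p \<in> sp (words_in G)" "q \<in> sp (words_in G)"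
  shows "mult A (proj p) (proj q) = proj (p * q)" "add A (proj p) (proj q) = proj (p + q)"
  using I.rcoset_mult_add[of p q] I.a_rcos_sum[of p q] assms
  by (simp_all add: A_def presented_alg_def quotient_alg_def FactRing_def proj_def I_def)

lemma A_consts: "one A = proj 1" "zero A = proj 0"
proof -
  show "one A = proj 1"
    by (simp add: A_def presented_alg_def quotient_alg_def FactRing_def proj_def I_def)
  have "proj 0 = I" by (simp add: proj_set)
  then show "zero A = proj 0"
    by (simp add: A_def presented_alg_def quotient_alg_def FactRing_def I_def)
qed

lemma A_smult: "smult A c (proj p) = proj (c \<cdot> p)"
proof -
  have "smult A c (proj p) = (\<Union>x\<in>proj p. proj (c \<cdot> x))"
    by (simp add: A_def presented_alg_def quotient_alg_def proj_def I_def)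
  also have "\<dots> = proj (c \<cdot> p)"
  proof -
    have "proj (c \<cdot> x) = proj (c \<cdot> p)" if x: "x \<in> proj p" for x
    proof -
      obtain i where "i \<in> I" "x = i + p" using x by (auto simp: proj_set)
      then show ?thesis by (simp add: proj_eq_iff I_scale pm_scale_distrib)
    qed
    moreover have "proj p \<noteq> {}" using I_diff(4) by (auto simp: proj_set)
    ultimately show ?thesis by auto
  qed
  finally show ?thesis .
qed

lemma gen_eq: "presented_gen G R g = proj (letter g)"
  by (simp add: presented_gen_def proj_def I_def)

lemma word_induct_sp [consumes 1, case_names zero add scale one letter]:
  fixes P :: "('g word \<Rightarrow>\<^sub>0 'k) \<Rightarrow> bool"
  assumes "p \<in> sp (words_in G)" "P 0" "\<And>u v. u \<in> sp (words_in G) \<Longrightarrow> v \<in> sp (words_in G) \<Longrightarrow> P u \<Longrightarrow> P v \<Longrightarrow> P (u + v)"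
    "\<And>c v. v \<in> sp (words_in G) \<Longrightarrow> P v \<Longrightarrow> P (c \<cdot> v)" "P 1"
    "\<And>g v. g \<in> G \<Longrightarrow> v \<in> sp (words_in G) \<Longrightarrow> P v \<Longrightarrow> P (letter g * v)"
  shows "P p"
proof -
  have w: "set l \<subseteq> G \<Longrightarrow> (basis_vec (Word l) :: 'g word \<Rightarrow>\<^sub>0 'k) \<in> sp (words_in G) \<and> P (basis_vec (Word l))" for l
  proof (induction l)
    case Nil
    have "basis_vec (Word []) = (1 :: 'g word \<Rightarrow>\<^sub>0 'k)" by (simp flip: zero_word_def add: basis_0)
    then show ?case using assms(5) by (simp add: sp_words_one)
  next
    case (Cons g l)
    have "basis_vec (Word (g # l)) = (letter g * basis_vec (Word l) :: 'g word \<Rightarrow>\<^sub>0 'k)"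
      by (simp add: letter_def basis_vec_def mult_single plus_word_def)
    moreover have "(basis_vec (Word (g # l)) :: 'g word \<Rightarrow>\<^sub>0 'k) \<in> sp (words_in G)"
      using Cons.prems by simp
    ultimately show ?case using Cons assms(6)[of g "basis_vec (Word l)"] by simp
  qed
  from assms(1) have "p \<in> sp (words_in G) \<and> P p"
  proof (induction rule: sp_induct)
    case (basis i)
    then show ?case using w[of "letters i"] by simp
  qed (use assms(2-4) in auto)
  then show ?thesis ..
qed

lemma A_closed:
  assumes "x \<in> carrier A" "y \<in> carrier A"
  shows "mult A x y \<in> carrier A" "add A x y \<in> carrier A" "smult A c x \<in> carrier A"
proof -
  from assms obtain p q where p: "p \<in> sp (words_in G)" "x = proj p" "q \<in> sp (words_in G)" "y = proj q"
    unfolding A_carrier by blast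
  show "mult A x y \<in> carrier A" "add A x y \<in> carrier A" "smult A c x \<in> carrier A"
    unfolding p(2,4) A_ops[OF p(1,3)] A_smult A_carrier using p by (auto intro!: imageI sp_words_mult)
qed

lemma A_one: "one A \<in> carrier A"
  by (simp add: A_consts A_carrier sp_words_one)

lemma A_letter: "g \<in> G \<Longrightarrow> proj (letter g) \<in> carrier A"
  by (simp add: A_carrier sp_words_letter)

lemma hom_restrict: "h \<in> alg_hom A B \<Longrightarrow> restrict h (carrier A) \<in> alg_hom A B"
  using A_closed A_one by (auto simp: alg_hom_def ring_hom_def)

text \<open>Homomorphisms from a presented algebra are determined on generators, by induction on words.\<close>
lemma hom_unique:
  assumes "h \<in> alg_hom A B" "h' \<in> alg_hom A B" "\<And>g. g \<in> G \<Longrightarrow> h (proj (letter g)) = h' (proj (letter g))"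
    and "x \<in> carrier A"
  shows "h x = h' x"
proof -
  have hh: "h (proj (p + q)) = add B (h (proj p)) (h (proj q))" "h (proj (p * q)) = mult B (h (proj p)) (h (proj q))"
    "h (proj 1) = one B" "h (proj (c \<cdot> p)) = smult B c (h (proj p))"
    if "h \<in> alg_hom A B" "p \<in> sp (words_in G)" "q \<in> sp (words_in G)" for h p q c
  proof -
    have c: "proj p \<in> carrier A" "proj q \<in> carrier A" using that by (auto simp: A_carrier)
    have r: "h \<in> ring_hom A B" "\<And>c x. x \<in> carrier A \<Longrightarrow> h (smult A c x) = smult B c (h x)"
      using that(1) by (auto simp: alg_hom_def)
    show "h (proj (p + q)) = add B (h (proj p)) (h (proj q))" "h (proj (p * q)) = mult B (h (proj p)) (h (proj q))"
      "h (proj 1) = one B" "h (proj (c \<cdot> p)) = smult B c (h (proj p))"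
      using ring_hom_add[OF r(1) c] ring_hom_mult[OF r(1) c] ring_hom_one[OF r(1)] r(2)[OF c(1)] A_ops[OF that(2,3)]
      by (simp_all add: A_consts A_smult)
  qed
  obtain p where p: "p \<in> sp (words_in G)" "x = proj p" using assms(4) by (auto simp: A_carrier)
  from p(1) have "h (proj p) = h' (proj p)"
  proof (induction rule: word_induct_sp)
    case zero
    show ?case
      using hh(3)[OF assms(1) sp_words_one sp_words_one] hh(3)[OF assms(2) sp_words_one sp_words_one]
        hh(4)[OF assms(1) sp_words_one sp_words_one, of 0] hh(4)[OF assms(2) sp_words_one sp_words_one, of 0] by simp
  next
    case one then show ?case using hh(3)[OF assms(1) sp_words_one sp_words_one] hh(3)[OF assms(2) sp_words_one sp_words_one] by simp
  next
    case (letter g v)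
    then show ?case
      using hh(2)[OF assms(1) sp_words_letter[OF letter(1)] letter(2)] hh(2)[OF assms(2) sp_words_letter[OF letter(1)] letter(2)] assms(3)
      by simp
  next
    case (add u v)
    then show ?case using hh(1)[OF assms(1) add(1,2)] hh(1)[OF assms(2) add(1,2)] by simp
  next
    case (scale c v)
    then show ?case using hh(4)[OF assms(1) scale(1,1)] hh(4)[OF assms(2) scale(1,1)] by simp
  qed
  then show ?thesis by (simp add: p)
qed

end

section \<open>Actions of presented algebras on tensor space\<close>

text \<open>The action of a linear combination of \<open>w\<close>'s, each of which acts by \<open>F w\<close>.\<close>
definition act :: "('w \<Rightarrow> ('a \<Rightarrow>\<^sub>0 'k) \<Rightarrow> ('a \<Rightarrow>\<^sub>0 'k)) \<Rightarrow> ('w \<Rightarrow>\<^sub>0 'k::field) \<Rightarrow> ('a \<Rightarrow>\<^sub>0 'k) \<Rightarrow> ('a \<Rightarrow>\<^sub>0 'k)" where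
  "act F p v = linear_ext (\<lambda>w. F w v) p"

lemma lin_act_left: "lin (\<lambda>p. act F p v)"
  by (simp add: act_def lin_linear_ext)

lemmas act_left_lin [simp] = lin_rules[OF lin_act_left]

lemma act_basis [simp]: "act F (basis_vec w) v = F w v"
  by (simp add: act_def)

lemma lin_act: "(\<And>w. lin (F w)) \<Longrightarrow> lin (act F p)"
  unfolding act_def by (rule linear_ext_vec_lin)

lemma act_ts: "(\<And>w v. v \<in> tensor_space r \<Longrightarrow> F w v \<in> tensor_space r) \<Longrightarrow> v \<in> tensor_space r \<Longrightarrow> act F p v \<in> tensor_space r"
  unfolding act_def linear_ext_def tensor_space_eq_sp by auto

lemma ts_sums:
  "u \<in> tensor_space r \<Longrightarrow> v \<in> tensor_space r \<Longrightarrow> u + v \<in> tensor_space r"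
  "v \<in> tensor_space r \<Longrightarrow> c \<cdot> v \<in> tensor_space r"
  by (auto simp: tensor_space_eq_sp)

text \<open>The target of a right or a left action.\<close>
definition end_alg :: "bool \<Rightarrow> nat \<Rightarrow> ('k::field, (int list \<Rightarrow>\<^sub>0 'k) \<Rightarrow> (int list \<Rightarrow>\<^sub>0 'k)) module" where
  "end_alg right r = (if right then opposite_alg (tensor_End r) else tensor_End r)"

text \<open>A family of operators indexed by letters extends to the free algebra, as a right or a left action.\<close>
locale word_action =
  fixes right :: bool and \<phi> :: "'g \<Rightarrow> (int list \<Rightarrow>\<^sub>0 'k::field) \<Rightarrow> (int list \<Rightarrow>\<^sub>0 'k)"
  assumes lin_\<phi>: "\<And>g. lin (\<phi> g)"
begin

definition "wact w = (if right then fold \<phi> (letters w) else foldr \<phi> (letters w))"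
definition "pact = act wact"

lemma lin_wact: "lin (wact w)"
proof -
  have "lin (fold \<phi> l)" "lin (foldr \<phi> l)" for l
    by (induction l) (auto simp: lin_def comp_def lin_rules[OF lin_\<phi>] id_def)
  then show ?thesis by (simp add: wact_def)
qed

lemma lin_pact: "lin (pact p)"
  by (simp add: pact_def lin_act lin_wact)

lemma lin_pact_left: "lin (\<lambda>p. pact p v)"
  by (simp add: pact_def lin_act_left)

lemmas pact_lin [simp] = lin_rules[OF lin_pact] lin_rules[OF lin_pact_left]

lemma pact_letter [simp]: "pact (letter g) v = \<phi> g v"
  by (simp add: pact_def letter_def wact_def flip: basis_vec_def)

lemma pact_one [simp]: "pact 1 v = v"
  by (simp add: pact_def wact_def flip: basis_0)

lemma pact_mult: "pact (p * q) v = (if right then pact q (pact p v) else pact p (pact q v))"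
proof -
  have wact_add: "wact (u + w) v = (if right then wact w (wact u v) else wact u (wact w v))" for u w v
    unfolding wact_def by simp
  have pb: "pact (basis_vec w) v = wact w v" for w v
    by (simp add: pact_def)
  have 2: "pact (basis_vec u * q) v = (if right then pact q (wact u v) else wact u (pact q v))" for u
  proof (rule lin_eqI[where v = q])
    show "lin (\<lambda>q. pact (basis_vec u * q) v)" by (rule lin_compose[OF lin_pact_left lin_mult_left])
    show "lin (\<lambda>q. if right then pact q (wact u v) else wact u (pact q v))"
      by (intro lin_if lin_pact_left lin_compose[OF lin_wact lin_pact_left])
    show "pact (basis_vec u * basis_vec i) v = (if right then pact (basis_vec i) (wact u v) else wact u (pact (basis_vec i) v))" for i
      unfolding basis_mult pb by (rule wact_add)
  qed
  show ?thesis
  proof (rule lin_eqI[where v = p])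
    show "lin (\<lambda>p. pact (p * q) v)" by (rule lin_compose[OF lin_pact_left lin_mult_right])
    show "lin (\<lambda>p. if right then pact q (pact p v) else pact p (pact q v))"
      by (intro lin_if lin_pact_left lin_compose[OF lin_pact lin_pact_left])
    show "pact (basis_vec i * q) v = (if right then pact q (pact (basis_vec i) v) else pact (basis_vec i) (pact q v))" for i
      unfolding pb by (rule 2)
  qed
qed

end

text \<open>If the relations act as zero on the tensor power, the action of the free algebra descends to the presented algebra.\<close>
locale presented_action = presentation G R + word_action right \<phi>
  for G :: "'g set" and R :: "('g word \<Rightarrow>\<^sub>0 'k::field) set" and right :: bool
    and \<phi> :: "'g \<Rightarrow> (int list \<Rightarrow>\<^sub>0 'k) \<Rightarrow> (int list \<Rightarrow>\<^sub>0 'k)" +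
  fixes r :: nat
  assumes \<phi>_ts: "\<And>g v. v \<in> tensor_space r \<Longrightarrow> \<phi> g v \<in> tensor_space r"
    and rels_zero: "\<And>p v. p \<in> R \<Longrightarrow> v \<in> tensor_space r \<Longrightarrow> pact p v = 0"
begin

lemma wact_ts: "v \<in> tensor_space r \<Longrightarrow> wact w v \<in> tensor_space r"
proof -
  have "v \<in> tensor_space r \<Longrightarrow> fold \<phi> l v \<in> tensor_space r" "v \<in> tensor_space r \<Longrightarrow> foldr \<phi> l v \<in> tensor_space r" for l
    by (induction l arbitrary: v) (auto simp: \<phi>_ts)
  then show "v \<in> tensor_space r \<Longrightarrow> wact w v \<in> tensor_space r" by (simp add: wact_def)
qed

lemma pact_ts: "v \<in> tensor_space r \<Longrightarrow> pact p v \<in> tensor_space r"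
  unfolding pact_def by (rule act_ts[OF wact_ts])

text \<open>The elements of the free algebra that act as zero form an ideal, which contains the relations.\<close>
lemma I_acts_zero:
  assumes "p \<in> I" "v \<in> tensor_space r"
  shows "pact p v = 0"
proof -
  define J :: "('g word \<Rightarrow>\<^sub>0 'k) set" where "J = {p \<in> sp (words_in G). \<forall>v\<in>tensor_space r. pact p v = 0}"
  define P where "P = pact"
  note P = pact_ts[folded P_def] pact_mult[folded P_def] pact_lin[folded P_def]
  have JP: "J = {p \<in> sp (words_in G). \<forall>v\<in>tensor_space r. P p v = 0}" by (simp add: J_def P_def)
  have "ideal J (free_alg G)"
  proof (rule idealI[OF ring_free_alg])
    show "subgroup J (add_monoid (free_alg G))"
    proof
      fix x assume x: "x \<in> J"
      have "inv\<^bsub>add_monoid (free_alg G)\<^esub> x = - x"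
        by (rule group.inv_equality[OF abelian_group.a_group[OF ring.is_abelian_group[OF ring_free_alg]]]) (use x in \<open>auto simp: J_def\<close>)
      then show "inv\<^bsub>add_monoid (free_alg G)\<^esub> x \<in> J" using x by (auto simp: J_def)
    qed (auto simp: J_def)
  next
    fix a x :: "'g word \<Rightarrow>\<^sub>0 'k" assume "a \<in> J" "x \<in> carrier (free_alg G)"
    then show "x \<otimes>\<^bsub>free_alg G\<^esub> a \<in> J" "a \<otimes>\<^bsub>free_alg G\<^esub> x \<in> J"
      by (auto simp: JP sp_words_mult P)
  qed
  moreover have "R \<subseteq> J" using rels rels_zero unfolding J_def by blast
  ultimately have "I \<subseteq> J" unfolding I_def by (intro ring.genideal_minimal[OF ring_free_alg])
  then show ?thesis using assms by (auto simp: J_def)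
qed

definition "rep C = (\<lambda>v\<in>tensor_space r. pact (SOME p. p \<in> sp (words_in G) \<and> proj p = C) v)"

lemma rep_proj:
  assumes "p \<in> sp (words_in G)"
  shows "rep (proj p) = (\<lambda>v\<in>tensor_space r. pact p v)"
proof -
  define q where "q = (SOME q. q \<in> sp (words_in G) \<and> proj q = proj p)"
  have "q \<in> sp (words_in G) \<and> proj q = proj p" unfolding q_def by (rule someI[of _ p]) (use assms in simp)
  then have "q - p \<in> I" by (simp add: proj_eq_iff)
  then have "pact q v = pact p v" if "v \<in> tensor_space r" for v
    using I_acts_zero[OF _ that, of "q - p"] by simp
  then show ?thesis unfolding rep_def q_def[symmetric] by (intro restrict_ext)
qed

lemma rep_End:
  assumes "x \<in> carrier A"
  shows "rep x \<in> carrier (tensor_End r)"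
proof -
  obtain p where p: "p \<in> sp (words_in G)" "x = proj p" using assms by (auto simp: A_carrier)
  show ?thesis unfolding p(2) rep_proj[OF p(1)]
    by (auto simp: tensor_End_def pact_ts ts_sums)
qed

lemma rep_hom: "rep \<in> alg_hom A (end_alg right r)"
proof -
  have "rep (mult A x y) = mult (end_alg right r) (rep x) (rep y) \<and> rep (add A x y) = add (end_alg right r) (rep x) (rep y)
     \<and> rep (smult A c x) = smult (end_alg right r) c (rep x)"
    if "x \<in> carrier A" "y \<in> carrier A" for x y c
  proof -
    from that obtain p q where p: "p \<in> sp (words_in G)" "x = proj p" "q \<in> sp (words_in G)" "y = proj q"
      unfolding A_carrier by blast
    define P where "P = pact"
    have mult: "mult (end_alg right r) f g = (if right then compose (tensor_space r) g f else compose (tensor_space r) f g)"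
      for f g :: "(int list \<Rightarrow>\<^sub>0 'k) \<Rightarrow> (int list \<Rightarrow>\<^sub>0 'k)"
      by (simp add: end_alg_def opposite_alg_def tensor_End_def)
    have add: "add (end_alg right r) = add (tensor_End r)" "smult (end_alg right r) = smult (tensor_End r)"
      by (simp_all add: end_alg_def opposite_alg_def)
    note P = pact_ts[folded P_def] pact_mult[folded P_def] pact_lin[folded P_def]
    have reps: "rep x = (\<lambda>v\<in>tensor_space r. P p v)" "rep y = (\<lambda>v\<in>tensor_space r. P q v)"
      "rep (mult A x y) = (\<lambda>v\<in>tensor_space r. P (p * q) v)" "rep (add A x y) = (\<lambda>v\<in>tensor_space r. P (p + q) v)"
      "rep (smult A c x) = (\<lambda>v\<in>tensor_space r. P (c \<cdot> p) v)"
      using p by (simp_all add: A_ops A_smult rep_proj sp_words_mult sp_add sp_scale P_def)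
    show ?thesis unfolding reps mult add
      by (auto simp: P compose_def tensor_End_def fun_eq_iff)
  qed
  moreover have "rep (one A) = one (end_alg right r)"
    by (simp add: A_consts rep_proj[OF sp_words_one] end_alg_def opposite_alg_def tensor_End_def)
  moreover have "carrier (end_alg right r) = carrier (tensor_End r)"
    by (simp add: end_alg_def opposite_alg_def)
  ultimately show ?thesis using rep_End by (auto simp: alg_hom_def ring_hom_def)
qed

end

section \<open>The Hecke action\<close>

context affine_params begin

fun hecke_op :: "hecke_gen \<Rightarrow> (int list \<Rightarrow>\<^sub>0 'k) \<Rightarrow> (int list \<Rightarrow>\<^sub>0 'k)" where
  "hecke_op (T_gen k) = opT (k - 1)"
| "hecke_op (X_gen t) = xop (t - 1) (- int n)"
| "hecke_op (Xinv_gen t) = xop (t - 1) (int n)"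

lemma lin_hecke_op: "lin (hecke_op g)"
  by (cases g) (simp_all add: lin_ops)

lemma hecke_op_ts: "v \<in> tensor_space r \<Longrightarrow> hecke_op g v \<in> tensor_space r"
  by (cases g) simp_all

lemma ts_longer: "v \<in> tensor_space r \<Longrightarrow> m \<le> r \<Longrightarrow> v \<in> longer m"
  by (auto simp: tensor_space_def sp_def)

sublocale H: word_action True hecke_op
  by unfold_locales (rule lin_hecke_op)

lemma H_mult [simp]: "H.pact (p * q) v = H.pact q (H.pact p v)"
  using H.pact_mult[of p q v] by simp

lemma hecke_rels_in: "hecke_rels r \<epsilon> \<subseteq> sp (words_in (hecke_gens r))"
  unfolding hecke_rels_def Let_def
  by (safe; intro sp_diff sp_add sp_scale sp_words_mult sp_words_one sp_words_letter) (auto simp: hecke_gens_def)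

lemma hecke_rels_zero:
  assumes "p \<in> hecke_rels r \<epsilon>" and v: "v \<in> tensor_space r"
  shows "H.pact p v = 0"
proof -
  have long: "u \<in> longer m" if "u \<in> tensor_space r" "m \<le> r" for u m
    by (rule ts_longer[OF that])
  have quad: "opT (i - 1) (opT (i - 1) v) = (\<epsilon>^2 - 1) \<cdot> opT (i - 1) v + \<epsilon>^2 \<cdot> v" if "1 \<le> i" "i < r" for i
    by (rule T_quadratic[OF long[OF v]]) (use that in simp)
  have far: "opT (j - 1) (opT (i - 1) v) = opT (i - 1) (opT (j - 1) v)"
    if "1 \<le> i" "i < r" "1 \<le> j" "j < r" "\<bar>int i - int j\<bar> > 1" for i j
  proof -
    have *: "opT (i - 1) (opT (j - 1) v) = opT (j - 1) (opT (i - 1) v)"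
      if "1 \<le> i" "i < r" "1 \<le> j" "j < r" "i + 1 < j" for i j
    proof -
      have "Suc (Suc (i - 1 + (j - i - 2))) = j - 1" using that by simp
      then show ?thesis using T_far[of v "i - 1" "j - i - 2"] long[OF v, of "Suc (Suc (i - 1))"] that by simp
    qed
    show ?thesis
    proof (cases "i < j")
      case True then show ?thesis using *[of i j] that by simp
    next
      case False then show ?thesis using *[of j i] that by simp
    qed
  qed
  have braid: "opT (i - 1) (opT i (opT (i - 1) v)) = opT i (opT (i - 1) (opT i v))" if "1 \<le> i" "i + 1 < r" for i
    using T_braid[of v "i - 1"] long[OF v, of "Suc (Suc (Suc (i - 1)))"] that by simp
  have TX: "opT (i - 1) (xop (i - 1) (- int n) (opT (i - 1) v)) = \<epsilon>^2 \<cdot> xop i (- int n) v" if "1 \<le> i" "i < r" for i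
  proof -
    have l: "u \<in> longer (Suc (Suc (i - 1)))" if "u \<in> tensor_space r" for u by (rule long[OF that]) (use \<open>1 \<le> i\<close> \<open>i < r\<close> in simp)
    have "opT (i - 1) (xop (i - 1) (- int n) (opT (i - 1) v)) = xop i (- int n) (opT (i - 1) (opT (i - 1) v)) - (\<epsilon>^2 - 1) \<cdot> xop i (- int n) (opT (i - 1) v)"
      using T_x[OF l, of "opT (i - 1) v"] v that by simp
    then show ?thesis using quad[OF that] by simp
  qed
  have XT: "opT (i - 1) (xop (j - 1) (- int n) v) = xop (j - 1) (- int n) (opT (i - 1) v)"
    if "1 \<le> i" "i < r" "1 \<le> j" "j \<le> r" "j \<noteq> i" "j \<noteq> i + 1" for i j
  proof (cases "j < i")
    case True
    define d where "d = i - j - 1"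
    have eq: "i - 1 = Suc (j - 1 + d)" using that True by (simp add: d_def)
    show ?thesis unfolding eq by (rule T_x_left[OF long[OF v]]) (use that in simp)
  next
    case False
    define d where "d = j - i - 2"
    have eq: "j - 1 = Suc (Suc (i - 1 + d))" using that False by (simp add: d_def)
    show ?thesis unfolding eq by (rule T_x_right[OF long[OF v]]) (use that in simp)
  qed
  show ?thesis
    using assms(1) unfolding hecke_rels_def Let_def
    by (auto simp: quad[simplified] far[simplified] braid[simplified] TX[simplified] XT[simplified] xop_commute
        pm_scale_distrib distrib_left distrib_right right_diff_distrib left_diff_distrib pm_scale_mult_right)
qed

lemma hecke_presented_action: "presented_action (hecke_gens r) (hecke_rels r \<epsilon>) True hecke_op r"
proof
  show "hecke_rels r \<epsilon> \<subseteq> sp (words_in (hecke_gens r))" by (rule hecke_rels_in)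
qed (simp_all add: hecke_op_ts hecke_rels_zero)

context
  fixes r :: nat
begin

interpretation HP: presented_action "hecke_gens r" "hecke_rels r \<epsilon>" True hecke_op r
  by (rule hecke_presented_action)

lemma hecke_alg_eq: "hecke_alg r \<epsilon> = HP.A"
  by (simp add: hecke_alg_def HP.A_def)

lemma hecke_elem_eq: "hecke_elem r \<epsilon> g = HP.proj (letter g)"
  by (simp add: hecke_elem_def HP.gen_eq)

lemma end_alg_right: "end_alg True r = opposite_alg (tensor_End r)"
  by (simp add: end_alg_def)

lemma hecke_op_rep: "g \<in> hecke_gens r \<Longrightarrow> v \<in> tensor_space r \<Longrightarrow> HP.rep (hecke_elem r \<epsilon> g) v = hecke_op g v"
  by (simp add: hecke_elem_eq HP.rep_proj sp_words_letter)

lemma T_hecke_value: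
  assumes "length i = r" "set i \<subseteq> {1..int n}" "k \<in> {1..<r}"
  shows "opT (k - 1) (basis_vec i) = hecke_T_value \<epsilon> k i"
proof -
  define xs a b ys where "xs = take (k - 1) i" and "a = i ! (k - 1)" and "b = i ! k" and "ys = drop (Suc k) i"
  have i: "i = xs @ a # b # ys"
    using assms unfolding xs_def a_def b_def ys_def
    by (metis Cons_nth_drop_Suc One_nat_def Suc_pred append_take_drop_id atLeastLessThan_iff less_imp_diff_less not_one_le_zero not_gr_zero)
  have len: "length xs = k - 1" using assms by (auto simp: xs_def)
  have nth: "i ! (k - 1) = a" "i ! k = b" by (simp_all add: a_def b_def)
  have "k = Suc (length xs)" using len assms(3) by simp
  then have "swap_entries k i = xs @ b # a # ys"
    unfolding swap_entries_def nth by (simp add: i list_update_append)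
  moreover have ab: "1 \<le> a" "a \<le> int n" "1 \<le> b" "b \<le> int n" using assms(2) by (auto simp: i)
  ultimately have "opT (k - 1) (basis_vec i) = (if a = b then \<epsilon>^2 else \<epsilon>) \<cdot> basis_vec (swap_entries k i)
    + (if a > b then (\<epsilon>^2 - 1) \<cdot> basis_vec i else 0)"
    using T_at[OF ab, of xs ys] by (simp only: len i)
  moreover have "a = b \<Longrightarrow> swap_entries k i = i" using \<open>swap_entries k i = _\<close> i by simp
  moreover have "hecke_T_value \<epsilon> k i = (if a = b then \<epsilon>^2 \<cdot> basis_vec i else if a < b then \<epsilon> \<cdot> basis_vec (swap_entries k i)
      else \<epsilon> \<cdot> basis_vec (swap_entries k i) + (\<epsilon>^2 - 1) \<cdot> basis_vec i)"
    unfolding hecke_T_value_def nth ..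
  ultimately show ?thesis by (cases a b rule: linorder_cases) simp_all
qed

lemma is_hecke_action_rep: "is_hecke_action n r \<epsilon> HP.rep"
  unfolding is_hecke_action_def
proof (intro conjI ballI allI impI)
  show "HP.rep \<in> alg_hom (hecke_alg r \<epsilon>) (opposite_alg (tensor_End r))"
    using HP.rep_hom by (simp add: hecke_alg_eq end_alg_right)
next
  fix t and i :: "int list" assume "t \<in> {1..r}" "length i = r"
  then show "HP.rep (hecke_elem r \<epsilon> (Xinv_gen t)) (basis_vec i) = basis_vec (i[t - 1 := i ! (t - 1) + int n])"
    by (subst hecke_op_rep) (auto simp: hecke_gens_def tensor_space_eq_sp xop_basis)
next
  fix k and i :: "int list" assume *: "k \<in> {1..<r}" "length i = r \<and> set i \<subseteq> {1..int n}"
  then have "HP.rep (hecke_elem r \<epsilon> (T_gen k)) (basis_vec i) = opT (k - 1) (basis_vec i)"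
    by (subst hecke_op_rep) (auto simp: hecke_gens_def tensor_space_eq_sp)
  then show "HP.rep (hecke_elem r \<epsilon> (T_gen k)) (basis_vec i) = hecke_T_value \<epsilon> k i"
    using T_hecke_value[of i k] * by simp
qed

lemma alg_hom_hecke:
  assumes "h \<in> alg_hom HP.A (opposite_alg (tensor_End r))" "p \<in> sp (words_in (hecke_gens r))" "q \<in> sp (words_in (hecke_gens r))"
  shows "h (HP.proj p) \<in> carrier (tensor_End r)"
    "v \<in> tensor_space r \<Longrightarrow> h (HP.proj (p * q)) v = h (HP.proj q) (h (HP.proj p) v)"
    "v \<in> tensor_space r \<Longrightarrow> h (HP.proj (p + q)) v = h (HP.proj p) v + h (HP.proj q) v"
    "v \<in> tensor_space r \<Longrightarrow> h (HP.proj (c \<cdot> p)) v = c \<cdot> h (HP.proj p) v"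
    "v \<in> tensor_space r \<Longrightarrow> h (HP.proj 1) v = v"
proof -
  have c: "HP.proj p \<in> carrier HP.A" "HP.proj q \<in> carrier HP.A" using assms by (auto simp: HP.A_carrier)
  have r: "h \<in> ring_hom HP.A (opposite_alg (tensor_End r))" "\<And>c x. x \<in> carrier HP.A \<Longrightarrow> h (smult HP.A c x) = smult (opposite_alg (tensor_End r)) c (h x)"
    using assms(1) by (auto simp: alg_hom_def)
  show "h (HP.proj p) \<in> carrier (tensor_End r)"
    using ring_hom_closed[OF r(1) c(1)] by (simp add: opposite_alg_def)
  show "v \<in> tensor_space r \<Longrightarrow> h (HP.proj (p * q)) v = h (HP.proj q) (h (HP.proj p) v)"
    "v \<in> tensor_space r \<Longrightarrow> h (HP.proj (p + q)) v = h (HP.proj p) v + h (HP.proj q) v"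
    "v \<in> tensor_space r \<Longrightarrow> h (HP.proj (c \<cdot> p)) v = c \<cdot> h (HP.proj p) v"
    "v \<in> tensor_space r \<Longrightarrow> h (HP.proj 1) v = v"
    using ring_hom_mult[OF r(1) c] ring_hom_add[OF r(1) c] ring_hom_one[OF r(1)] r(2)[OF c(1)] HP.A_ops[OF assms(2,3)]
    by (simp_all add: HP.A_consts HP.A_smult opposite_alg_def tensor_End_def compose_def)
qed

lemma End_lin:
  assumes "f \<in> carrier (tensor_End r)" "u \<in> tensor_space r" "v \<in> tensor_space r"
  shows "f (u + v) = f u + f v" "f (c \<cdot> v) = c \<cdot> f v" "f v \<in> tensor_space r"
  using assms by (auto simp: tensor_End_def)

lemma End_eqI:
  fixes f f' :: "(int list \<Rightarrow>\<^sub>0 'a::field) \<Rightarrow> (int list \<Rightarrow>\<^sub>0 'a)"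
  assumes "f \<in> carrier (tensor_End r)" "f' \<in> carrier (tensor_End r)" "\<And>i. length i = r \<Longrightarrow> f (basis_vec i) = f' (basis_vec i)"
  shows "f = f'"
proof (rule extensionalityI[of _ "tensor_space r"])
  fix v :: "int list \<Rightarrow>\<^sub>0 'a" assume "v \<in> tensor_space r"
  then have "v \<in> sp (\<lambda>i. length i = r)" by (simp add: tensor_space_eq_sp)
  then have "v \<in> tensor_space r \<and> f v = f' v"
  proof (induction rule: sp_induct)
    case zero
    have "f (0 \<cdot> 0) = f' (0 \<cdot> 0)"
      using End_lin(2)[OF assms(1), of 0 0 0] End_lin(2)[OF assms(2), of 0 0 0] by (simp add: ts_intro)
    then show ?case by (simp add: ts_intro)
  next
    case (add u v) then show ?case using End_lin(1)[OF assms(1)] End_lin(1)[OF assms(2)] by (simp add: ts_sums)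
  next
    case (scale c v) then show ?case using End_lin(2)[OF assms(1), of v v] End_lin(2)[OF assms(2), of v v] by (simp add: ts_sums)
  next
    case (basis i) then show ?case using assms(3) by (simp add: tensor_space_eq_sp)
  qed
  then show "f v = f' v" ..
qed (use assms in \<open>auto simp: tensor_End_def PiE_def\<close>)

text \<open>The operators \<open>X\<^sub>t\<close> are forced as inverses of \<open>X\<^sub>t\<^sup>-\<^sup>1\<close>. For \<open>\<tau> = T\<^sub>k\<close> the quadratic relation makes \<open>\<tau>\<close> invertible, and then
\<open>T\<^sub>k X\<^sub>k T\<^sub>k = q X\<^bsub>k+1\<^esub>\<close> yields the Bernstein relations. Hence the difference \<open>D\<close> of \<open>\<tau>\<close> and the explicit operator intertwines
the \<open>X\<^sub>t\<close> up to a transposition, and it vanishes because it does so on tuples in \<open>{1..n}\<close>, where both are given by the same formula.\<close>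
lemma hecke_action_unique_T:
  assumes h: "is_hecke_action n r \<epsilon> h"
  shows "t \<in> {1..r} \<Longrightarrow> v \<in> tensor_space r \<Longrightarrow> h (HP.proj (letter (Xinv_gen t))) v = xop (t - 1) (int n) v"
    "t \<in> {1..r} \<Longrightarrow> v \<in> tensor_space r \<Longrightarrow> h (HP.proj (letter (X_gen t))) v = xop (t - 1) (- int n) v"
    "k \<in> {1..<r} \<Longrightarrow> v \<in> tensor_space r \<Longrightarrow> h (HP.proj (letter (T_gen k))) v = opT (k - 1) v"
proof -
  have hom: "h \<in> alg_hom HP.A (opposite_alg (tensor_End r))"
    and hX: "\<And>t i. t \<in> {1..r} \<Longrightarrow> length i = r \<Longrightarrow> h (HP.proj (letter (Xinv_gen t))) (basis_vec i) = basis_vec (i[t - 1 := i ! (t - 1) + int n])"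
    and hT: "\<And>k i. k \<in> {1..<r} \<Longrightarrow> length i = r \<Longrightarrow> set i \<subseteq> {1..int n} \<Longrightarrow> h (HP.proj (letter (T_gen k))) (basis_vec i) = hecke_T_value \<epsilon> k i"
    using h by (auto simp: is_hecke_action_def hecke_alg_eq hecke_elem_eq)
  have gens: "letter (T_gen k) \<in> sp (words_in (hecke_gens r))" if "k \<in> {1..<r}" for k
    using that by (intro sp_words_letter) (auto simp: hecke_gens_def)
  have gensX: "letter (X_gen t) \<in> sp (words_in (hecke_gens r))" "letter (Xinv_gen t) \<in> sp (words_in (hecke_gens r))" if "t \<in> {1..r}" for t
    using that by (auto intro!: sp_words_letter simp: hecke_gens_def)
  note ah = alg_hom_hecke[OF hom]
  show Xinv: "h (HP.proj (letter (Xinv_gen t))) v = xop (t - 1) (int n) v" if t: "t \<in> {1..r}" and v: "v \<in> tensor_space r" for t v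
  proof -
    have E: "h (HP.proj (letter (Xinv_gen t))) \<in> carrier (tensor_End r)" by (rule ah(1)[OF gensX(2)[OF t] gensX(2)[OF t]])
    have E': "(\<lambda>v\<in>tensor_space r. xop (t - 1) (int n) v) \<in> carrier (tensor_End r)"
      by (auto simp: tensor_End_def ts_sums)
    have "h (HP.proj (letter (Xinv_gen t))) = (\<lambda>v\<in>tensor_space r. xop (t - 1) (int n) v)"
      by (rule End_eqI[OF E E']) (simp add: hX[simplified] t[simplified] tensor_space_eq_sp xop_basis)
    then show ?thesis using v by simp
  qed
  have ts: "h (HP.proj (letter g)) v \<in> tensor_space r" if "g \<in> hecke_gens r" "v \<in> tensor_space r" for g v
    using End_lin(3)[OF ah(1)[OF sp_words_letter[OF that(1)] sp_words_letter[OF that(1)]] that(2) that(2)] .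
  show X: "h (HP.proj (letter (X_gen t))) v = xop (t - 1) (- int n) v" if t: "t \<in> {1..r}" and v: "v \<in> tensor_space r" for t v
  proof -
    have "letter (Xinv_gen t) * letter (X_gen t) - 1 \<in> hecke_rels r \<epsilon>"
      unfolding hecke_rels_def Let_def using t by blast
    then have "HP.proj (letter (Xinv_gen t) * letter (X_gen t)) = HP.proj 1"
      using HP.R_subset_I by (auto simp: HP.proj_eq_iff)
    then have "h (HP.proj (letter (X_gen t))) (h (HP.proj (letter (Xinv_gen t))) (xop (t - 1) (- int n) v)) = xop (t - 1) (- int n) v"
      using ah(2)[OF gensX(2)[OF t] gensX(1)[OF t], of "xop (t - 1) (- int n) v"] ah(5)[OF gensX(2)[OF t] gensX(1)[OF t], of "xop (t - 1) (- int n) v"] v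
      by simp
    then show ?thesis using Xinv[OF t, of "xop (t - 1) (- int n) v"] v by simp
  qed
  show "h (HP.proj (letter (T_gen k))) v = opT (k - 1) v" if k: "k \<in> {1..<r}" and v: "v \<in> tensor_space r" for k v
  proof -
    let ?T = "letter (T_gen k) :: hecke_gen word \<Rightarrow>\<^sub>0 'k"
    define \<tau> where "\<tau> = h (HP.proj ?T)"
    have kr: "k \<in> {1..r}" "k + 1 \<in> {1..r}" using k by auto
    let ?x = "xop (k - 1) (- int n)" and ?y = "xop k (- int n)"
    have \<tau>E: "\<tau> \<in> carrier (tensor_End r)" unfolding \<tau>_def by (rule ah(1)[OF gens[OF k] gens[OF k]])
    have \<tau>ts: "\<tau> v \<in> tensor_space r" if "v \<in> tensor_space r" for v by (rule End_lin(3)[OF \<tau>E that that])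
    note \<tau>lin = End_lin(1,2)[OF \<tau>E]
    have \<tau>diff: "\<tau> (u - v) = \<tau> u - \<tau> v" if "u \<in> tensor_space r" "v \<in> tensor_space r" for u v
      using \<tau>lin(1)[of u "- 1 \<cdot> v"] \<tau>lin(2)[of v v "- 1"] that ts_sums(2)[OF that(2), of "- 1"] by simp
    have q0: "\<epsilon>^2 \<noteq> 0" using eps_nonzero by simp
    have quad: "\<tau> (\<tau> v) = (\<epsilon>^2 - 1) \<cdot> \<tau> v + \<epsilon>^2 \<cdot> v" if v: "v \<in> tensor_space r" for v
    proof -
      have "(?T + 1) * (?T - (\<epsilon>^2) \<cdot> 1) \<in> hecke_rels r \<epsilon>"
        unfolding hecke_rels_def Let_def using k by blast
      moreover have "(?T + 1) * (?T - (\<epsilon>^2) \<cdot> 1) = ?T * ?T - ((\<epsilon>^2 - 1) \<cdot> ?T + \<epsilon>^2 \<cdot> 1)"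
        by (simp add: distrib_right right_diff_distrib pm_scale_mult_right pm_scale_distrib)
      ultimately have eq: "HP.proj (?T * ?T) = HP.proj ((\<epsilon>^2 - 1) \<cdot> ?T + \<epsilon>^2 \<cdot> 1)"
        using HP.R_subset_I by (auto simp: HP.proj_eq_iff)
      have "\<tau> (\<tau> v) = h (HP.proj (?T * ?T)) v"
        unfolding \<tau>_def using ah(2)[OF gens[OF k] gens[OF k] v] by simp
      also have "\<dots> = (\<epsilon>^2 - 1) \<cdot> \<tau> v + \<epsilon>^2 \<cdot> v"
        unfolding eq \<tau>_def
        using ah(3)[OF sp_scale[OF gens[OF k], of "\<epsilon>^2 - 1"] sp_scale[OF sp_words_one, of "\<epsilon>^2"] v]
          ah(4)[OF gens[OF k] gens[OF k] v] ah(4)[OF sp_words_one sp_words_one v] ah(5)[OF gens[OF k] gens[OF k] v] by simp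
      finally show ?thesis .
    qed
    have TXT: "\<tau> (?x (\<tau> v)) = \<epsilon>^2 \<cdot> ?y v" if v: "v \<in> tensor_space r" for v
    proof -
      have "?T * letter (X_gen k) * ?T - (\<epsilon>^2) \<cdot> letter (X_gen (k + 1)) \<in> hecke_rels r \<epsilon>"
        unfolding hecke_rels_def Let_def using k by blast
      then have eq: "HP.proj (?T * letter (X_gen k) * ?T) = HP.proj ((\<epsilon>^2) \<cdot> letter (X_gen (k + 1)))"
        using HP.R_subset_I by (auto simp: HP.proj_eq_iff)
      have "\<tau> (?x (\<tau> v)) = h (HP.proj (?T * letter (X_gen k) * ?T)) v"
        using ah(2)[OF sp_words_mult[OF gens[OF k] gensX(1)[OF kr(1)]] gens[OF k] v] ah(2)[OF gens[OF k] gensX(1)[OF kr(1)] v]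
          X[OF kr(1) \<tau>ts[OF v]] by (simp add: \<tau>_def)
      also have "\<dots> = \<epsilon>^2 \<cdot> ?y v"
        unfolding eq using ah(4)[OF gensX(1)[OF kr(2)] gensX(1)[OF kr(2)] v] X[OF kr(2) v] by simp
      finally show ?thesis .
    qed
    have \<tau>x: "\<tau> (?x v) = ?y (\<tau> v) - (\<epsilon>^2 - 1) \<cdot> ?y v" if v: "v \<in> tensor_space r" for v
    proof -
      \<comment> \<open>\<open>u\<close> is \<open>v\<close> under the inverse of \<open>\<tau>\<close>, read off from the quadratic relation.\<close>
      define u where "u = inverse (\<epsilon>^2) \<cdot> (\<tau> v - (\<epsilon>^2 - 1) \<cdot> v)"
      have d: "\<tau> v - (\<epsilon>^2 - 1) \<cdot> v \<in> tensor_space r" using v \<tau>ts[OF v] by (intro ts_intro)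
      then have u: "u \<in> tensor_space r" unfolding u_def by (rule ts_sums)
      have "\<tau> u = inverse (\<epsilon>^2) \<cdot> (\<tau> (\<tau> v) - (\<epsilon>^2 - 1) \<cdot> \<tau> v)"
        unfolding u_def using \<tau>lin(2)[OF d d] \<tau>diff[OF \<tau>ts[OF v] ts_sums(2)[OF v]] \<tau>lin(2)[OF v v] by simp
      then have "\<tau> u = v" using q0 by (simp add: quad[OF v])
      then show ?thesis using TXT[OF u] q0 by (simp add: u_def)
    qed
    have \<tau>y: "\<tau> (?y v) = ?x (\<tau> v) + (\<epsilon>^2 - 1) \<cdot> ?y v" if v: "v \<in> tensor_space r" for v
    proof -
      have x\<tau>: "?x (\<tau> v) \<in> tensor_space r" using \<tau>ts[OF v] by simp
      have "\<epsilon>^2 \<cdot> \<tau> (?y v) = \<tau> (\<tau> (?x (\<tau> v)))"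
        using TXT[OF v] \<tau>lin(2)[of "?y v" "?y v"] v by simp
      also have "\<dots> = \<epsilon>^2 \<cdot> (?x (\<tau> v) + (\<epsilon>^2 - 1) \<cdot> ?y v)"
        using quad[OF x\<tau>] TXT[OF v] by (simp add: pm_scale_distrib mult.commute)
      finally show ?thesis using pm_scale_cancel[OF q0] by blast
    qed
    have \<tau>z: "\<tau> (xop t (- int n) v) = xop t (- int n) (\<tau> v)" if v: "v \<in> tensor_space r" and t: "t < r" "t \<noteq> k - 1" "t \<noteq> k" for t v
    proof -
      have tr: "t + 1 \<in> {1..r}" using t by simp
      have "letter (X_gen (t + 1)) * ?T - ?T * letter (X_gen (t + 1)) \<in> hecke_rels r \<epsilon>"
        unfolding hecke_rels_def Let_def
        apply (rule UnI2)
        apply (rule CollectI, rule exI[of _ k], rule exI[of _ "t + 1"])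
        using k t by auto
      then have eq: "HP.proj (letter (X_gen (t + 1)) * ?T) = HP.proj (?T * letter (X_gen (t + 1)))"
        using HP.R_subset_I by (auto simp: HP.proj_eq_iff)
      show ?thesis
        using arg_cong[OF eq, of "\<lambda>x. h x v"] ah(2)[OF gensX(1)[OF tr] gens[OF k] v] ah(2)[OF gens[OF k] gensX(1)[OF tr] v]
          X[OF tr v] X[OF tr \<tau>ts[OF v]] by (simp add: \<tau>_def)
    qed
    have Tl: "w \<in> longer (Suc (Suc (k - 1)))" if "w \<in> tensor_space r" for w
      by (rule ts_longer[OF that]) (use k in auto)
    have k1: "Suc (k - 1) = k" using k by simp
    define D where "D w = \<tau> w - opT (k - 1) w" for w
    have Dx: "D (xop t (- int n) w) = xop (if t = k - 1 then k else if t = k then k - 1 else t) (- int n) (D w)"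
      if w: "w \<in> tensor_space r" and t: "t < r" for t w
    proof -
      consider "t = k - 1" | "t = k" "t \<noteq> k - 1" | "t \<noteq> k - 1" "t \<noteq> k" by blast
      then show ?thesis
      proof cases
        case 1 then show ?thesis using \<tau>x[OF w] T_x[OF Tl[OF w], unfolded k1] by (simp add: D_def)
      next
        case 2 then show ?thesis using \<tau>y[OF w] T_y[OF Tl[OF w], unfolded k1] by (simp add: D_def)
      next
        case 3
        have "opT (k - 1) (xop t (- int n) w) = xop t (- int n) (opT (k - 1) w)"
        proof (cases "t < k - 1")
          case True
          define d where "d = k - 1 - Suc t"
          have eq: "k - 1 = Suc (t + d)" using True by (simp add: d_def)
          show ?thesis unfolding eq by (rule T_x_left[OF ts_longer[OF w]]) (use t in simp)
        next
          case False
          define d where "d = t - Suc k"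
          have eq: "t = Suc (Suc (k - 1 + d))" using False 3 k by (auto simp: d_def)
          show ?thesis unfolding eq by (rule T_x_right[OF Tl[OF w]])
        qed
        then show ?thesis using \<tau>z[OF w t 3] 3 by (simp add: D_def)
      qed
    qed
    have bt: "basis_vec i \<in> tensor_space r" if "length i = r" for i
      using that by (simp add: tensor_space_eq_sp)
    have D0: "D (basis_vec i) = 0" if "length i = r" for i
    proof (rule base_lists_suffice[of _ "\<lambda>i. D (basis_vec i) = 0", OF _ _ that])
      show "D (basis_vec i) = 0" if "length i = r" "set i \<subseteq> {1..int n}" for i
        using hT[OF k that] T_hecke_value[OF that k] by (simp add: D_def \<tau>_def)
      show "(D (basis_vec (xs @ (a - int n) # ys)) = 0) = (D (basis_vec (xs @ a # ys)) = 0)"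
        if "length (xs @ a # ys) = r" for xs a ys
      proof -
        have "xop (length xs) (- int n) (basis_vec (xs @ a # ys)) = basis_vec (xs @ (a - int n) # ys)"
          by (simp add: xop_basis list_update_append)
        then show ?thesis using Dx[OF bt[OF that], of "length xs"] that by simp
      qed
    qed
    have "\<tau> = (\<lambda>v\<in>tensor_space r. opT (k - 1) v)"
      by (rule End_eqI[OF \<tau>E]) (use D0 bt in \<open>auto simp: tensor_End_def ts_sums D_def\<close>)
    then show ?thesis using v by (simp add: \<tau>_def)
  qed
qed

lemma hecke_action_unique:
  assumes h: "is_hecke_action n r \<epsilon> h" and x: "x \<in> carrier (hecke_alg r \<epsilon>)"
  shows "h x = HP.rep x"
proof (rule HP.hom_unique)
  show hom: "h \<in> alg_hom HP.A (opposite_alg (tensor_End r))"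
    using h by (simp add: is_hecke_action_def hecke_alg_eq)
  show "HP.rep \<in> alg_hom HP.A (opposite_alg (tensor_End r))"
    using HP.rep_hom by (simp add: end_alg_right)
  show "x \<in> carrier HP.A" using x by (simp add: hecke_alg_eq)
  fix g assume g: "g \<in> hecke_gens r"
  have E: "h (HP.proj (letter g)) \<in> carrier (tensor_End r)"
    by (rule alg_hom_hecke(1)[OF hom sp_words_letter[OF g] sp_words_letter[OF g]])
  have "h (HP.proj (letter g)) v = hecke_op g v" if "v \<in> tensor_space r" for v
    using g hecke_action_unique_T[OF h] that by (auto simp: hecke_gens_def)
  then have "h (HP.proj (letter g)) = (\<lambda>v\<in>tensor_space r. hecke_op g v)"
    using E by (intro extensionalityI[of _ "tensor_space r"]) (auto simp: tensor_End_def PiE_def)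
  then show "h (HP.proj (letter g)) = HP.rep (HP.proj (letter g))"
    by (simp add: HP.rep_proj sp_words_letter g)
qed

lemma hecke_action_rep:
  assumes x: "x \<in> carrier (hecke_alg r \<epsilon>)"
  shows "hecke_action n r \<epsilon> x = HP.rep x"
proof -
  let ?h = "restrict HP.rep (carrier (hecke_alg r \<epsilon>))"
  have is_restrict: "is_hecke_action n r \<epsilon> ?h"
    unfolding is_hecke_action_def hecke_alg_eq
  proof (intro conjI ballI allI impI)
    show "restrict HP.rep (carrier HP.A) \<in> alg_hom HP.A (opposite_alg (tensor_End r))"
      by (rule HP.hom_restrict) (use HP.rep_hom in \<open>simp add: end_alg_right\<close>)
  next
    fix t and i :: "int list" assume *: "t \<in> {1..r}" "length i = r"
    then have "hecke_elem r \<epsilon> (Xinv_gen t) \<in> carrier HP.A"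
      unfolding hecke_elem_eq by (intro HP.A_letter) (auto simp: hecke_gens_def)
    then show "restrict HP.rep (carrier HP.A) (hecke_elem r \<epsilon> (Xinv_gen t)) (basis_vec i) = basis_vec (i[t - 1 := i ! (t - 1) + int n])"
      using is_hecke_action_rep * unfolding is_hecke_action_def by simp
  next
    fix k and i :: "int list" assume *: "k \<in> {1..<r}" "length i = r \<and> set i \<subseteq> {1..int n}"
    then have "hecke_elem r \<epsilon> (T_gen k) \<in> carrier HP.A"
      unfolding hecke_elem_eq by (intro HP.A_letter) (auto simp: hecke_gens_def)
    then show "restrict HP.rep (carrier HP.A) (hecke_elem r \<epsilon> (T_gen k)) (basis_vec i) = hecke_T_value \<epsilon> k i"
      using is_hecke_action_rep * unfolding is_hecke_action_def by simp
  qed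
  have "hecke_action n r \<epsilon> = ?h"
    unfolding hecke_action_def
  proof (rule the_equality)
    show "?h \<in> extensional (carrier (hecke_alg r \<epsilon>)) \<and> is_hecke_action n r \<epsilon> ?h"
      using is_restrict by simp
    fix h assume "h \<in> extensional (carrier (hecke_alg r \<epsilon>)) \<and> is_hecke_action n r \<epsilon> h"
    then show "h = ?h"
      using hecke_action_unique[of h] by (intro extensionalityI[of _ "carrier (hecke_alg r \<epsilon>)"]) auto
  qed
  then show ?thesis using x by simp
qed

text \<open>Linearity over the Hecke algebra can be tested on its generators, whose action is explicit.\<close>
lemma schur_carrier:
  "f \<in> carrier (schur_alg n r \<epsilon>) \<longleftrightarrow> f \<in> carrier (tensor_End r) \<and>
     (\<forall>g\<in>hecke_gens r. \<forall>v\<in>tensor_space r. f (hecke_op g v) = hecke_op g (f v))"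
proof -
  have "(\<forall>h\<in>carrier (hecke_alg r \<epsilon>). \<forall>v\<in>tensor_space r. f (hecke_action n r \<epsilon> h v) = hecke_action n r \<epsilon> h (f v)) \<longleftrightarrow>
     (\<forall>g\<in>hecke_gens r. \<forall>v\<in>tensor_space r. f (hecke_op g v) = hecke_op g (f v))" (is "?L \<longleftrightarrow> ?R")
    if f: "f \<in> carrier (tensor_End r)"
  proof
    assume L: ?L
    show ?R
    proof (intro ballI)
      fix g and v :: "int list \<Rightarrow>\<^sub>0 'k" assume g: "g \<in> hecke_gens r" and v: "v \<in> tensor_space r"
      have c: "HP.proj (letter g) \<in> carrier (hecke_alg r \<epsilon>)" using HP.A_letter[OF g] by (simp add: hecke_alg_eq)
      have "hecke_action n r \<epsilon> (HP.proj (letter g)) v = hecke_op g v" if "v \<in> tensor_space r" for v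
        using that hecke_action_rep[OF c] by (simp add: HP.rep_proj sp_words_letter g)
      then show "f (hecke_op g v) = hecke_op g (f v)"
        using L[rule_format, OF c v] v End_lin(3)[OF f v v] by simp
    qed
  next
    assume R: ?R
    show ?L
    proof (intro ballI)
      fix x and v :: "int list \<Rightarrow>\<^sub>0 'k" assume x: "x \<in> carrier (hecke_alg r \<epsilon>)" and v: "v \<in> tensor_space r"
      then obtain p where p: "p \<in> sp (words_in (hecke_gens r))" "x = HP.proj p" by (auto simp: hecke_alg_eq HP.A_carrier)
      have "\<forall>v\<in>tensor_space r. f (H.pact p v) = H.pact p (f v)"
        using p(1)
      proof (induction rule: HP.word_induct_sp)
        case zero
        have "f (0 \<cdot> 0) = 0 \<cdot> f 0" using End_lin(2)[OF f, of 0 0 0] by (simp add: ts_intro)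
        then show ?case by simp
      next
        case (add u v)
        then show ?case using End_lin(1)[OF f] by (simp add: HP.pact_ts)
      next
        case (scale c v)
        then show ?case using End_lin(2)[OF f] by (simp add: HP.pact_ts)
      next
        case (letter g v)
        then show ?case using R End_lin(3)[OF f] by (simp add: hecke_op_ts)
      qed simp
      then show "f (hecke_action n r \<epsilon> x v) = hecke_action n r \<epsilon> x (f v)"
        using v End_lin(3)[OF f v v] hecke_action_rep[OF x] by (simp add: p(2) HP.rep_proj[OF p(1)])
    qed
  qed
  then show ?thesis by (auto simp: schur_alg_def)
qed

end

section \<open>The action of quantum affine gl(n)\<close>

definition Kf :: "int \<Rightarrow> int \<Rightarrow> 'k" where "Kf i s = (if cong_n s i then \<epsilon> else 1)"
definition Kfi :: "int \<Rightarrow> int \<Rightarrow> 'k" where "Kfi i s = (if cong_n s i then inverse \<epsilon> else 1)"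

fun qop :: "qaff_gen \<Rightarrow> (int list \<Rightarrow>\<^sub>0 'k) \<Rightarrow> (int list \<Rightarrow>\<^sub>0 'k)" where
  "qop (E_gen i) = opE i"
| "qop (F_gen i) = opF i"
| "qop (K_gen i) = diag (Kf i)"
| "qop (Kinv_gen i) = diag (Kfi i)"
| "qop (Zp_gen m) = opZ (int m)"
| "qop (Zm_gen m) = opZ (- int m)"

lemma lin_qop: "lin (qop g)"
  by (cases g) (simp_all add: lin_ops)

lemmas qop_lin = lin_rules[OF lin_qop]

lemma qop_ts [simp]: "v \<in> tensor_space r \<Longrightarrow> qop g v \<in> tensor_space r"
  by (cases g) simp_all

lemma delta_mod_cong_n: "delta_mod n j s = (if cong_n s j then 1 else 0)"
  by (simp add: delta_mod_def cong_iff_dvd_diff cong_n_def dvd_diff_commute)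

lemma cong_n_next: "cong_n s (next_idx n i) = cong_n s (i + 1)"
  by (simp add: next_idx_def cong_n_mod)

lemma Kt_kv: "(\<lambda>s. Kf i s * Kfi (next_idx n i) s) = kv i" "(\<lambda>s. Kf (next_idx n i) s * Kfi i s) = (\<lambda>s. inverse (kv i s))"
  by (auto simp: fun_eq_iff Kf_def Kfi_def kv_def cong_n_next)

text \<open>Both sides follow the same recursion on the number of tensor factors, given by the comultiplication.\<close>
lemma tensor_value_eq: "v \<in> tensor_space r \<Longrightarrow> tensor_value n \<epsilon> r g v = qop g v"
proof (induction r arbitrary: g v)
  case 0
  have "lin (\<lambda>v. counit g \<cdot> v)" by (intro lin_intro)
  then show ?case
    unfolding tensor_value.simps
    by (rule lin_eq_on_sp[OF _ lin_qop _ "0"[unfolded tensor_space_eq_sp]]) (cases g; simp)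
next
  case (Suc r)
  have l: "lin (tensor_value n \<epsilon> (Suc r) g)" by (simp add: lin_def lin_rules[OF lin_linear_ext])
  show ?case
  proof (rule lin_eq_on_sp[OF l lin_qop _ Suc.prems[unfolded tensor_space_eq_sp]])
    fix i :: "int list" assume "length i = Suc r"
    then obtain s i' where i: "i = s # i'" "length i' = r" by (cases i) auto
    let ?v = "basis_vec i' :: int list \<Rightarrow>\<^sub>0 'k"
    have v: "?v \<in> tensor_space r" using i by (simp add: tensor_space_eq_sp)
    note tc = lin_scale[OF lin_tensor_Cons_left] tensor_Cons_basis
    have K: "tensor_value n \<epsilon> r (K_gen j) (diag (Kfi (next_idx n j)) ?v) = diag (kv j) ?v" for j
      using Suc.IH[of "diag (Kfi (next_idx n j)) ?v" "K_gen j"] v by (simp add: Kt_kv)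
    have expand: "tensor_value n \<epsilon> (Suc r) g (basis_vec i) = (\<Sum>(a, b)\<leftarrow>comult n g.
        tensor_Cons (foldr (\<lambda>x. linear_ext (omega_value n \<epsilon> x)) a (basis_vec s)) (foldr (tensor_value n \<epsilon> r) b ?v))"
      by (simp add: i(1))
    show "tensor_value n \<epsilon> (Suc r) g (basis_vec i) = qop g (basis_vec i)"
      unfolding expand unfolding i(1)
      using Suc.IH[OF v]
      by (cases g) (auto simp: tc K delta_mod_cong_n Kf_def Kfi_def kv_def cong_n_next lin_rules(2)[OF lin_linear_ext] simp flip: cns_basis
         simp del: diag_diag)
  qed
qed

sublocale Q: word_action False qop
  by unfold_locales (rule lin_qop)

lemma Q_mult [simp]: "Q.pact (p * q) v = Q.pact p (Q.pact q v)"
  using Q.pact_mult[of p q v] by simp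

lemma qaff_rels_in: "qaff_rels n \<epsilon> \<subseteq> sp (words_in (qaff_gens n))"
proof -
  have pw: "p ^ m \<in> sp (words_in G)" if "p \<in> sp (words_in G)" for p :: "qaff_gen word \<Rightarrow>\<^sub>0 'k" and G m
    by (induction m) (auto intro: that sp_words_mult sp_words_one)
  have nx: "next_idx n i \<in> {0..<int n}" for i using n_ge_2 by (simp add: next_idx_def)
  show ?thesis
    unfolding qaff_rels_def Let_def serre_expr_def
    by (safe; intro sp_diff sp_add sp_scale sp_sum sp_words_mult sp_words_one sp_words_letter pw)
      (use nx in \<open>auto simp: qaff_gens_def\<close>)
qed

lemma q_int_nonzero: "m \<ge> 1 \<Longrightarrow> q_int \<epsilon> m \<noteq> 0"
proof
  assume m: "m \<ge> 1" and "q_int \<epsilon> m = 0"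
  then have "\<epsilon> ^ m = inverse \<epsilon> ^ m" using eps_sq by (simp add: q_int_def)
  then have "\<epsilon> ^ m * \<epsilon> ^ m = \<epsilon> ^ m * inverse (\<epsilon> ^ m)" by (simp add: power_inverse)
  then have "\<epsilon> ^ m * \<epsilon> ^ m = 1" using eps_nonzero by simp
  then have "\<epsilon> ^ (m + m) = 1" by (simp add: power_add)
  then show False using eps_not_root[of "m + m"] m by simp
qed

lemma q_fact_nonzero: "q_fact \<epsilon> m \<noteq> 0"
  by (simp add: q_fact_def q_int_nonzero)

lemma q_int_values: "q_int \<epsilon> 1 = 1" "q_int \<epsilon> 2 = \<epsilon> + inverse \<epsilon>" "q_int \<epsilon> 3 = \<epsilon>^2 + 1 + inverse \<epsilon>^2"
proof -
  have d: "\<epsilon> - inverse \<epsilon> \<noteq> 0" by (rule eps_sq)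
  show "q_int \<epsilon> 1 = 1" using d by (simp add: q_int_def)
  have "\<epsilon>^2 - inverse \<epsilon>^2 = (\<epsilon> + inverse \<epsilon>) * (\<epsilon> - inverse \<epsilon>)" by (simp add: algebra_simps power2_eq_square)
  then show "q_int \<epsilon> 2 = \<epsilon> + inverse \<epsilon>" using d by (simp add: q_int_def)
  have "\<epsilon>^3 - inverse \<epsilon>^3 = (\<epsilon>^2 + 1 + inverse \<epsilon>^2) * (\<epsilon> - inverse \<epsilon>)" by (simp add: algebra_simps power2_eq_square power3_eq_cube)
  then show "q_int \<epsilon> 3 = \<epsilon>^2 + 1 + inverse \<epsilon>^2" using d by (simp add: q_int_def)
qed

lemma q_fact_Suc: "q_fact \<epsilon> 0 = 1" "q_fact \<epsilon> (Suc m) = q_fact \<epsilon> m * q_int \<epsilon> (Suc m)"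
  by (simp_all add: q_fact_def prod.nat_ivl_Suc' mult.commute)

lemma q_binom_ends: "q_binom \<epsilon> m 0 = 1" "q_binom \<epsilon> m m = 1"
  using q_fact_nonzero[of m] by (simp_all add: q_binom_def q_fact_Suc)

lemma q_binom_values: "q_binom \<epsilon> 2 1 = \<epsilon> + inverse \<epsilon>" "q_binom \<epsilon> 3 1 = \<epsilon>^2 + 1 + inverse \<epsilon>^2" "q_binom \<epsilon> 3 2 = \<epsilon>^2 + 1 + inverse \<epsilon>^2"
proof -
  have f: "q_fact \<epsilon> 1 = 1" "q_fact \<epsilon> 2 = q_int \<epsilon> 2" "q_fact \<epsilon> 3 = q_int \<epsilon> 2 * q_int \<epsilon> 3"
    using q_fact_Suc(2)[of 0] q_fact_Suc(2)[of 1] q_fact_Suc(2)[of 2] q_int_values(1)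
    by (simp_all add: q_fact_Suc(1) numeral_2_eq_2 numeral_3_eq_3)
  show "q_binom \<epsilon> 2 1 = \<epsilon> + inverse \<epsilon>" "q_binom \<epsilon> 3 1 = \<epsilon>^2 + 1 + inverse \<epsilon>^2" "q_binom \<epsilon> 3 2 = \<epsilon>^2 + 1 + inverse \<epsilon>^2"
    using q_int_nonzero[of 2] f by (simp_all add: q_binom_def q_int_values)
qed

lemma serre_action:
  fixes x y :: qaff_gen
  defines "X \<equiv> qop x" and "Y \<equiv> qop y"
  shows "Q.pact (serre_expr \<epsilon> 1 (letter x) (letter y)) v = Y (X v) - X (Y v)"
    "Q.pact (serre_expr \<epsilon> 2 (letter x) (letter y)) v = Y (X (X v)) - (\<epsilon> + inverse \<epsilon>) \<cdot> X (Y (X v)) + X (X (Y v))"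
    "Q.pact (serre_expr \<epsilon> 3 (letter x) (letter y)) v = Y (X (X (X v))) - (\<epsilon>^2 + 1 + inverse \<epsilon>^2) \<cdot> X (Y (X (X v)))
      + (\<epsilon>^2 + 1 + inverse \<epsilon>^2) \<cdot> X (X (Y (X v))) - X (X (X (Y v)))"
proof -
  have s: "{..1::nat} = {0, 1}" "{..2::nat} = {0, 1, 2}" "{..3::nat} = {0, 1, 2, 3}" by auto
  show "Q.pact (serre_expr \<epsilon> 1 (letter x) (letter y)) v = Y (X v) - X (Y v)"
    "Q.pact (serre_expr \<epsilon> 2 (letter x) (letter y)) v = Y (X (X v)) - (\<epsilon> + inverse \<epsilon>) \<cdot> X (Y (X v)) + X (X (Y v))"
    "Q.pact (serre_expr \<epsilon> 3 (letter x) (letter y)) v = Y (X (X (X v))) - (\<epsilon>^2 + 1 + inverse \<epsilon>^2) \<cdot> X (Y (X (X v)))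
      + (\<epsilon>^2 + 1 + inverse \<epsilon>^2) \<cdot> X (X (Y (X v))) - X (X (X (Y v)))"
    unfolding serre_expr_def s
    by (simp_all add: q_binom_ends q_binom_values q_binom_values[simplified] qop_lin power2_eq_square power3_eq_cube X_def Y_def algebra_simps pm_scale_distrib numeral_2_eq_2[symmetric])
qed

lemma Kf_values: "Kf i s * Kfi i s = 1" "Kf i s * Kfi (next_idx n i) s = kv i s"
    "Kf (next_idx n i) s * Kfi i s = inverse (kv i s)"
  using fun_cong[OF Kt_kv(1)] fun_cong[OF Kt_kv(2)] by (auto simp: Kf_def Kfi_def)

lemma Kf_shift: "Kf i (s - m * int n) = Kf i s" "Kfi i (s - m * int n) = Kfi i s"
  by (simp_all add: Kf_def Kfi_def)

lemma K_E: "diag (Kf i) (opE j v) = (\<epsilon> powi (delta_mod n i j - delta_mod n i (j + 1))) \<cdot> opE j (diag (Kf i) v)"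
proof (rule E_diag)
  fix s assume s: "cong_n s (j + 1)"
  have "cong_n s i = cong_n (j + 1) i" "cong_n (s - 1) i = cong_n j i"
    using cong_n_cong0[OF s, of i] cong_n_cong_minus[OF s, of 1 i] by simp_all
  then show "Kf i (s - 1) = \<epsilon> powi (delta_mod n i j - delta_mod n i (j + 1)) * Kf i s"
    by (simp add: Kf_def delta_mod_cong_n)
qed

lemma K_F: "diag (Kf i) (opF j v) = (\<epsilon> powi (- delta_mod n i j + delta_mod n i (j + 1))) \<cdot> opF j (diag (Kf i) v)"
proof (rule F_diag)
  fix s assume s: "cong_n s j"
  have "cong_n s i = cong_n j i" "cong_n (s + 1) i = cong_n (j + 1) i"
    using cong_n_cong0[OF s, of i] cong_n_cong[OF s, of 1 i] by simp_all
  then show "Kf i (s + 1) = \<epsilon> powi (- delta_mod n i j + delta_mod n i (j + 1)) * Kf i s"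
    by (simp add: Kf_def delta_mod_cong_n)
qed

lemma Z_central: "opZ m (qop g v) = qop g (opZ m v)"
  by (cases g) (simp_all add: Z_E Z_F Z_Z[of m] Z_diag Kf_shift)

text \<open>The off-diagonal Cartan entries and what they mean for the residues. For \<open>n = 2\<close> the two neighbours of \<open>i\<close> coincide, which
gives the entry \<open>- 2\<close>.\<close>
lemma serre_cases:
  assumes "i \<in> {0..<int n}" "j \<in> {0..<int n}" "i \<noteq> j"
  obtains "cartan n i j = 0" "\<not> cong_n i j" "\<not> cong_n i (j + 1)" "\<not> cong_n (i + 1) j"
    | j' where "cartan n i j = - 1" "n \<ge> 3" "cong_n j j'" "j' = i + 1 \<or> i = j' + 1"
    | "cartan n i j = - 2" "n = 2" "cong_n j (i + 1)"
proof -
  have small: "\<not> int n dvd d" if "d \<noteq> 0" "- int n < d" "d < int n" for d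
    using that not_dvd_between[of d] by (cases "d > 0") auto
  have ij: "\<not> cong_n i j" "\<not> cong_n j i"
    unfolding cong_n_def using assms small[of "i - j"] small[of "j - i"] by simp_all
  have c: "cartan n i j = (if cong_n i (j + 1) then - 1 else 0) + (if cong_n (i + 1) j then - 1 else 0)"
    using ij by (simp add: cartan_def delta_mod_cong_n cong_n_sym[of "j + 1"] cong_n_sym[of j "i + 1"])
  show ?thesis
  proof (cases "n = 2")
    case True
    then have "i = 0 \<and> j = 1 \<or> i = 1 \<and> j = 0" using assms by auto
    then have "cong_n i (j + 1)" "cong_n (i + 1) j" "cong_n j (i + 1)" unfolding cong_n_def using True by auto
    then show ?thesis using that(3) True c by simp
  next
    case False
    then have n3: "n \<ge> 3" using n_ge_2 by simp
    have "\<not> (cong_n i (j + 1) \<and> cong_n (i + 1) j)"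
    proof
      assume h: "cong_n i (j + 1) \<and> cong_n (i + 1) j"
      then have "int n dvd (i + 1 - j) - (i - (j + 1))" by (intro dvd_diff[of _ "i + 1 - j"]) (simp_all only: cong_n_def)
      then show False using not_dvd_small(3)[OF n3] by (simp add: algebra_simps)
    qed
    moreover have "cong_n j (i - 1)" if "cong_n i (j + 1)"
      using cong_n_cong_minus[OF that, of 1 j] cong_n_sym[of j "i - 1"] by simp
    moreover have "cong_n j (i + 1)" if "cong_n (i + 1) j" using that cong_n_sym by blast
    ultimately show ?thesis using that(1) that(2)[of "i + 1"] that(2)[of "i - 1"] n3 ij c by (auto split: if_splits)
  qed
qed

text \<open>The argument is the same for the \<open>E\<close>'s and the \<open>F\<close>'s, so it is given for a family \<open>op\<close> with the three kinds of Serre relations.\<close>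
lemma serre_zero:
  fixes g :: "int \<Rightarrow> qaff_gen" and op :: "int \<Rightarrow> (int list \<Rightarrow>\<^sub>0 'k) \<Rightarrow> (int list \<Rightarrow>\<^sub>0 'k)"
  defines "b \<equiv> \<epsilon>^2 + 1 + inverse \<epsilon>^2"
  assumes g: "\<And>i. qop (g i) = op i" and cong: "\<And>i j. cong_n i j \<Longrightarrow> op i = op j"
    and far: "\<And>i j v. \<not> cong_n i j \<Longrightarrow> \<not> cong_n i (j + 1) \<Longrightarrow> \<not> cong_n (i + 1) j \<Longrightarrow> op i (op j v) = op j (op i v)"
    and s2: "\<And>i j v. n \<ge> 3 \<Longrightarrow> j = i + 1 \<or> i = j + 1 \<Longrightarrow>
      op i (op i (op j v)) + op j (op i (op i v)) = (\<epsilon> + inverse \<epsilon>) \<cdot> op i (op j (op i v))"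
    and s3: "\<And>i j v. n = 2 \<Longrightarrow> cong_n j (i + 1) \<Longrightarrow> op i (op i (op i (op j v))) + b \<cdot> op i (op j (op i (op i v)))
      = b \<cdot> op i (op i (op j (op i v))) + op j (op i (op i (op i v)))"
    and ij: "i \<in> {0..<int n}" "j \<in> {0..<int n}" "i \<noteq> j"
  shows "Q.pact (serre_expr \<epsilon> (nat (1 - cartan n i j)) (letter (g i)) (letter (g j))) v = 0"
proof (cases rule: serre_cases[OF ij])
  case 1
  then show ?thesis using serre_action(1)[of "g i" "g j" v] far[of i j v] by (simp add: g)
next
  case (2 j')
  have m: "nat (1 - cartan n i j) = 2" using 2(1) by simp
  show ?thesis
    unfolding m serre_action(2) g cong[OF 2(3)]
    using s2[OF 2(2,4), of v] by (simp add: algebra_simps)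
next
  case 3
  have m: "nat (1 - cartan n i j) = 3" using 3(1) by simp
  show ?thesis
    unfolding m serre_action(3) g b_def[symmetric]
    using s3[OF 3(2,3), of v] by (simp add: algebra_simps)
qed

lemma qaff_rels_zero:
  assumes "p \<in> qaff_rels n \<epsilon>"
  shows "Q.pact p v = 0"
proof -
  have E: "Q.pact (serre_expr \<epsilon> (nat (1 - cartan n i j)) (letter (E_gen i)) (letter (E_gen j))) v = 0"
    if "i \<in> {0..<int n}" "j \<in> {0..<int n}" "i \<noteq> j" for i j
    by (rule serre_zero[where op = opE and g = E_gen, OF _ opE_cong E_commute_far E_serre2 E_serre3 that]) simp_all
  have F: "Q.pact (serre_expr \<epsilon> (nat (1 - cartan n i j)) (letter (F_gen i)) (letter (F_gen j))) v = 0"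
    if "i \<in> {0..<int n}" "j \<in> {0..<int n}" "i \<noteq> j" for i j
    by (rule serre_zero[where op = opF and g = F_gen, OF _ opF_cong F_commute_far F_serre2 F_serre3 that]) simp_all
  have EF: "opE i (opF j v) - opF j (opE i v) - (of_int (delta_mod n i j) / (\<epsilon> - inverse \<epsilon>)) \<cdot>
      (diag (kv i) v - diag (\<lambda>s. inverse (kv i s)) v) = 0" for i j
    by (simp add: EF_relation delta_mod_cong_n cong_n_sym[of j])
  have Z: "qop z (qop g v) = qop g (qop z v)" if "z \<in> Zp_gen ` {1..} \<union> Zm_gen ` {1..}" for z g
    using that Z_central by auto
  have K: "qop g (qop h v) = qop h (qop g v)"
    if "g \<in> K_gen ` I \<union> Kinv_gen ` I" "h \<in> K_gen ` I \<union> Kinv_gen ` I" for g h I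
    using that by (auto simp: mult.commute)
  from assms show ?thesis
    unfolding qaff_rels_def Let_def
    apply (elim UnE; elim CollectE exE conjE)
    subgoal for g h using K[of g "{0..<int n}" h] by simp
    subgoal by (simp add: Kf_values)
    subgoal by (simp add: K_E)
    subgoal by (simp add: K_F)
    subgoal for i j using EF[of i j] by (simp add: Kf_values)
    subgoal for i j using E[of i j] by simp
    subgoal for i j using F[of i j] by simp
    subgoal for z g using Z[of z g] by simp
    done
qed

lemma qaff_presented_action: "presented_action (qaff_gens n) (qaff_rels n \<epsilon>) False qop r"
proof
  show "qaff_rels n \<epsilon> \<subseteq> sp (words_in (qaff_gens n))" by (rule qaff_rels_in)
qed (simp_all add: qaff_rels_zero)

lemma qop_hecke:
  assumes h: "h \<in> hecke_gens r" and v: "v \<in> tensor_space r"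
  shows "qop g (hecke_op h v) = hecke_op h (qop g v)"
proof -
  have X: "qop g (xop t (- int n) v) = xop t (- int n) (qop g v)" for t v
    using Kf_shift[of _ _ 1] by (cases g) (simp_all add: xop_E xop_F xop_diag xop_Z)
  have Xinv: "qop g (xop t (int n) v) = xop t (int n) (qop g v)" for t v
    using arg_cong[OF X[of t "xop t (int n) v"], of "xop t (int n)"] by simp
  have T: "qop g (opT (k - 1) v) = opT (k - 1) (qop g v)" if "k \<in> {1..<r}" for k
  proof -
    have l: "v \<in> longer (Suc (Suc (k - Suc 0)))" by (rule ts_longer[OF v]) (use that in simp)
    show ?thesis
      using Kf_shift[of _ _ 1] by (cases g) (simp_all add: E_T[OF l] F_T[OF l] diag_T[OF _ l] Z_T[OF l])
  qed
  show ?thesis using h X Xinv T by (auto simp: hecke_gens_def)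
qed

end

section \<open>Subalgebras generated by letters\<close>

lemma (in presentation) ring_A: "ring A"
proof (rule ringI)
  note simps = A_carrier A_ops A_consts sp_words_mult sp_words_one sp_add
  show "abelian_group A"
  proof (rule abelian_groupI)
    fix x assume "x \<in> carrier A"
    then obtain p where p: "p \<in> sp (words_in G)" "x = proj p" by (auto simp: A_carrier)
    show "\<exists>y\<in>carrier A. y \<oplus>\<^bsub>A\<^esub> x = \<zero>\<^bsub>A\<^esub>"
      by (rule bexI[of _ "proj (- p)"]) (use p in \<open>auto simp: simps sp_uminus\<close>)
  qed (auto simp: simps add_ac)
  show "monoid A" by (rule monoidI) (auto simp: simps mult.assoc)
qed (auto simp: A_carrier A_ops sp_words_mult sp_add distrib_left distrib_right)

text \<open>The generated subalgebra is the image of the free subalgebra on the same letters.\<close>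
lemma (in presentation) generated_subalg_letters:
  assumes S: "S \<subseteq> G"
  shows "generated_subalg A ((\<lambda>g. proj (letter g)) ` S) = proj ` sp (words_in S)"
proof
  have SG: "sp (words_in S) \<subseteq> (sp (words_in G) :: ('g word \<Rightarrow>\<^sub>0 'k) set)" using S by (auto simp: sp_def)
  interpret A: ring A by (rule ring_A)
  have "subring (proj ` sp (words_in S)) A"
  proof (rule A.subringI)
    show "proj ` sp (words_in S) \<subseteq> carrier A" using SG by (auto simp: A_carrier)
    show "\<one>\<^bsub>A\<^esub> \<in> proj ` sp (words_in S)" by (simp add: A_consts sp_words_one)
  next
    fix h assume "h \<in> proj ` sp (words_in S)"
    then obtain p where p: "p \<in> sp (words_in S)" "h = proj p" by auto
    have "proj p \<in> carrier A" "proj (- p) \<in> carrier A" using p SG by (auto simp: A_carrier)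
    moreover have "add A (proj (- p)) (proj p) = zero A" using p SG A_ops(2)[of "- p" p] by (auto simp: A_consts)
    ultimately have "\<ominus>\<^bsub>A\<^esub> h = proj (- p)" unfolding p by (intro A.minus_equality) auto
    then show "\<ominus>\<^bsub>A\<^esub> h \<in> proj ` sp (words_in S)" using p by auto
  next
    fix h1 h2 assume "h1 \<in> proj ` sp (words_in S)" "h2 \<in> proj ` sp (words_in S)"
    then obtain p q where p: "p \<in> sp (words_in S)" "h1 = proj p" "q \<in> sp (words_in S)" "h2 = proj q" by auto
    then have "p \<in> sp (words_in G)" "q \<in> sp (words_in G)" using SG by auto
    then show "h1 \<otimes>\<^bsub>A\<^esub> h2 \<in> proj ` sp (words_in S)" "h1 \<oplus>\<^bsub>A\<^esub> h2 \<in> proj ` sp (words_in S)"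
      unfolding p using p by (auto simp: A_ops sp_words_mult)
  qed
  moreover have "c \<odot>\<^bsub>A\<^esub> b \<in> proj ` sp (words_in S)" if "b \<in> proj ` sp (words_in S)" for b c
    using that by (auto simp: A_smult)
  moreover have "(\<lambda>g. proj (letter g)) ` S \<subseteq> proj ` sp (words_in S)" by (auto simp: sp_words_letter)
  ultimately show "generated_subalg A ((\<lambda>g. proj (letter g)) ` S) \<subseteq> proj ` sp (words_in S)"
    unfolding generated_subalg_def by (intro Inter_lower) simp
  interpret S: presentation S "{}" by standard simp
  show "proj ` sp (words_in S) \<subseteq> generated_subalg A ((\<lambda>g. proj (letter g)) ` S)"
    unfolding generated_subalg_def
  proof (rule Inter_greatest, clarify)
    fix B and p :: "'g word \<Rightarrow>\<^sub>0 'k"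
    assume B: "subring B A" "\<forall>c. \<forall>b\<in>B. c \<odot>\<^bsub>A\<^esub> b \<in> B" "(\<lambda>g. proj (letter g)) ` S \<subseteq> B" and p: "p \<in> sp (words_in S)"
    from p show "proj p \<in> B"
    proof (induction rule: S.word_induct_sp)
      case zero then show ?case using subringE(2)[OF B(1)] by (simp add: A_consts)
    next
      case (add u v)
      then have "u \<in> sp (words_in G)" "v \<in> sp (words_in G)" using SG by auto
      then show ?case using subringE(7)[OF B(1) add(3,4)] by (simp add: A_ops)
    next
      case (scale c v) then show ?case using B(2) by (metis A_smult)
    next
      case one then show ?case using subringE(3)[OF B(1)] by (simp add: A_consts)
    next
      case (letter g v)
      then have "(letter g :: 'g word \<Rightarrow>\<^sub>0 'k) \<in> sp (words_in G)" "v \<in> sp (words_in G)" "proj (letter g) \<in> B"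
        using SG S B(3) by (auto intro: sp_words_letter)
      then show ?case using subringE(6)[OF B(1) _ letter(3), of "proj (letter g)"] by (simp add: A_ops)
    qed
  qed
qed

text \<open>Commutators are derivations in each argument, so centrality need only be required of letters.\<close>
lemma (in presentation) commutator_in_ideal:
  assumes S: "S \<subseteq> G" and comm: "\<And>z g. z \<in> S \<Longrightarrow> g \<in> G \<Longrightarrow> letter z * letter g - letter g * letter z \<in> I"
    and p: "p \<in> sp (words_in S)" and q: "q \<in> sp (words_in G)"
  shows "p * q - q * p \<in> I"
proof -
  have SG: "sp (words_in S) \<subseteq> (sp (words_in G) :: ('g word \<Rightarrow>\<^sub>0 'k) set)" using S by (auto simp: sp_def)
  have z: "letter z * q - q * letter z \<in> I" if "z \<in> S" "q \<in> sp (words_in G)" for z q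
    using that(2)
  proof (induction rule: word_induct_sp)
    case (add u v)
    have "letter z * (u + v) - (u + v) * letter z = (letter z * u - u * letter z) + (letter z * v - v * letter z)"
      by (simp add: algebra_simps)
    then show ?case using I_diff(1) add by metis
  next
    case (scale c v)
    have "letter z * (c \<cdot> v) - (c \<cdot> v) * letter z = c \<cdot> (letter z * v - v * letter z)"
      by (simp add: pm_scale_mult_left pm_scale_mult_right pm_scale_distrib)
    then show ?case using I_scale scale by metis
  next
    case (letter g v)
    have "letter z * (letter g * v) - letter g * v * letter z
        = (letter z * letter g - letter g * letter z) * v + letter g * (letter z * v - v * letter z)"
      by (simp add: algebra_simps)
    moreover have "(letter z * letter g - letter g * letter z) * v \<in> I"
      by (rule I_diff(2)) (use comm that letter in auto)
    moreover have "letter g * (letter z * v - v * letter z) \<in> I"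
      by (rule I_diff(3)) (use letter in \<open>auto intro: sp_words_letter\<close>)
    ultimately show ?case using I_diff(1) by metis
  qed (simp_all add: I_diff(4))
  interpret S: presentation S "{}" by standard simp
  from p show ?thesis
  proof (induction rule: S.word_induct_sp)
    case (add u v)
    have "(u + v) * q - q * (u + v) = (u * q - q * u) + (v * q - q * v)" by (simp add: algebra_simps)
    then show ?case using I_diff(1) add by metis
  next
    case (scale c v)
    have "(c \<cdot> v) * q - q * (c \<cdot> v) = c \<cdot> (v * q - q * v)"
      by (simp add: pm_scale_mult_left pm_scale_mult_right pm_scale_distrib)
    then show ?case using I_scale scale by metis
  next
    case (letter g v)
    have "letter g * v * q - q * (letter g * v) = letter g * (v * q - q * v) + (letter g * q - q * letter g) * v"
      by (simp add: algebra_simps)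
    moreover have "letter g * (v * q - q * v) \<in> I"
      by (rule I_diff(3)) (use letter S in \<open>auto intro: sp_words_letter\<close>)
    moreover have "(letter g * q - q * letter g) * v \<in> I"
      by (rule I_diff(2)[OF z[OF letter(1) q]]) (use letter SG in auto)
    ultimately show ?case using I_diff(1) by metis
  qed (simp_all add: I_diff(4))
qed

section \<open>The homomorphism to the affine quantum Schur algebra\<close>

context affine_params begin

definition "zgens = Zp_gen ` {1..} \<union> Zm_gen ` {1..}"

lemma zgens_subset: "zgens \<subseteq> qaff_gens n"
  by (auto simp: zgens_def qaff_gens_def)

context
  fixes r :: nat
begin

interpretation QP: presented_action "qaff_gens n" "qaff_rels n \<epsilon>" False qop r
  by (rule qaff_presented_action)

lemma qaff_alg_eq: "qaff_alg n \<epsilon> = QP.A"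
  by (simp add: qaff_alg_def QP.A_def)

lemma qaff_elem_eq: "qaff_elem n \<epsilon> g = QP.proj (letter g)"
  by (simp add: qaff_elem_def QP.gen_eq)

lemma pact_hecke:
  assumes "p \<in> sp (words_in (qaff_gens n))" "h \<in> hecke_gens r" "v \<in> tensor_space r"
  shows "Q.pact p (hecke_op h v) = hecke_op h (Q.pact p v)"
proof -
  note hl = lin_rules[OF lin_hecke_op]
  from assms(1) show ?thesis
    by (induction rule: QP.word_induct_sp) (simp_all add: hl qop_hecke[OF assms(2)] QP.pact_ts assms(3))
qed

lemma schur_simps: "mult (schur_alg n r \<epsilon>) = mult (tensor_End r)" "add (schur_alg n r \<epsilon>) = add (tensor_End r)"
  "one (schur_alg n r \<epsilon>) = one (tensor_End r)" "smult (schur_alg n r \<epsilon>) = smult (tensor_End r)"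
  by (simp_all add: schur_alg_def)

lemma rep_schur: "x \<in> carrier QP.A \<Longrightarrow> QP.rep x \<in> carrier (schur_alg n r \<epsilon>)"
proof -
  assume x: "x \<in> carrier QP.A"
  then obtain p where p: "p \<in> sp (words_in (qaff_gens n))" "x = QP.proj p" by (auto simp: QP.A_carrier)
  show ?thesis
    using QP.rep_End[OF x] pact_hecke[OF p(1)] by (auto simp: schur_carrier p(2) QP.rep_proj[OF p(1)] hecke_op_ts)
qed

lemma rep_hom_schur: "QP.rep \<in> alg_hom QP.A (schur_alg n r \<epsilon>)"
  using QP.rep_hom rep_schur by (auto simp: alg_hom_def ring_hom_def schur_simps end_alg_def)

text \<open>The descended action has the characterizing properties of \<open>zeta\<close>, which determine it on generators and hence everywhere.\<close>
lemma zeta_rep: "zeta n r \<epsilon> = restrict QP.rep (carrier QP.A)"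
  unfolding zeta_def qaff_alg_eq qaff_elem_eq
proof (rule the_equality)
  have "QP.rep (QP.proj (letter g)) v = tensor_value n \<epsilon> r g v" if "g \<in> qaff_gens n" "v \<in> tensor_space r" for g v
    using that by (simp add: QP.rep_proj sp_words_letter tensor_value_eq)
  then show "restrict QP.rep (carrier QP.A) \<in> extensional (carrier QP.A) \<and>
      restrict QP.rep (carrier QP.A) \<in> alg_hom QP.A (schur_alg n r \<epsilon>) \<and>
      (\<forall>g\<in>qaff_gens n. \<forall>v\<in>tensor_space r. restrict QP.rep (carrier QP.A) (QP.proj (letter g)) v = tensor_value n \<epsilon> r g v)"
    using QP.hom_restrict[OF rep_hom_schur] QP.A_letter by auto
next
  fix z assume z: "z \<in> extensional (carrier QP.A) \<and> z \<in> alg_hom QP.A (schur_alg n r \<epsilon>) \<and>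
      (\<forall>g\<in>qaff_gens n. \<forall>v\<in>tensor_space r. z (QP.proj (letter g)) v = tensor_value n \<epsilon> r g v)"
  have "z (QP.proj (letter g)) = QP.rep (QP.proj (letter g))" if g: "g \<in> qaff_gens n" for g
  proof (rule End_eqI)
    have "z (QP.proj (letter g)) \<in> carrier (schur_alg n r \<epsilon>)"
      using z QP.A_letter[OF g] by (auto simp: alg_hom_def ring_hom_def)
    then show "z (QP.proj (letter g)) \<in> carrier (tensor_End r)" by (simp add: schur_carrier)
    show "QP.rep (QP.proj (letter g)) \<in> carrier (tensor_End r)" by (rule QP.rep_End[OF QP.A_letter[OF g]])
    fix i :: "int list" assume "length i = r"
    then have i: "(basis_vec i :: int list \<Rightarrow>\<^sub>0 'k) \<in> tensor_space r" by (simp add: tensor_space_eq_sp)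
    then show "z (QP.proj (letter g)) (basis_vec i) = QP.rep (QP.proj (letter g)) (basis_vec i)"
      using z g i by (simp add: QP.rep_proj sp_words_letter tensor_value_eq)
  qed
  then have "z x = QP.rep x" if "x \<in> carrier QP.A" for x
    using QP.hom_unique[OF _ rep_hom_schur _ that, of z] z by blast
  then show "z = restrict QP.rep (carrier QP.A)"
    using z by (intro extensionalityI[of _ "carrier QP.A"]) auto
qed

lemma zeta_image_central:
  "zeta n r \<epsilon> ` central_subalg n \<epsilon> = (\<lambda>p. \<lambda>v\<in>tensor_space r. Q.pact p v) ` sp (words_in zgens)"
proof -
  have z: "(\<lambda>m. qaff_elem n \<epsilon> (Zp_gen m)) ` {1..} \<union> (\<lambda>m. qaff_elem n \<epsilon> (Zm_gen m)) ` {1..} = (\<lambda>g. QP.proj (letter g)) ` zgens"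
    by (auto simp: zgens_def qaff_elem_eq)
  have "central_subalg n \<epsilon> = QP.proj ` sp (words_in zgens)"
    unfolding central_subalg_def z unfolding qaff_alg_eq by (rule QP.generated_subalg_letters[OF zgens_subset])
  moreover have "zeta n r \<epsilon> (QP.proj p) = (\<lambda>v\<in>tensor_space r. Q.pact p v)" if "p \<in> sp (words_in zgens)" for p
  proof -
    have "p \<in> sp (words_in (qaff_gens n))" using that zgens_subset by (auto simp: sp_def)
    then show ?thesis by (simp add: zeta_rep QP.A_carrier QP.rep_proj)
  qed
  ultimately show ?thesis by (simp add: image_image cong: image_cong)
qed

lemma central_subalg_central: "central_subalg n \<epsilon> \<subseteq> alg_center (qaff_alg n \<epsilon>)"
proof -
  have z: "(\<lambda>m. qaff_elem n \<epsilon> (Zp_gen m)) ` {1..} \<union> (\<lambda>m. qaff_elem n \<epsilon> (Zm_gen m)) ` {1..} = (\<lambda>g. QP.proj (letter g)) ` zgens"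
    by (auto simp: zgens_def qaff_elem_eq)
  have c: "central_subalg n \<epsilon> = QP.proj ` sp (words_in zgens)"
    unfolding central_subalg_def z unfolding qaff_alg_eq by (rule QP.generated_subalg_letters[OF zgens_subset])
  have I: "letter z * letter g - letter g * letter z \<in> QP.I" if "z \<in> zgens" "g \<in> qaff_gens n" for z g
  proof -
    have "letter z * letter g - letter g * letter z \<in> qaff_rels n \<epsilon>"
      unfolding qaff_rels_def Let_def zgens_def[symmetric] using that by blast
    then show ?thesis using QP.R_subset_I by blast
  qed
  show ?thesis unfolding c alg_center_def qaff_alg_eq
  proof (intro subsetI CollectI conjI ballI; elim imageE)
    fix x and p :: "qaff_gen word \<Rightarrow>\<^sub>0 'k" assume x: "x = QP.proj p" and p: "p \<in> sp (words_in zgens)"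
    then have p': "p \<in> sp (words_in (qaff_gens n))" using zgens_subset by (auto simp: sp_def)
    then show "x \<in> carrier QP.A" by (simp add: x QP.A_carrier)
    fix y assume "y \<in> carrier QP.A"
    then obtain q where q: "q \<in> sp (words_in (qaff_gens n))" "y = QP.proj q" by (auto simp: QP.A_carrier)
    show "x \<otimes>\<^bsub>QP.A\<^esub> y = y \<otimes>\<^bsub>QP.A\<^esub> x"
      using QP.commutator_in_ideal[OF zgens_subset I p q(1)]
      unfolding x q(2) QP.A_ops(1)[OF p' q(1)] QP.A_ops(1)[OF q(1) p'] QP.proj_eq_iff .
  qed
qed

lemma zeta_letter:
  assumes "g \<in> qaff_gens n"
  shows "\<exists>x\<in>carrier (qaff_alg n \<epsilon>). zeta n r \<epsilon> x = (\<lambda>v\<in>tensor_space r. qop g v)"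
  by (rule bexI[of _ "QP.proj (letter g)"])
    (simp_all add: zeta_rep qaff_alg_eq QP.A_letter assms QP.rep_proj sp_words_letter)

lemma zeta_hom: "zeta n r \<epsilon> \<in> alg_hom (qaff_alg n \<epsilon>) (schur_alg n r \<epsilon>)"
  unfolding zeta_rep qaff_alg_eq by (rule QP.hom_restrict[OF rep_hom_schur])

lemma pact_ts: "v \<in> tensor_space r \<Longrightarrow> Q.pact p v \<in> tensor_space r"
  by (rule QP.pact_ts)

text \<open>A linear map that commutes with all \<open>z\<^sub>m\<close> commutes with the subalgebra that they generate.\<close>
lemma zgens_induct:
  assumes "p \<in> sp (words_in zgens)" "\<And>m v. v \<in> tensor_space r \<Longrightarrow> F (opZ m v) = opZ m (F v)"
    "\<And>u v. u \<in> tensor_space r \<Longrightarrow> v \<in> tensor_space r \<Longrightarrow> F (u + v) = F u + F v"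
    "\<And>c v. v \<in> tensor_space r \<Longrightarrow> F (c \<cdot> v) = c \<cdot> F v"
    and v: "v \<in> tensor_space r"
  shows "F (Q.pact p v) = Q.pact p (F v)"
proof -
  interpret S: presentation zgens "{} :: (qaff_gen word \<Rightarrow>\<^sub>0 'k) set" by standard simp
  from assms(1) show ?thesis
  proof (induction rule: S.word_induct_sp)
    case zero
    have "F (0 \<cdot> v) = 0 \<cdot> F v" using assms(4)[OF v] .
    then show ?case by simp
  next
    case (letter g w)
    then have "F (qop g v') = qop g (F v')" if "v' \<in> tensor_space r" for v'
      using assms(2)[OF that] by (auto simp: zgens_def)
    then show ?case using letter by (simp add: pact_ts v)
  qed (simp_all add: assms pact_ts)
qed

end

end

section \<open>Symmetric vectors\<close>

lemma lookup_linear_ext_inj: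
  fixes v :: "'a \<Rightarrow>\<^sub>0 'k::field"
  assumes "inj_on h (insert j (Poly_Mapping.keys v))"
  shows "Poly_Mapping.lookup (linear_ext (\<lambda>i. basis_vec (h i)) v) (h j) = Poly_Mapping.lookup v j"
proof -
  have "Poly_Mapping.lookup (linear_ext (\<lambda>i. basis_vec (h i)) v) (h j)
      = (\<Sum>i\<in>Poly_Mapping.keys v. if i = j then Poly_Mapping.lookup v i else 0)"
    unfolding linear_ext_def lookup_sum
    by (intro sum.cong) (use assms in \<open>auto simp: lookup_basis_vec inj_on_def\<close>)
  then show ?thesis by (simp add: sum.delta in_keys_iff)
qed

definition permute_op :: "(nat \<Rightarrow> nat) \<Rightarrow> (int list \<Rightarrow>\<^sub>0 'k::field) \<Rightarrow> (int list \<Rightarrow>\<^sub>0 'k)" where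
  "permute_op \<pi> = linear_ext (\<lambda>i. basis_vec (permute_list \<pi> i))"

definition symmetrize :: "nat \<Rightarrow> (int list \<Rightarrow>\<^sub>0 'k::field) \<Rightarrow> (int list \<Rightarrow>\<^sub>0 'k)" where
  "symmetrize r v = (\<Sum>\<pi> | \<pi> permutes {..<r}. permute_op \<pi> v)"

lemma lin_permute_op: "lin (permute_op \<pi>)"
  by (simp add: permute_op_def lin_linear_ext)

lemma lin_symmetrize: "lin (symmetrize r)"
  unfolding symmetrize_def by (intro lin_sumI lin_permute_op)

lemma symmetrize_basis: "symmetrize r (basis_vec i) = (\<Sum>\<pi> | \<pi> permutes {..<r}. basis_vec (permute_list \<pi> i))"
  by (simp add: symmetrize_def permute_op_def)

lemma symmetrize_mset:
  assumes "mset i = mset j"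
  shows "symmetrize (length j) (basis_vec i :: int list \<Rightarrow>\<^sub>0 'k::field) = symmetrize (length j) (basis_vec j)"
proof -
  obtain q where q: "q permutes {..<length j}" "permute_list q j = i"
    using mset_eq_permutation[OF assms] .
  have "symmetrize (length j) (basis_vec j :: int list \<Rightarrow>\<^sub>0 'k) = (\<Sum>\<pi> | \<pi> permutes {..<length j}. basis_vec (permute_list (q \<circ> \<pi>) j))"
    unfolding symmetrize_basis by (rule setum_permutations_compose_left[OF q(1)])
  also have "\<dots> = (\<Sum>\<pi> | \<pi> permutes {..<length j}. basis_vec (permute_list \<pi> i))"
    by (rule sum.cong) (auto simp: permute_list_compose q(2))
  finally show ?thesis by (simp add: symmetrize_basis)
qed

lemma sum_const_scale: "finite A \<Longrightarrow> (\<Sum>x\<in>A. v) = of_nat (card A) \<cdot> (v :: _ \<Rightarrow>\<^sub>0 'k::field)"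
  by (induction A rule: finite_induct) (simp_all add: pm_scale_distrib)

lemma permute_op_symmetric:
  fixes v :: "int list \<Rightarrow>\<^sub>0 'k::field"
  assumes v: "v \<in> tensor_space r" and \<pi>: "\<pi> permutes {..<r}"
    and sym: "\<And>i j. length i = r \<Longrightarrow> mset i = mset j \<Longrightarrow> Poly_Mapping.lookup v i = Poly_Mapping.lookup v j"
  shows "permute_op \<pi> v = v"
proof -
  have K: "length i = r" if "i \<in> Poly_Mapping.keys v" for i using v that by (simp add: tensor_space_def)
  have inv: "permute_list \<pi> (permute_list (inv_into UNIV \<pi>) i) = i" "permute_list (inv_into UNIV \<pi>) (permute_list \<pi> i) = i" if "length i = r" for i :: "int list"
    using permute_list_compose[of \<pi> i "inv_into UNIV \<pi>"] permute_list_compose[of "inv_into UNIV \<pi>" i \<pi>] that \<pi> permutes_inv[OF \<pi>]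
    by (simp_all add: permutes_inv_o[OF \<pi>])
  have ms: "mset (permute_list \<pi> i) = mset i" "mset (permute_list (inv_into UNIV \<pi>) i) = mset i" if "length i = r" for i :: "int list"
    using that \<pi> permutes_inv[OF \<pi>] by simp_all
  have keys: "i \<in> Poly_Mapping.keys v \<longleftrightarrow> j \<in> Poly_Mapping.keys v" if "length i = r" "mset i = mset j" for i j
    using sym[OF that] by (simp add: in_keys_iff)
  have "permute_op \<pi> v = (\<Sum>i\<in>Poly_Mapping.keys v. Poly_Mapping.lookup v i \<cdot> basis_vec (permute_list \<pi> i))"
    by (simp add: permute_op_def linear_ext_def)
  also have "\<dots> = (\<Sum>i\<in>Poly_Mapping.keys v. Poly_Mapping.lookup v i \<cdot> basis_vec i)"
  proof (rule sum.reindex_bij_witness[of _ "permute_list (inv_into UNIV \<pi>)" "permute_list \<pi>"])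
    fix i assume i: "i \<in> Poly_Mapping.keys v"
    note l = K[OF i]
    show "permute_list (inv_into UNIV \<pi>) (permute_list \<pi> i) = i" "permute_list \<pi> (permute_list (inv_into UNIV \<pi>) i) = i"
      using inv[OF l] by simp_all
    show "permute_list \<pi> i \<in> Poly_Mapping.keys v" "permute_list (inv_into UNIV \<pi>) i \<in> Poly_Mapping.keys v"
      using keys[OF l ms(1)[OF l, symmetric]] keys[OF l ms(2)[OF l, symmetric]] i by blast+
    show "Poly_Mapping.lookup v (permute_list \<pi> i) \<cdot> basis_vec (permute_list \<pi> i)
        = Poly_Mapping.lookup v i \<cdot> basis_vec (permute_list \<pi> i)"
      using sym[OF l ms(1)[OF l, symmetric]] by (simp only:)
  qed
  also have "\<dots> = v" by (rule sp_expansion[symmetric])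
  finally show ?thesis .
qed

text \<open>In characteristic \<open>0\<close> the factor is invertible, so every symmetric vector is a symmetrization.\<close>
lemma symmetrize_symmetric:
  fixes v :: "int list \<Rightarrow>\<^sub>0 'k::field_char_0"
  assumes "v \<in> tensor_space r"
    and "\<And>i j. length i = r \<Longrightarrow> mset i = mset j \<Longrightarrow> Poly_Mapping.lookup v i = Poly_Mapping.lookup v j"
  shows "symmetrize r v = fact r \<cdot> v"
proof -
  have "symmetrize r v = (\<Sum>\<pi> | \<pi> permutes {..<r}. v)"
    unfolding symmetrize_def by (rule sum.cong[OF refl]) (use permute_op_symmetric[OF assms(1) _ assms(2)] in auto)
  then show ?thesis by (simp add: sum_const_scale finite_permutations card_permutations)
qed

context affine_params begin

lemma Z_xop:
  assumes "v \<in> tensor_space r"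
  shows "opZ m v = (\<Sum>t<r. xop t (- m * int n) v)"
proof -
  have "opZ m (basis_vec i) = (\<Sum>t<length i. xop t (- m * int n) (basis_vec i))" for i
  proof (induction i)
    case (Cons s i)
    define c where "c = - m * int n"
    have "opZ m (cns s (basis_vec i)) = xop 0 c (cns s (basis_vec i)) + cns s (\<Sum>t<length i. xop t c (basis_vec i))"
      unfolding opZ_cns Cons by (simp add: c_def del: cns_basis)
    also have "\<dots> = (\<Sum>t<length (s # i). xop t c (cns s (basis_vec i)))"
      by (simp only: length_Cons sum.lessThan_Suc_shift xop_cns cns_lin)
    finally show ?case unfolding c_def cns_basis .
  qed simp
  moreover have "lin (\<lambda>v. \<Sum>t<r. xop t (- m * int n) v)" by (intro lin_sumI lin_ops(5))
  ultimately show ?thesis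
    using lin_eq_on_sp[OF lin_ops(4)[of m] _ _ assms[unfolded tensor_space_eq_sp], of "\<lambda>v. \<Sum>t<r. xop t (- m * int n) v"] by blast
qed

lemma xop_permute:
  assumes "length i = r" "\<pi> permutes {..<r}" "t < r"
  shows "xop t c (permute_op \<pi> (basis_vec i)) = permute_op \<pi> (xop (\<pi> t) c (basis_vec i))"
proof -
  have "(permute_list \<pi> i)[t := permute_list \<pi> i ! t + c] = permute_list \<pi> (i[\<pi> t := i ! \<pi> t + c])"
  proof (rule nth_equalityI)
    fix s assume "s < length ((permute_list \<pi> i)[t := permute_list \<pi> i ! t + c])"
    then have s: "s < r" using assms(1) by simp
    have "\<pi> s < r" "\<pi> t < r" using permutes_in_image[OF assms(2)] s assms(3) by auto
    moreover have "\<pi> t = \<pi> s \<longleftrightarrow> t = s" using permutes_inj[OF assms(2)] by (simp add: inj_eq)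
    ultimately show "(permute_list \<pi> i)[t := permute_list \<pi> i ! t + c] ! s = permute_list \<pi> (i[\<pi> t := i ! \<pi> t + c]) ! s"
      using assms s by (simp add: permute_list_nth nth_list_update)
  qed simp
  then show ?thesis by (simp add: permute_op_def xop_basis)
qed

text \<open>The power sum operator commutes with permutations of the tensor factors.\<close>
lemma Z_symmetrize:
  assumes "length i = r"
  shows "opZ m (symmetrize r (basis_vec i)) = (\<Sum>t<r. symmetrize r (basis_vec (i[t := i ! t - m * int n])))"
proof -
  have ts: "permute_op \<pi> (basis_vec i) \<in> tensor_space r" for \<pi>
    using assms by (simp add: permute_op_def tensor_space_eq_sp)
  have one: "opZ m (permute_op \<pi> (basis_vec i)) = (\<Sum>t<r. permute_op \<pi> (basis_vec (i[t := i ! t - m * int n])))"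
    if \<pi>: "\<pi> permutes {..<r}" for \<pi>
  proof -
    have "opZ m (permute_op \<pi> (basis_vec i)) = (\<Sum>t<r. permute_op \<pi> (xop (\<pi> t) (- m * int n) (basis_vec i)))"
      unfolding Z_xop[OF ts] by (rule sum.cong) (simp_all add: xop_permute[OF assms \<pi>])
    also have "\<dots> = (\<Sum>t<r. permute_op \<pi> (xop t (- m * int n) (basis_vec i)))"
      by (rule sum.reindex_bij_betw[OF permutes_imp_bij[OF \<pi>]])
    finally show ?thesis by (simp add: xop_basis)
  qed
  have "opZ m (symmetrize r (basis_vec i)) = (\<Sum>\<pi> | \<pi> permutes {..<r}. opZ m (permute_op \<pi> (basis_vec i)))"
    by (simp add: symmetrize_def)
  also have "\<dots> = (\<Sum>\<pi> | \<pi> permutes {..<r}. \<Sum>t<r. permute_op \<pi> (basis_vec (i[t := i ! t - m * int n])))"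
    by (rule sum.cong) (simp_all add: one)
  also have "\<dots> = (\<Sum>t<r. symmetrize r (basis_vec (i[t := i ! t - m * int n])))"
    unfolding symmetrize_def by (rule sum.swap)
  finally show ?thesis .
qed

text \<open>The image of \<open>\<omega>\<close> under the polynomials in the \<open>z\<^sub>m\<close>.\<close>
definition orbit :: "nat \<Rightarrow> (int list \<Rightarrow>\<^sub>0 'k) set" where
  "orbit r = {Q.pact p (basis_vec (replicate r 1)) | p. p \<in> sp (words_in zgens)}"

lemma orbit_closed:
  "u \<in> orbit r \<Longrightarrow> v \<in> orbit r \<Longrightarrow> u + v \<in> orbit r" "v \<in> orbit r \<Longrightarrow> c \<cdot> v \<in> orbit r" "0 \<in> orbit r"
  "basis_vec (replicate r 1) \<in> orbit r" "m \<noteq> 0 \<Longrightarrow> v \<in> orbit r \<Longrightarrow> opZ m v \<in> orbit r"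
proof -
  let ?w = "basis_vec (replicate r 1)"
  have I: "p \<in> sp (words_in zgens) \<Longrightarrow> Q.pact p ?w \<in> orbit r" for p by (auto simp: orbit_def)
  show "u \<in> orbit r \<Longrightarrow> v \<in> orbit r \<Longrightarrow> u + v \<in> orbit r"
  proof -
    assume "u \<in> orbit r" "v \<in> orbit r"
    then obtain p q where p: "p \<in> sp (words_in zgens)" "u = Q.pact p ?w" "q \<in> sp (words_in zgens)" "v = Q.pact q ?w"
      by (auto simp: orbit_def)
    then show ?thesis using I[of "p + q"] by auto
  qed
  show "0 \<in> orbit r" using I[of 0] by simp
  show "?w \<in> orbit r" using I[of 1] by (simp add: sp_words_one)
  assume "v \<in> orbit r"
  then obtain p where p: "p \<in> sp (words_in zgens)" "v = Q.pact p ?w" by (auto simp: orbit_def)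
  show "c \<cdot> v \<in> orbit r" using I[of "c \<cdot> p"] p by auto
  assume m: "m \<noteq> 0"
  define g where "g = (if m > 0 then Zp_gen (nat m) else Zm_gen (nat (- m)))"
  have "g \<in> zgens" "qop g = opZ m" using m by (auto simp: g_def zgens_def)
  then show "opZ m v \<in> orbit r" using I[of "letter g * p"] p by (simp add: sp_words_mult sp_words_letter)
qed

lemma orbit_sum: "(\<And>x. x \<in> A \<Longrightarrow> f x \<in> orbit r) \<Longrightarrow> sum f A \<in> orbit r"
  by (induction A rule: infinite_finite_induct) (auto intro: orbit_closed)

text \<open>Power sums generate the symmetric functions: induction on the number of entries different from \<open>1\<close>. Replace one such entry,
\<open>1 - m n\<close>, by \<open>1\<close> to get \<open>i'\<close>, and apply \<open>z\<^sub>m\<close> to the symmetrization of \<open>i'\<close>. The terms in which \<open>z\<^sub>m\<close> hits an entry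
\<open>1\<close> are permutations of \<open>i\<close>, so they give a positive multiple of the vector in question; in the other terms
there are at most as many entries different from \<open>1\<close> as in \<open>i'\<close>, hence fewer than in \<open>i\<close>.\<close>
lemma symmetrize_in_orbit:
  assumes "length i = r" "\<And>s. s \<in> set i \<Longrightarrow> cong_n s 1"
  shows "symmetrize r (basis_vec i :: int list \<Rightarrow>\<^sub>0 'k) \<in> orbit r"
  using assms
proof (induction "length (filter (\<lambda>s. s \<noteq> 1) i)" arbitrary: i rule: less_induct)
  case less
  show ?case
  proof (cases "\<exists>t<r. i ! t \<noteq> 1")
    case False
    then have i: "i = replicate r 1" using less(2) by (intro nth_equalityI) auto
    have "symmetrize r (basis_vec i :: int list \<Rightarrow>\<^sub>0 'k) = fact r \<cdot> basis_vec i"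
    proof (rule symmetrize_symmetric)
      fix j l :: "int list" assume *: "length j = r" "mset j = mset l"
      have rep: "x = i \<longleftrightarrow> (\<forall>s\<in>set x. s = 1)" if "length x = r" for x
        using replicate_length_same[of x 1] that unfolding i by (metis in_set_replicate)
      have "j = i \<longleftrightarrow> (\<forall>s\<in>set j. s = 1)" "l = i \<longleftrightarrow> (\<forall>s\<in>set l. s = 1)"
        using rep[of j] rep[of l] *(1) mset_eq_length[OF *(2)] by simp_all
      then have "j = i \<longleftrightarrow> l = i" using mset_eq_setD[OF *(2)] by simp
      then show "Poly_Mapping.lookup (basis_vec i :: int list \<Rightarrow>\<^sub>0 'k) j = Poly_Mapping.lookup (basis_vec i) l"
        by (auto simp: lookup_basis_vec)
    qed (simp add: i tensor_space_eq_sp)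
    then show ?thesis using orbit_closed(4)[of r] by (simp add: i orbit_closed)
  next
    case True
    then obtain t where t: "t < r" "i ! t \<noteq> 1" by blast
    have "cong_n (i ! t) 1" using less(2,3) t by simp
    then obtain k where "i ! t - 1 = int n * k" unfolding cong_n_def by (elim dvdE)
    then have "i ! t = 1 - (- k) * int n" by (simp add: algebra_simps)
    then obtain m where m: "i ! t = 1 - m * int n" by blast
    have m0: "m \<noteq> 0" using m t by auto
    define i' where "i' = i[t := 1]"
    have i': "length i' = r" "i = i'[t := 1 - m * int n]" "i' ! t = 1"
      using less(2) t by (simp_all add: i'_def flip: m)
    have eq': "cong_n s 1" if "s \<in> set i'" for s
      using that less(3) by (auto simp: i'_def dest!: set_update_subset_insert[THEN subsetD])
    define N where "N j = length (filter (\<lambda>s. s \<noteq> (1::int)) j)" for j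
    have N_app: "N (xs @ a # ys) = N xs + (if a = 1 then 0 else 1) + N ys" for xs a ys
      by (simp add: N_def)
    have upd: "N (j[l := a]) + (if j ! l = 1 then 0 else 1) = N j + (if a = 1 then 0 else 1)" if "l < length j" for j l a
      using N_app[of "take l j" a "drop (Suc l) j"] N_app[of "take l j" "j ! l" "drop (Suc l) j"]
      unfolding upd_conv_take_nth_drop[OF that] id_take_nth_drop[OF that, symmetric] by simp
    have Ni: "N i = Suc (N i')" using upd[of t i' "1 - m * int n"] i' t m by simp
    \<comment> \<open>The terms of \<open>z\<^sub>m\<close> applied to \<open>i'\<close>; those at positions in \<open>A\<close> are permutations of \<open>i\<close>.\<close>
    define J where "J l = i'[l := i' ! l - m * int n]" for l
    have J: "length (J l) = r" "\<And>s. s \<in> set (J l) \<Longrightarrow> cong_n s 1" if "l < r" for l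
    proof -
      show "length (J l) = r" by (simp add: J_def i')
      fix s assume "s \<in> set (J l)"
      moreover have "cong_n (i' ! l) 1" using eq' that i' by simp
      ultimately show "cong_n s 1" using eq'
        by (auto simp: J_def dest!: set_update_subset_insert[THEN subsetD])
    qed
    define A where "A = {l. l < r \<and> i' ! l = 1}"
    have A: "finite A" "t \<in> A" using t i' by (auto simp: A_def)
    have inA: "symmetrize r (basis_vec (J l)) = symmetrize r (basis_vec i :: int list \<Rightarrow>\<^sub>0 'k)" if "l \<in> A" for l
    proof -
      have l: "l < r" "i' ! l = 1" using that by (auto simp: A_def)
      have "mset (J l) = mset i" unfolding i'(2) J_def using l t i' by (simp add: mset_update)
      then show ?thesis using symmetrize_mset[of "J l" i] less(2) by simp
    qed
    have notA: "symmetrize r (basis_vec (J l) :: int list \<Rightarrow>\<^sub>0 'k) \<in> orbit r" if "l \<in> {..<r} - A" for l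
    proof -
      have l: "l < r" "i' ! l \<noteq> 1" using that by (auto simp: A_def)
      have "N (J l) < N i" using upd[of l i' "i' ! l - m * int n"] l i' Ni by (auto simp: J_def split: if_splits)
      then show ?thesis using less(1)[of "J l"] J[OF l(1)] by (simp add: N_def)
    qed
    have "symmetrize r (basis_vec i' :: int list \<Rightarrow>\<^sub>0 'k) \<in> orbit r"
      using less(1)[of i'] Ni eq' i' by (simp add: N_def)
    then have Zo: "opZ m (symmetrize r (basis_vec i')) \<in> orbit r" by (rule orbit_closed(5)[OF m0])
    have Z: "opZ m (symmetrize r (basis_vec i')) = (\<Sum>l<r. symmetrize r (basis_vec (J l)))"
      unfolding J_def by (rule Z_symmetrize) (simp add: i')
    have split: "(\<Sum>l<r. symmetrize r (basis_vec (J l)) :: int list \<Rightarrow>\<^sub>0 'k)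
        = (\<Sum>l\<in>{..<r} - A. symmetrize r (basis_vec (J l))) + (\<Sum>l\<in>A. symmetrize r (basis_vec (J l)))"
      by (rule sum.subset_diff) (auto simp: A_def)
    have onA: "(\<Sum>l\<in>A. symmetrize r (basis_vec (J l)) :: int list \<Rightarrow>\<^sub>0 'k) = of_nat (card A) \<cdot> symmetrize r (basis_vec i)"
      using A by (simp add: inA sum_const_scale)
    define rest :: "int list \<Rightarrow>\<^sub>0 'k" where "rest = (\<Sum>l\<in>{..<r} - A. symmetrize r (basis_vec (J l)))"
    have rest: "rest \<in> orbit r" unfolding rest_def by (rule orbit_sum[OF notA])
    have eq: "of_nat (card A) \<cdot> symmetrize r (basis_vec i :: int list \<Rightarrow>\<^sub>0 'k)
        = opZ m (symmetrize r (basis_vec i')) + (- 1) \<cdot> rest"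
      unfolding Z split onA rest_def by simp
    have "of_nat (card A) \<cdot> symmetrize r (basis_vec i :: int list \<Rightarrow>\<^sub>0 'k) \<in> orbit r"
      unfolding eq by (rule orbit_closed(1)[OF Zo orbit_closed(2)[OF rest]])
    then have "inverse (of_nat (card A)) \<cdot> of_nat (card A) \<cdot> symmetrize r (basis_vec i :: int list \<Rightarrow>\<^sub>0 'k) \<in> orbit r"
      by (rule orbit_closed(2))
    moreover have "of_nat (card A) \<noteq> (0 :: 'k)" using A by auto
    ultimately show ?thesis by simp
  qed
qed

lemma symmetric_in_orbit:
  assumes v: "v \<in> tensor_space r" and supp: "v \<in> sp (\<lambda>i. length i = r \<and> (\<forall>s\<in>set i. cong_n s 1))"
    and sym: "\<And>i j. length i = r \<Longrightarrow> mset i = mset j \<Longrightarrow> Poly_Mapping.lookup v i = Poly_Mapping.lookup v j"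
  shows "v \<in> orbit r"
proof -
  have "symmetrize r v \<in> orbit r"
    using supp
    by (induction rule: sp_induct) (auto simp: lin_rules[OF lin_symmetrize] orbit_closed symmetrize_in_orbit)
  then have "inverse (fact r) \<cdot> symmetrize r v \<in> orbit r" by (rule orbit_closed(2))
  then show ?thesis by (simp add: symmetrize_symmetric[OF v sym])
qed

section \<open>Operators commuting with both actions\<close>

lemma lookup_xop:
  "Poly_Mapping.lookup (xop t c v) (i[t := i ! t + c]) = Poly_Mapping.lookup v i"
proof -
  have "inj_on (\<lambda>i. i[t := i ! t + c]) A" for A :: "int list set"
  proof (rule inj_on_inverseI)
    show "(i[t := i ! t + c])[t := i[t := i ! t + c] ! t - c] = i" for i :: "int list"
      by (cases "t < length i") (simp_all add: list_update_beyond)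
  qed
  then show ?thesis unfolding xop_def by (rule lookup_linear_ext_inj)
qed

lemma lookup_diag: "Poly_Mapping.lookup (diag c v) i = prod_list (map c i) * Poly_Mapping.lookup v i"
proof -
  have "v \<in> sp (\<lambda>i. True)" by simp
  then show ?thesis
    by (induction rule: sp_induct) (auto simp: diag_basis lookup_add lookup_basis_vec algebra_simps)
qed

text \<open>A nonzero finitely supported vector is not an eigenvector of the lattice shift \<open>X\<^sub>k\<^sup>-\<^sup>1 X\<^bsub>k+1\<^esub>\<close>: look at a tuple in
the support whose entry at \<open>k\<close> is maximal.\<close>
lemma shift_eigenvector_zero:
  assumes d: "d \<in> tensor_space r" "Suc k < r"
    and eig: "xop (Suc k) (- int n) d = c \<cdot> xop k (- int n) d"
  shows "d = 0"
proof (rule ccontr)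
  assume "d \<noteq> 0"
  define M where "M = Max ((\<lambda>i. i ! k) ` Poly_Mapping.keys d)"
  have "M \<in> (\<lambda>i. i ! k) ` Poly_Mapping.keys d"
    unfolding M_def using \<open>d \<noteq> 0\<close> by (intro Max_in) auto
  then obtain i where i: "i \<in> Poly_Mapping.keys d" "i ! k = M" by auto
  have len: "length i = r" using i d by (auto simp: tensor_space_def)
  define j where "j = i[Suc k := i ! Suc k + - int n]"
  define l where "l = j[k := j ! k + int n]"
  have len_j: "length j = r" using len by (simp add: j_def)
  have j: "j = l[k := l ! k + - int n]" "l ! k = M + int n"
    using len_j d by (simp add: l_def) (use len d i(2) in \<open>simp add: l_def j_def\<close>)
  have "Poly_Mapping.lookup (xop (Suc k) (- int n) d) j \<noteq> 0"
    unfolding j_def lookup_xop using i by (simp add: in_keys_iff)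
  then have "Poly_Mapping.lookup (xop k (- int n) d) j \<noteq> 0" unfolding eig by auto
  then have "Poly_Mapping.lookup d l \<noteq> 0" unfolding j(1) lookup_xop .
  then have "l ! k \<le> M" unfolding M_def by (intro Max_ge) (auto simp: in_keys_iff)
  then show False using j(2) n_ge_2 by simp
qed

text \<open>The Bernstein relations for all positions at once.\<close>
lemma T_shift:
  assumes "v \<in> tensor_space r" "Suc k < r" "t < r"
  shows "opT k (xop t (- int n) v) = xop (transpose k (Suc k) t) (- int n) (opT k v)
    + (if t = k then - ((\<epsilon>^2 - 1) \<cdot> xop (Suc k) (- int n) v) else if t = Suc k then (\<epsilon>^2 - 1) \<cdot> xop (Suc k) (- int n) v else 0)"
proof -
  have l: "v \<in> longer (Suc (Suc k))" by (rule ts_longer[OF assms(1)]) (use assms in simp)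
  consider "t = k" | "t = Suc k" | "t < k" | "t > Suc k" by linarith
  then show ?thesis
  proof cases
    case 1 then show ?thesis using T_x[OF l] by simp
  next
    case 2 then show ?thesis using T_y[OF l] by simp
  next
    case 3
    then have eq: "k = Suc (t + (k - Suc t))" by simp
    have "opT k (xop t (- int n) v) = xop t (- int n) (opT k v)"
      by (subst (1 2) eq) (rule T_x_left[OF ts_longer[OF assms(1)]], use assms in simp)
    then show ?thesis using 3 by simp
  next
    case 4
    then have eq: "t = Suc (Suc (k + (t - Suc (Suc k))))" by simp
    have "opT k (xop t (- int n) v) = xop t (- int n) (opT k v)"
      by (subst (1 2) eq) (rule T_x_right[OF l])
    then show ?thesis using 4 by simp
  qed
qed

lemma permute_shift:
  assumes v: "v \<in> tensor_space r" and k: "Suc k < r" "t < r"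
  shows "permute_op (transpose k (Suc k)) (xop t c v) = xop (transpose k (Suc k) t) c (permute_op (transpose k (Suc k)) v)"
proof (rule lin_eq_on_sp[OF lin_compose[OF lin_permute_op lin_ops(5)] lin_compose[OF lin_ops(5) lin_permute_op] _ v[unfolded tensor_space_eq_sp]])
  fix i :: "int list" assume i: "length i = r"
  have p: "transpose k (Suc k) permutes {..<r}" using k by (intro permutes_swap_id) auto
  have "transpose k (Suc k) t < r" using k by (auto simp: transpose_def)
  from xop_permute[OF i p this, of c]
  show "permute_op (transpose k (Suc k)) (xop t c (basis_vec i))
    = xop (transpose k (Suc k) t) c (permute_op (transpose k (Suc k)) (basis_vec i))" by simp
qed

lemma base_ones: "length i = r \<Longrightarrow> set i \<subseteq> {1..int n} \<Longrightarrow> \<forall>s\<in>set i. cong_n s 1 \<Longrightarrow> i = replicate r 1"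
proof -
  assume i: "length i = r" "set i \<subseteq> {1..int n}" "\<forall>s\<in>set i. cong_n s 1"
  have "s = 1" if "s \<in> set i" for s
  proof (rule ccontr)
    assume "s \<noteq> 1"
    then have "0 < s - 1" "s - 1 < int n" using i(2) that by auto
    then show False using not_dvd_between(1)[of "s - 1"] i(3) that unfolding cong_n_def by blast
  qed
  then show ?thesis using replicate_length_same[of i 1] i(1) by simp
qed

lemma T_ones: "Suc k < r \<Longrightarrow> opT k (basis_vec (replicate r 1)) = \<epsilon>^2 \<cdot> basis_vec (replicate r 1)"
proof -
  assume k: "Suc k < r"
  have eq: "replicate r 1 = replicate k 1 @ (1::int) # 1 # replicate (r - Suc (Suc k)) 1"
    using k by (simp flip: replicate_Suc replicate_add)
  show ?thesis
    using T_at[of 1 1 "replicate k 1" "replicate (r - Suc (Suc k)) 1"] n_ge_2 unfolding eq by simp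
qed

lemma permute_ones:
  assumes "Suc k < r"
  shows "permute_op (transpose k (Suc k)) (basis_vec (replicate r 1)) = basis_vec (replicate r 1)"
proof -
  have p: "transpose k (Suc k) permutes {..<length (replicate r (1::int))}" using assms by (intro permutes_swap_id) auto
  have "permute_list (transpose k (Suc k)) (replicate r (1::int)) = replicate r 1"
    by (rule nth_equalityI) (use permutes_in_image[OF p] in \<open>auto simp: permute_list_nth[OF p]\<close>)
  then show ?thesis by (simp add: permute_op_def)
qed

text \<open>On tuples with all entries congruent to \<open>1\<close> the operator \<open>T\<^sub>k\<close> is the Demazure-Lusztig operator; the formula is
multiplied by the difference of \<open>X\<^bsub>k+1\<^esub>\<close> and \<open>X\<^sub>k\<close> to clear the denominator. Both sides transform alike under the
lattice shifts, and for \<open>\<omega>\<close> itself they agree.\<close>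
lemma T_on_ones:
  fixes v :: "int list \<Rightarrow>\<^sub>0 'k" and k r :: nat
  defines "\<sigma> \<equiv> permute_op (transpose k (Suc k))" and "x \<equiv> xop k (- int n)" and "y \<equiv> xop (Suc k) (- int n)"
  assumes v: "v \<in> sp (\<lambda>i. length i = r \<and> (\<forall>s\<in>set i. cong_n s 1))" and k: "Suc k < r"
  shows "y (opT k v) - x (opT k v) = \<epsilon>^2 \<cdot> (y (\<sigma> v) - x (\<sigma> v)) + (\<epsilon>^2 - 1) \<cdot> (y v - y (\<sigma> v))"
proof -
  define D where "D v = y (opT k v) - x (opT k v) - (\<epsilon>^2 \<cdot> (y (\<sigma> v) - x (\<sigma> v)) + (\<epsilon>^2 - 1) \<cdot> (y v - y (\<sigma> v)))" for v
  have l\<sigma>: "lin \<sigma>" by (simp add: \<sigma>_def lin_permute_op)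
  note \<sigma>_lin = lin_rules[OF l\<sigma>]
  have lD: "lin D" unfolding lin_def D_def x_def y_def by (simp add: \<sigma>_lin algebra_simps pm_scale_distrib)
  have shift: "D (xop t (- int n) w) = xop (transpose k (Suc k) t) (- int n) (D w)" if w: "w \<in> tensor_space r" "t < r" for t w
  proof -
    note T = T_shift[OF w(1) k w(2)] and S = permute_shift[OF w(1) k w(2), of "- int n", folded \<sigma>_def]
    consider "t = k" | "t = Suc k" | "t \<noteq> k" "t \<noteq> Suc k" by blast
    then show ?thesis
    proof cases
      case 1
      show ?thesis unfolding D_def T S unfolding x_def y_def 1
        by (simp add: xop_commute[of "Suc k" _ k] algebra_simps pm_scale_distrib)
    next
      case 2
      show ?thesis unfolding D_def T S unfolding x_def y_def 2
        by (simp add: xop_commute[of "Suc k" _ k] algebra_simps pm_scale_distrib)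
    next
      case 3
      show ?thesis unfolding D_def T S unfolding x_def y_def
        using 3 by (simp add: xop_commute[of _ _ t] algebra_simps pm_scale_distrib)
    qed
  qed
  have "(\<forall>s\<in>set i. cong_n s 1) \<longrightarrow> D (basis_vec i) = 0" if "length i = r" for i
  proof (rule base_lists_suffice[of _ "\<lambda>i. (\<forall>s\<in>set i. cong_n s 1) \<longrightarrow> D (basis_vec i) = 0", OF _ _ that])
    fix i :: "int list" assume i: "length i = r" "set i \<subseteq> {1..int n}"
    show "(\<forall>s\<in>set i. cong_n s 1) \<longrightarrow> D (basis_vec i) = 0"
    proof
      assume "\<forall>s\<in>set i. cong_n s 1"
      then have i: "i = replicate r 1" by (rule base_ones[OF i])
      show "D (basis_vec i) = 0"
        unfolding i D_def \<sigma>_def T_ones[OF k] permute_ones[OF k] by (simp add: x_def y_def pm_scale_distrib)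
    qed
  next
    fix xs ys and a :: int assume len: "length (xs @ a # ys) = r"
    have "xop (length xs) (- int n) (basis_vec (xs @ a # ys)) = basis_vec (xs @ (a - int n) # ys)"
      by (simp add: xop_basis list_update_append)
    moreover have "(basis_vec (xs @ a # ys) :: int list \<Rightarrow>\<^sub>0 'k) \<in> tensor_space r" "length xs < r" using len by (auto simp: tensor_space_eq_sp)
    ultimately have "D (basis_vec (xs @ (a - int n) # ys)) = 0 \<longleftrightarrow> D (basis_vec (xs @ a # ys)) = 0"
      using shift[of "basis_vec (xs @ a # ys)" "length xs"] by simp
    then show "((\<forall>s\<in>set (xs @ (a - int n) # ys). cong_n s 1) \<longrightarrow> D (basis_vec (xs @ (a - int n) # ys)) = 0)
      = ((\<forall>s\<in>set (xs @ a # ys). cong_n s 1) \<longrightarrow> D (basis_vec (xs @ a # ys)) = 0)" by simp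
  qed
  then have "D v = 0" using lin_eq_on_sp[OF lD lin_const_zero _ v] by simp
  then show ?thesis by (simp add: D_def)
qed

text \<open>If \<open>T\<^sub>k v = \<epsilon>\<^sup>2 v\<close>, then \<open>T_on_ones\<close> says that \<open>d = v - \<sigma> v\<close>, with \<open>\<sigma>\<close> the transposition, is an eigenvector of a
lattice shift. So \<open>d = 0\<close>.\<close>
lemma T_eigenvector_symmetric:
  assumes v: "v \<in> sp (\<lambda>i. length i = r \<and> (\<forall>s\<in>set i. cong_n s 1))"
    and T: "\<And>k. Suc k < r \<Longrightarrow> opT k v = \<epsilon>^2 \<cdot> v"
    and ij: "length i = r" "mset i = mset j"
  shows "Poly_Mapping.lookup v i = Poly_Mapping.lookup v j"
proof -
  have ts: "v \<in> tensor_space r" using v by (auto simp: tensor_space_def sp_def)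
  have fixed: "permute_op (transpose k (Suc k)) v = v" if k: "Suc k < r" for k
  proof -
    define \<sigma> :: "(int list \<Rightarrow>\<^sub>0 'k) \<Rightarrow> (int list \<Rightarrow>\<^sub>0 'k)" where "\<sigma> = permute_op (transpose k (Suc k))"
    define d where "d = v - \<sigma> v"
    have "\<sigma> v \<in> tensor_space r"
      unfolding \<sigma>_def permute_op_def tensor_space_eq_sp
      by (rule lin_maps_sp[OF lin_linear_ext ts[unfolded tensor_space_eq_sp]]) simp
    then have d: "d \<in> tensor_space r" unfolding d_def using ts by (rule ts_intro(2)[rotated])
    have "xop (Suc k) (- int n) d = \<epsilon>^2 \<cdot> xop k (- int n) d"
      using T_on_ones[OF v k, folded \<sigma>_def] unfolding T[OF k] d_def
      by (simp add: algebra_simps pm_scale_distrib)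
    then have "d = 0" by (rule shift_eigenvector_zero[OF d k])
    then show ?thesis by (simp add: d_def \<sigma>_def)
  qed
  have swap: "Poly_Mapping.lookup v (xs @ b # a # ys) = Poly_Mapping.lookup v (xs @ a # b # ys)"
    if "length (xs @ a # b # ys) = r" for xs ys a b
  proof -
    define k where "k = length xs"
    have k: "Suc k < r" using that by (simp add: k_def)
    have p: "transpose k (Suc k) permutes {..<r}" using k by (intro permutes_swap_id) auto
    have pl: "permute_list (transpose k (Suc k)) (xs @ a # b # ys) = xs @ b # a # ys"
    proof (rule nth_equalityI)
      fix s assume "s < length (permute_list (transpose k (Suc k)) (xs @ a # b # ys))"
      then have s: "s < r" "transpose k (Suc k) permutes {..<length (xs @ a # b # ys)}" using that p by simp_all
      consider "s < k" | "s = k" | "s = Suc k" | m where "s = Suc (Suc (k + m))"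
        by (metis less_iff_Suc_add linorder_neqE_nat not_less_eq add_Suc)
      then show "permute_list (transpose k (Suc k)) (xs @ a # b # ys) ! s = (xs @ b # a # ys) ! s"
        using s that by cases (simp_all add: permute_list_nth[OF s(2)] transpose_def nth_append flip: k_def)
    qed simp
    have inj: "inj_on (permute_list (transpose k (Suc k))) (insert (xs @ a # b # ys) (Poly_Mapping.keys v))"
    proof (rule inj_on_inverseI)
      fix i :: "int list" assume "i \<in> insert (xs @ a # b # ys) (Poly_Mapping.keys v)"
      then have "length i = r" using that ts by (auto simp: tensor_space_def)
      then show "permute_list (transpose k (Suc k)) (permute_list (transpose k (Suc k)) i) = i"
        using permute_list_compose[of "transpose k (Suc k)" i "transpose k (Suc k)"] p by simp
    qed
    show ?thesis using lookup_linear_ext_inj[OF inj] unfolding permute_op_def[symmetric] fixed[OF k] pl .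
  qed
  have "length j = r \<and> Poly_Mapping.lookup v j = Poly_Mapping.lookup v i"
    by (rule swap_closed_perm[of "\<lambda>l. length l = r \<and> Poly_Mapping.lookup v l = Poly_Mapping.lookup v i", OF _ ij(2)])
      (use swap ij in auto)
  then show ?thesis by simp
qed

text \<open>\<open>K\<^sub>1\<close> acts on \<open>\<omega>\<^sub>i\<close> by \<open>\<epsilon>\<close> to the number of entries congruent to \<open>1\<close>, and distinct powers of \<open>\<epsilon>\<close> are distinct.\<close>
lemma K_eigenvector_support:
  assumes v: "v \<in> tensor_space r" and K: "diag (Kf 1) v = \<epsilon> ^ r \<cdot> v"
  shows "v \<in> sp (\<lambda>i. length i = r \<and> (\<forall>s\<in>set i. cong_n s 1))"
  unfolding sp_def
proof (intro CollectI ballI)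
  fix i assume i: "i \<in> Poly_Mapping.keys v"
  have len: "length i = r" using v i by (auto simp: tensor_space_def)
  define N where "N = length (filter (\<lambda>s. cong_n s 1) i)"
  have "prod_list (map (Kf 1) i) = \<epsilon> ^ N" unfolding N_def by (induction i) (simp_all add: Kf_def)
  then have "\<epsilon> ^ N * Poly_Mapping.lookup v i = \<epsilon> ^ r * Poly_Mapping.lookup v i"
    using lookup_diag[of "Kf 1" v i] unfolding K by auto
  then have "\<epsilon> ^ N = \<epsilon> ^ r" using i by (simp add: in_keys_iff)
  moreover have N: "N \<le> r" unfolding N_def len[symmetric] by (rule length_filter_le)
  then have "\<epsilon> ^ r = \<epsilon> ^ N * \<epsilon> ^ (r - N)" by (simp flip: power_add)
  ultimately have "\<epsilon> ^ (r - N) = 1" using eps_nonzero by simp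
  then have "N = r" using eps_not_root[of "r - N"] N by (cases "r - N \<ge> 1") auto
  then have "\<forall>s\<in>set i. cong_n s 1" using length_filter_less[of _ i "\<lambda>s. cong_n s 1"] len unfolding N_def by auto
  then show "length i = r \<and> (\<forall>s\<in>set i. cong_n s 1)" using len by simp
qed

lemma commutant_central:
  assumes f: "f \<in> carrier (schur_alg n r \<epsilon>)"
    and fq: "\<And>g v. g \<in> qaff_gens n \<Longrightarrow> v \<in> tensor_space r \<Longrightarrow> f (qop g v) = qop g (f v)"
  shows "f \<in> zeta n r \<epsilon> ` central_subalg n \<epsilon>"
proof -
  have fE: "f \<in> carrier (tensor_End r)" and fh: "\<And>g v. g \<in> hecke_gens r \<Longrightarrow> v \<in> tensor_space r \<Longrightarrow> f (hecke_op g v) = hecke_op g (f v)"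
    using f by (auto simp: schur_carrier)
  \<comment> \<open>\<open>f\<close> is undefined outside the tensor power; extend it by zero to a linear map.\<close>
  define F where "F = linear_ext (\<lambda>i. if length i = r then f (basis_vec i) else 0)"
  have lF: "lin F" by (simp add: F_def lin_linear_ext)
  have fts: "f v \<in> tensor_space r" if "v \<in> tensor_space r" for v by (rule End_lin(3)[OF fE that that])
  have bts: "(basis_vec i :: int list \<Rightarrow>\<^sub>0 'k) \<in> tensor_space r" if "length i = r" for i using that by (simp add: tensor_space_eq_sp)
  have F_ts: "F v \<in> tensor_space r" if "v \<in> tensor_space r" for v
    unfolding tensor_space_eq_sp
    by (rule lin_maps_sp[OF lF that[unfolded tensor_space_eq_sp]]) (use fts bts in \<open>simp add: F_def flip: tensor_space_eq_sp\<close>)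
  have "f = (\<lambda>v\<in>tensor_space r. F v)"
  proof (rule End_eqI[OF fE])
    show "(\<lambda>v\<in>tensor_space r. F v) \<in> carrier (tensor_End r)"
      by (auto simp: tensor_End_def F_ts ts_sums lin_rules[OF lF])
    show "f (basis_vec i) = (\<lambda>v\<in>tensor_space r. F v) (basis_vec i)" if "length i = r" for i
      using that bts[OF that] by (simp add: F_def)
  qed
  then have Ff: "F v = f v" if "v \<in> tensor_space r" for v using that by simp
  define w :: "int list \<Rightarrow>\<^sub>0 'k" where "w = basis_vec (replicate r 1)"
  have w: "w \<in> tensor_space r" by (simp add: w_def tensor_space_eq_sp)
  have Kw: "diag (Kf 1) w = \<epsilon> ^ r \<cdot> w"
    unfolding w_def diag_basis by (simp add: Kf_def map_replicate prod_list_replicate)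
  have K: "diag (Kf 1) (f w) = \<epsilon> ^ r \<cdot> f w"
    using fq[of "K_gen 1", OF _ w] n_ge_2 Kw End_lin(2)[OF fE w w] by (auto simp: qaff_gens_def)
  have T: "opT k (f w) = \<epsilon>^2 \<cdot> f w" if "Suc k < r" for k
    using fh[of "T_gen (Suc k)", OF _ w] that T_ones[OF that] End_lin(2)[OF fE w w] by (auto simp: hecke_gens_def w_def)
  have supp: "f w \<in> sp (\<lambda>i. length i = r \<and> (\<forall>s\<in>set i. cong_n s 1))"
    by (rule K_eigenvector_support[OF fts[OF w] K])
  have "f w \<in> orbit r"
    by (rule symmetric_in_orbit[OF fts[OF w] supp T_eigenvector_symmetric[OF supp T]])
  then obtain p where p: "p \<in> sp (words_in zgens)" "f w = Q.pact p w" by (auto simp: orbit_def w_def)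
  have p': "p \<in> sp (words_in (qaff_gens n))" using p zgens_subset by (auto simp: sp_def)
  define g where "g v = F v - Q.pact p v" for v
  have "g v = 0" if "v \<in> tensor_space r" for v
  proof (rule commuting_map_zero[OF _ _ _ _ _ _ that])
    show "lin g" unfolding g_def by (intro lin_minus lF Q.lin_pact)
    show "g v \<in> tensor_space r" if "v \<in> tensor_space r" for v
      unfolding g_def using that by (intro ts_intro F_ts pact_ts)
    show "g (opE j v) = opE j (g v)" if v: "v \<in> tensor_space r" for j v
    proof -
      have "E_gen (j mod int n) \<in> qaff_gens n" using n_ge_2 by (simp add: qaff_gens_def)
      then have "f (opE j v) = opE j (f v)" using fq[of "E_gen (j mod int n)", OF _ v] by (simp add: E_mod)
      moreover have "opE j (Q.pact p v) = Q.pact p (opE j v)"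
        by (rule zgens_induct[OF p(1) _ _ _ v]) (simp_all add: Z_E)
      ultimately show ?thesis using v by (simp add: g_def Ff)
    qed
    show "g (xop t (- int n) v) = xop t (- int n) (g v)" if "t < r" and v: "v \<in> tensor_space r" for t v
    proof -
      have X: "X_gen (Suc t) \<in> hecke_gens r" using that by (auto simp: hecke_gens_def)
      show ?thesis using fh[OF X v] pact_hecke[OF p' X v] v by (simp add: g_def Ff)
    qed
    show "g (opT k v) = opT k (g v)" if "Suc k < r" and v: "v \<in> tensor_space r" for k v
    proof -
      have X: "T_gen (Suc k) \<in> hecke_gens r" using that by (auto simp: hecke_gens_def)
      show ?thesis using fh[OF X v] pact_hecke[OF p' X v] v by (simp add: g_def Ff)
    qed
    show "g (basis_vec (replicate r 1)) = 0" using p(2) w by (simp add: g_def Ff flip: w_def)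
  qed
  then have "f v = Q.pact p v" if "v \<in> tensor_space r" for v using that Ff[OF that] by (simp add: g_def)
  moreover have "f \<in> extensional (tensor_space r)" using fE by (simp add: tensor_End_def PiE_def)
  ultimately have "f = (\<lambda>v\<in>tensor_space r. Q.pact p v)"
    by (intro extensionalityI[of _ "tensor_space r"]) auto
  then show ?thesis using p(1) by (auto simp: zeta_image_central)
qed

text \<open>\<open>z\<^sub>m\<close> acts through the Hecke algebra, as a power sum of the \<open>X\<^sub>t\<close>.\<close>
lemma schur_Z:
  assumes f: "f \<in> carrier (schur_alg n r \<epsilon>)" and v: "v \<in> tensor_space r"
  shows "f (opZ m v) = opZ m (f v)"
proof -
  have fE: "f \<in> carrier (tensor_End r)" and fh: "\<And>g v. g \<in> hecke_gens r \<Longrightarrow> v \<in> tensor_space r \<Longrightarrow> f (hecke_op g v) = hecke_op g (f v)"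
    using f by (auto simp: schur_carrier)
  have fts: "f v \<in> tensor_space r" if "v \<in> tensor_space r" for v by (rule End_lin(3)[OF fE that that])
  have X: "f (xop t c v) = xop t c (f v)" if "t < r" "c = int n \<or> c = - int n" "v \<in> tensor_space r" for t c v
    using fh[of "X_gen (Suc t)" v] fh[of "Xinv_gen (Suc t)" v] that by (auto simp: hecke_gens_def)
  have Xm: "f (xop t (int m * c) v) = xop t (int m * c) (f v)" if "t < r" "c = int n \<or> c = - int n" for t c m
  proof (induction m)
    case (Suc m)
    have s: "int (Suc m) * c = int m * c + c" by (simp add: distrib_right)
    show ?case unfolding s
      using X[OF that, of "xop t (int m * c) v"] v Suc by simp
  qed simp
  have Xall: "f (xop t (- m * int n) v) = xop t (- m * int n) (f v)" if "t < r" for t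
  proof (cases "m \<ge> 0")
    case True then show ?thesis using Xm[OF that, of "- int n" "nat m"] by simp
  next
    case False then show ?thesis using Xm[OF that, of "int n" "nat (- m)"] by simp
  qed
  have sum: "f (\<Sum>t\<in>A. h t) = (\<Sum>t\<in>A. f (h t))" if "\<And>t. t \<in> A \<Longrightarrow> h t \<in> tensor_space r" "finite A" for h :: "nat \<Rightarrow> _" and A
    using that(2,1)
  proof (induction A rule: finite_induct)
    case empty
    have "f (0 \<cdot> v) = 0 \<cdot> f v" by (rule End_lin(2)[OF fE v v])
    then show ?case by simp
  next
    case (insert x A)
    then show ?case using End_lin(1)[OF fE, of "h x" "sum h A"] by (simp add: ts_intro)
  qed
  have "f (opZ m v) = (\<Sum>t<r. f (xop t (- m * int n) v))"
    unfolding Z_xop[OF v] by (rule sum) (use v in simp_all)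
  also have "\<dots> = (\<Sum>t<r. xop t (- m * int n) (f v))" by (rule sum.cong) (simp_all only: Xall lessThan_iff)
  also have "\<dots> = opZ m (f v)" by (rule Z_xop[OF fts[OF v], symmetric])
  finally show ?thesis .
qed

lemma centers:
  "zeta n r \<epsilon> ` alg_center (qaff_alg n \<epsilon>) = zeta n r \<epsilon> ` central_subalg n \<epsilon>"
  "zeta n r \<epsilon> ` central_subalg n \<epsilon> = alg_center (schur_alg n r \<epsilon>)"
proof -
  let ?U = "qaff_alg n \<epsilon>" and ?S = "schur_alg n r \<epsilon>" and ?Z = "zeta n r \<epsilon>"
  have hom: "?Z \<in> ring_hom ?U ?S" using zeta_hom by (simp add: alg_hom_def)
  have mult: "mult ?S = compose (tensor_space r)" by (simp add: schur_simps tensor_End_def)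
  have commutant: "f \<in> ?Z ` central_subalg n \<epsilon>"
    if f: "f \<in> carrier ?S" and comm: "\<And>x. x \<in> carrier ?U \<Longrightarrow> f \<otimes>\<^bsub>?S\<^esub> ?Z x = ?Z x \<otimes>\<^bsub>?S\<^esub> f" for f
  proof (rule commutant_central[OF f])
    fix g and v :: "int list \<Rightarrow>\<^sub>0 'k" assume g: "g \<in> qaff_gens n" and v: "v \<in> tensor_space r"
    from zeta_letter[OF g] obtain x where x: "x \<in> carrier ?U" "?Z x = (\<lambda>v\<in>tensor_space r. qop g v)" by blast
    have "f v \<in> tensor_space r" using f v End_lin(3)[of f r v v] by (simp add: schur_carrier)
    then show "f (qop g v) = qop g (f v)"
      using fun_cong[OF comm[OF x(1)], of v] v by (simp add: mult x(2) compose_def)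
  qed
  show "?Z ` alg_center ?U = ?Z ` central_subalg n \<epsilon>"
  proof (rule antisym)
    show "?Z ` alg_center ?U \<subseteq> ?Z ` central_subalg n \<epsilon>"
    proof (rule image_subsetI, rule commutant)
      fix z x assume z: "z \<in> alg_center ?U"
      then show "?Z z \<in> carrier ?S" using ring_hom_closed[OF hom] by (simp add: alg_center_def)
      assume "x \<in> carrier ?U"
      then show "?Z z \<otimes>\<^bsub>?S\<^esub> ?Z x = ?Z x \<otimes>\<^bsub>?S\<^esub> ?Z z"
        using z ring_hom_mult[OF hom, of z x] ring_hom_mult[OF hom, of x z] by (simp add: alg_center_def)
    qed
    show "?Z ` central_subalg n \<epsilon> \<subseteq> ?Z ` alg_center ?U" by (rule image_mono[OF central_subalg_central])
  qed
  show "?Z ` central_subalg n \<epsilon> = alg_center ?S"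
  proof (rule antisym)
    show "alg_center ?S \<subseteq> ?Z ` central_subalg n \<epsilon>"
      by (rule subsetI, rule commutant) (use ring_hom_closed[OF hom] in \<open>auto simp: alg_center_def\<close>)
    show "?Z ` central_subalg n \<epsilon> \<subseteq> alg_center ?S"
    proof
      fix z assume z: "z \<in> ?Z ` central_subalg n \<epsilon>"
      then obtain p where p: "p \<in> sp (words_in zgens)" "z = (\<lambda>v\<in>tensor_space r. Q.pact p v)"
        by (auto simp: zeta_image_central)
      have "z \<in> ?Z ` carrier ?U" using z central_subalg_central by (auto simp: alg_center_def)
      then have zS: "z \<in> carrier ?S" using ring_hom_closed[OF hom] by auto
      have "z \<otimes>\<^bsub>?S\<^esub> f = f \<otimes>\<^bsub>?S\<^esub> z" if f: "f \<in> carrier ?S" for f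
      proof (rule extensionalityI[of _ "tensor_space r"])
        fix v :: "int list \<Rightarrow>\<^sub>0 'k" assume v: "v \<in> tensor_space r"
        have fE: "f \<in> carrier (tensor_End r)" using f by (simp add: schur_carrier)
        have "f (Q.pact p v) = Q.pact p (f v)"
          by (rule zgens_induct[OF p(1) schur_Z[OF f] _ _ v]) (use End_lin[OF fE] in auto)
        then show "(z \<otimes>\<^bsub>?S\<^esub> f) v = (f \<otimes>\<^bsub>?S\<^esub> z) v"
          using v End_lin(3)[OF fE v v] by (simp add: mult compose_def p(2))
      qed (simp_all add: mult)
      then show "z \<in> alg_center ?S" using zS by (simp add: alg_center_def)
    qed
  qed
qed

end

theorem theorem7p2:
  fixes \<epsilon> :: "'k::field_char_0" and n r :: nat
  assumes "\<epsilon> \<noteq> 0"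
    and "\<forall>m\<ge>1. \<epsilon> ^ m \<noteq> 1"
    and "n \<ge> 2"
    and "r \<ge> 1"
  shows "zeta n r \<epsilon> ` alg_center (qaff_alg n \<epsilon>) = zeta n r \<epsilon> ` central_subalg n \<epsilon>
    \<and> zeta n r \<epsilon> ` central_subalg n \<epsilon> = alg_center (schur_alg n r \<epsilon>)"
proof -
  interpret affine_params \<epsilon> n
    using assms by unfold_locales auto
  show ?thesis using centers by simp
qed

end
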